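(* Let $d,p,q,r\in\mathbb{N}$, $A\in\mathbb{R}^{d\times d}$, $B\in\mathbb{R}^{d\times p}$, $C\in\mathbb{R}^{q\times d}$, $D\in\mathbb{R}^{q\times r}$, and consider the linear Gaussian filtering model $$X_t=X_0+\int_0^tAX_s\,ds+BW_t,\qquad Y_t=\int_0^tCX_s\,ds+DV_t,\qquad t\ge0,$$ where $W$ and $V$ are independent $p$- and $r$-dimensional Wiener processes, independent of $X_0$. Denote by $\mathbf{P}^\mu$ the law of $(X_t,Y_t)_{t\ge0}$ when $X_0\sim\mu\in P(\mathbb{R}^d)$. Then this model is uniformly observable, i.e., for all sequences $\{\mu_n\},\{\nu_n\}\subset P(\mathbb{R}^d)$ $$\|\mathbf{P}^{\mu_n}|_{\mathcal{F}^Y}-\mathbf{P}^{\nu_n}|_{\mathcal{F}^Y}\|_{\mathrm{TV}}\xrightarrow{n\to\infty}0\quad\text{implies}\quad\|\mu_n-\nu_n\|_{\mathrm{BL}}\xrightarrow{n\to\infty}0,$$ if and only if the pair $\{A,C\}$ is observable in the sense of linear systems theory, i.e., the $dq\times d$ matrix $$O(A,C)=\begin{bmatrix} C \\ C A \\ \vdots \\ C A^{d-1} \end{bmatrix}$$ has full rank.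
   Context: $P(\mathbb{R}^d)$ is the set of Borel probability measures on $\mathbb{R}^d$. $\mathcal F^Y$ is the $\sigma$-field generated by the observation process $(Y_t)_{t\ge0}$ (completed), so $\mathbf{P}^\mu|_{\mathcal F^Y}$ is the law of the path $(Y_t)_{t\ge0}$ when $X_0\sim\mu$. $\|\cdot\|_{\mathrm{TV}}$ is total variation distance, normalized as the supremum of differences of integrals of measurable functions with absolute value at most $1$. $\|\mu-\nu\|_{\mathrm{BL}}=\sup|\int f\,d\mu-\int f\,d\nu|$, the supremum being over all $f:\mathbb{R}^d\to\mathbb{R}$ with $\|f\|_\infty\le1$ and Lipschitz constant at most $1$. No invertibility assumptions are made on $B$ or $D$. *)

theory Defs
  imports "HOL-Probability.Probability"
begin

text \<open>
  Processes are functions of time in \<open>real\<close>, of which only the times \<open>t \<ge> 0\<close> matter. A path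
  space carries the product \<open>\<sigma>\<close>-field, generated by the coordinate maps.
\<close>

definition path_space :: "(real \<Rightarrow> 'b::topological_space) measure" where
  "path_space = (\<Pi>\<^sub>M t\<in>{0..}. borel)"

definition path :: "(real \<Rightarrow> 'w \<Rightarrow> 'b) \<Rightarrow> 'w \<Rightarrow> real \<Rightarrow> 'b" where
  "path Z \<omega> = (\<lambda>t\<in>{0..}. Z t \<omega>)"

definition process_events ::
    "'w measure \<Rightarrow> (real \<Rightarrow> 'w \<Rightarrow> 'b::topological_space) \<Rightarrow> 'w set set" where
  "process_events M Z = {path Z -` E \<inter> space M |E. E \<in> sets path_space}"

definition wiener_process :: "'w measure \<Rightarrow> (real \<Rightarrow> 'w \<Rightarrow> real^'n) \<Rightarrow> bool" where
  "wiener_process M W \<longleftrightarrow>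
     prob_space M \<and>
     (\<forall>t\<ge>0. W t \<in> borel_measurable M) \<and>
     (AE \<omega> in M. W 0 \<omega> = 0) \<and>
     (AE \<omega> in M. continuous_on {0..} (\<lambda>t. W t \<omega>)) \<and>
     (\<forall>(t::nat \<Rightarrow> real) m. 0 \<le> t 0 \<and> strict_mono t \<longrightarrow>
        prob_space.indep_vars M (\<lambda>_. borel) (\<lambda>i \<omega>. W (t (Suc i)) \<omega> - W (t i) \<omega>) {..<m}) \<and>
     (\<forall>s t. 0 \<le> s \<and> s < t \<longrightarrow>
        distributed M lborel (\<lambda>\<omega>. W t \<omega> - W s \<omega>)
          (\<lambda>x. ennreal (\<Prod>i\<in>UNIV. normal_density 0 (sqrt (t - s)) (x $ i))))"

text \<open>
  A realization of the model on the probability space \<open>M\<close>; the initial condition is the random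
  vector \<open>X 0\<close>. The noises need not have full rank. The integrals are gauge integrals;
  integrability of \<open>A *v X s \<omega>\<close> and continuity of \<open>W\<close> make \<open>X\<close> continuous almost surely, so they
  agree with the Riemann and Lebesgue integrals. The two independence conditions together state
  that \<open>X 0\<close>, \<open>W\<close> and \<open>V\<close> are mutually independent.
\<close>

definition linear_filtering_model ::
    "real^'d^'d \<Rightarrow> real^'p^'d \<Rightarrow> real^'d^'q \<Rightarrow> real^'r^'q \<Rightarrow> 'w measure \<Rightarrow>
     (real \<Rightarrow> 'w \<Rightarrow> real^'p) \<Rightarrow> (real \<Rightarrow> 'w \<Rightarrow> real^'r) \<Rightarrow>
     (real \<Rightarrow> 'w \<Rightarrow> real^'d) \<Rightarrow> (real \<Rightarrow> 'w \<Rightarrow> real^'q) \<Rightarrow> bool" where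
  "linear_filtering_model A B C D M W V X Y \<longleftrightarrow>
     wiener_process M W \<and> wiener_process M V \<and>
     (\<forall>t\<ge>0. X t \<in> borel_measurable M) \<and> (\<forall>t\<ge>0. Y t \<in> borel_measurable M) \<and>
     prob_space.indep_set M (process_events M W) (process_events M V) \<and>
     prob_space.indep_set M {X 0 -` E \<inter> space M |E. E \<in> sets borel}
       (process_events M (\<lambda>t \<omega>. (W t \<omega>, V t \<omega>))) \<and>
     (AE \<omega> in M. \<forall>t\<ge>0.
        (\<lambda>s. A *v X s \<omega>) integrable_on {0..t} \<and>
        X t \<omega> = X 0 \<omega> + integral {0..t} (\<lambda>s. A *v X s \<omega>) + B *v W t \<omega>) \<and>
     (AE \<omega> in M. \<forall>t\<ge>0.
        (\<lambda>s. C *v X s \<omega>) integrable_on {0..t} \<and>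
        Y t \<omega> = integral {0..t} (\<lambda>s. C *v X s \<omega>) + D *v V t \<omega>)"

definition signal_observation_law ::
    "'w measure \<Rightarrow> (real \<Rightarrow> 'w \<Rightarrow> 'a::topological_space) \<Rightarrow> (real \<Rightarrow> 'w \<Rightarrow> 'b::topological_space) \<Rightarrow>
     (real \<Rightarrow> 'a \<times> 'b) measure" where
  "signal_observation_law M X Y = distr M path_space (path (\<lambda>t \<omega>. (X t \<omega>, Y t \<omega>)))"

text \<open>
  The \<open>\<sigma>\<close>-field generated by the observations, on the path space of the pair. It is not completed:
  adding null sets does not change total variation distances.
\<close>

definition observation_field ::
    "(real \<Rightarrow> 'a::topological_space \<times> 'b::topological_space) measure" where
  "observation_field =
     vimage_algebra (space path_space) (path (\<lambda>t z. snd (z t))) path_space"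

definition borel_probabilities :: "('a::topological_space) measure set" where
  "borel_probabilities = {\<mu>. sets \<mu> = sets borel \<and> prob_space \<mu>}"

text \<open>Meaningful for probability measures \<open>P\<close>, \<open>Q\<close> on the same \<open>\<sigma>\<close>-field; takes values in [0,2].\<close>

definition tv_dist :: "'a measure \<Rightarrow> 'a measure \<Rightarrow> real" where
  "tv_dist P Q =
     (SUP f\<in>{f \<in> borel_measurable P. \<forall>x\<in>space P. \<bar>f x\<bar> \<le> 1}. \<bar>(\<integral>x. f x \<partial>P) - (\<integral>x. f x \<partial>Q)\<bar>)"

definition bl_dist :: "('a::metric_space) measure \<Rightarrow> 'a measure \<Rightarrow> real" where
  "bl_dist \<mu> \<nu> =
     (SUP f\<in>{f::'a \<Rightarrow> real. (\<forall>x. \<bar>f x\<bar> \<le> 1) \<and> 1-lipschitz_on UNIV f}.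
        \<bar>(\<integral>x. f x \<partial>\<mu>) - (\<integral>x. f x \<partial>\<nu>)\<bar>)"

text \<open>The argument \<open>P\<close> maps the initial law \<open>\<mu>\<close> to the law of the pair (signal, observation).\<close>

definition uniformly_observable ::
    "(('a::metric_space) measure \<Rightarrow> (real \<Rightarrow> 'a \<times> 'b::topological_space) measure) \<Rightarrow> bool" where
  "uniformly_observable P \<longleftrightarrow>
     (\<forall>\<mu> \<nu> :: nat \<Rightarrow> 'a measure.
        (\<forall>n. \<mu> n \<in> borel_probabilities) \<and> (\<forall>n. \<nu> n \<in> borel_probabilities) \<longrightarrow>
        (\<lambda>n. tv_dist (restr_to_subalg (P (\<mu> n)) observation_field)
                     (restr_to_subalg (P (\<nu> n)) observation_field)) \<longlonglongrightarrow> 0 \<longrightarrow>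
        (\<lambda>n. bl_dist (\<mu> n) (\<nu> n)) \<longlonglongrightarrow> 0)"

text \<open>The instance of \<open>times\<close> for vectors is componentwise, so \<open>A ^ k\<close> would not be a matrix power.\<close>

primrec matrix_pow :: "real^'d^'d \<Rightarrow> nat \<Rightarrow> real^'d^'d" where
  "matrix_pow A 0 = mat 1"
| "matrix_pow A (Suc k) = A ** matrix_pow A k"

text \<open>
  The rows are indexed by pairs (block, row of \<open>C\<close>). The function \<open>to_nat_on UNIV\<close> is a bijection
  from the index type \<open>'d\<close> onto \<open>{..<CARD('d)}\<close>, so the blocks are \<open>C A^k\<close> for \<open>k < CARD('d)\<close>, each
  occurring once.
\<close>

definition observability_matrix :: "real^'d^'d \<Rightarrow> real^'d^'q \<Rightarrow> real^'d^('d \<times> 'q)" where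
  "observability_matrix A C =
     (\<chi> ki. (C ** matrix_pow A (to_nat_on UNIV (fst ki))) $ snd ki)"

definition full_rank :: "real^'n^'m \<Rightarrow> bool" where
  "full_rank M \<longleftrightarrow> rank M = min CARD('m) CARD('n)"

end

theory Submission
  imports Defs
begin

text \<open>
  If \<open>C A\<^sup>k v = 0\<close> for all \<open>k\<close> and some \<open>v \<noteq> 0\<close>, then the observations have the same law under the
  initial laws \<open>\<delta>\<^sub>0\<close> and \<open>\<delta>\<^sub>v\<close>. Conversely, for an observable pair a linear combination of finitely
  many observations has the form \<open>X\<^sub>0 + \<eta>\<close> with a centred Gaussian \<open>\<eta>\<close> that is independent of \<open>X\<^sub>0\<close>
  and whose law does not depend on \<open>\<mu>\<close>. Hence the convolutions of \<open>\<mu>\<^sub>n - \<nu>\<^sub>n\<close> with the law of \<open>\<eta>\<close>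
  tend to 0 in total variation, and adding more independent noise, so do the convolutions with
  \<open>N(0, T I)\<close> for all large \<open>T\<close>. As functions of \<open>w = 1 / (2 T)\<close> the latter are, up to a factor,
  Laplace transforms \<open>\<integral> exp (- w s) \<kappa>\<^sub>n(ds)\<close> with uniform bounds, so that by Taylor expansion the
  convergence extends from small \<open>w\<close> to all \<open>w\<close>. For small \<open>T\<close> the convolution hardly changes the
  integrals of bounded Lipschitz functions. The law of \<open>\<eta>\<close> is obtained from an Euler scheme, which
  expresses the noise part of the observations as a pathwise limit of linear combinations of
  increments of the Wiener processes.
\<close>

section \<open>Gaussian measures on Euclidean space\<close>

text \<open>The obstacle is that the sequences \<open>\<mu> n\<close> and \<open>\<nu> n\<close>
  need not be tight. Convergence of characteristic functions, hence division by that of the noise,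
  would then say nothing about the bounded Lipschitz distance. So every estimate is uniform over
  test functions that may change with \<open>n\<close>, and the passage from large to small
  variances concerns functionals bounded uniformly in \<open>n\<close>. Extra noise makes the
  variance isotropic because the Gaussian density is then an exponential of the squared norm with
  the single parameter \<open>w\<close>, up to a factor. As \<open>B\<close> and \<open>D\<close>
  are arbitrary, \<open>\<eta>\<close> may be degenerate: it is described only by its characteristic
  function, and densities appear after nondegenerate noise has been added. Every initial law has its
  own realization of the model, so a common law of \<open>\<eta>\<close> has to be proved. The Euler
  scheme yields noise characteristic functions that depend on the matrices alone; the realization
  started at \<open>0\<close> shows that they converge to a characteristic function.\<close>

abbreviation gauss_density :: "('n::finite \<Rightarrow> real) \<Rightarrow> real^'n \<Rightarrow> real" where
  "gauss_density \<sigma> x \<equiv> \<Prod>i\<in>UNIV. normal_density 0 (\<sigma> i) (x $ i)"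

definition gauss :: "('n::finite \<Rightarrow> real) \<Rightarrow> (real^'n) measure" where
  "gauss \<sigma> = density lborel (\<lambda>x. ennreal (gauss_density \<sigma> x))"

lemma borel_measurable_vec_nth [measurable]: "(\<lambda>x::real^'n. x $ i) \<in> borel_measurable borel"
  by (intro borel_measurable_continuous_onI continuous_intros)

lemma borel_measurable_vec_lambda [measurable]:
  fixes N :: "'n::finite \<Rightarrow> real measure"
  assumes [measurable_cong]: "\<And>i. sets (N i) = sets borel"
  shows "(\<lambda>g. \<chi> i. g i) \<in> borel_measurable (PiM UNIV N)"
proof (subst borel_measurable_euclidean_space)
  show "\<forall>b\<in>Basis. (\<lambda>g. (\<chi> i. g i) \<bullet> (b::real^'n)) \<in> borel_measurable (PiM UNIV N)"
    by (auto simp: Basis_vec_def inner_axis)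
qed

text \<open>Agreement on boxes determines Lebesgue measure. This transfers the product integral
  formulas for \<open>PiM\<close> to \<open>real^'n\<close>.\<close>

lemma lborel_eq_distr_PiM:
  "(lborel :: (real^'n) measure) = distr (PiM UNIV (\<lambda>_::'n. lborel)) borel (\<lambda>g. \<chi> i. g i)"
proof (rule lborel_eqI)
  interpret product_sigma_finite "\<lambda>_::'n. lborel :: real measure" ..
  fix l u :: "real^'n" assume lu: "\<And>b. b \<in> Basis \<Longrightarrow> l \<bullet> b \<le> u \<bullet> b"
  have le: "l $ i \<le> u $ i" for i using lu[of "axis i 1"] by (simp add: inner_axis axis_in_Basis_iff)
  have "emeasure (distr (PiM UNIV (\<lambda>_::'n. lborel)) borel (\<lambda>g. \<chi> i. g i)) (box l u) =
     emeasure (PiM UNIV (\<lambda>_::'n. lborel)) (PiE UNIV (\<lambda>i. {l $ i <..< u $ i}))"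
    by (subst emeasure_distr) (auto simp: space_PiM mem_box_cart PiE_iff intro!: arg_cong2[where f=emeasure])
  also have "\<dots> = (\<Prod>i\<in>UNIV. ennreal (u $ i - l $ i))"
    by (subst emeasure_PiM) (auto simp: le)
  also have "\<dots> = ennreal (\<Prod>i\<in>UNIV. u $ i - l $ i)"
    by (rule prod_ennreal) (simp add: le)
  also have "(\<Prod>i\<in>UNIV. u $ i - l $ i) = (\<Prod>b\<in>Basis. (u - l) \<bullet> b)"
  proof -
    have inj: "inj (\<lambda>i::'n. axis i (1::real))" by (auto simp: inj_on_def axis_eq_axis)
    have B: "(Basis :: (real^'n) set) = (\<lambda>i. axis i 1) ` UNIV" by (auto simp: Basis_vec_def)
    show ?thesis unfolding B by (subst prod.reindex[OF inj]) (simp add: inner_axis)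
  qed
  finally show "emeasure (distr (PiM UNIV (\<lambda>_::'n. lborel)) borel (\<lambda>g. \<chi> i. g i)) (box l u) =
     ennreal (\<Prod>b\<in>Basis. (u - l) \<bullet> b)" .
qed simp

lemma nn_integral_lborel_vec_prod:
  assumes [measurable]: "\<And>i::'n. f i \<in> borel_measurable borel"
  shows "(\<integral>\<^sup>+x. (\<Prod>i\<in>UNIV. f i ((x::real^'n) $ i)) \<partial>lborel) = (\<Prod>i\<in>UNIV. (\<integral>\<^sup>+x. f i x \<partial>lborel))"
proof -
  interpret product_sigma_finite "\<lambda>_::'n. lborel :: real measure" ..
  show ?thesis
    by (subst lborel_eq_distr_PiM, subst nn_integral_distr) (auto intro!: product_nn_integral_prod)
qed

lemma sets_gauss [simp, measurable_cong]: "sets (gauss \<sigma>) = sets borel"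
  and space_gauss [simp]: "space (gauss \<sigma>) = UNIV"
  by (auto simp: gauss_def)

lemma gauss_eq_distr_PiM:
  fixes \<sigma> :: "'n::finite \<Rightarrow> real"
  assumes pos: "\<And>i. 0 < \<sigma> i"
  shows "gauss \<sigma> = distr (PiM UNIV (\<lambda>i. density lborel (normal_density 0 (\<sigma> i)))) borel (\<lambda>g. \<chi> i. g i)"
proof -
  let ?N = "\<lambda>i. density lborel (normal_density 0 (\<sigma> i))"
  interpret N: product_prob_space ?N UNIV
    by (intro product_prob_spaceI prob_space_normal_density pos)
  have s: "sets (PiM UNIV ?N) = sets (PiM UNIV (\<lambda>_. borel))" by (intro sets_PiM_cong) auto
  have m' [measurable]: "(\<lambda>x::real^'n. \<lambda>i. x $ i) \<in> measurable borel (PiM UNIV ?N)"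
    by (subst measurable_cong_sets[OF refl s]) (rule measurable_PiM_single', auto)
  \<comment> \<open>A product measure is characterized by its values on rectangles, so the inverse
    coordinate map is treated first; pushing forward along \<open>vec_lambda\<close> then gives the
    claim.\<close>
  have "PiM UNIV ?N = distr (gauss \<sigma>) (PiM UNIV ?N) (\<lambda>x. \<lambda>i. x $ i)"
  proof (rule N.PiM_eqI[symmetric])
    fix A assume A: "\<And>i. i \<in> UNIV \<Longrightarrow> A i \<in> sets (?N i)"
    have [measurable]: "\<And>i. A i \<in> sets borel" using A by auto
    have ge: "(\<Prod>i\<in>UNIV. normal_density 0 (\<sigma> i) ((x::real^'n) $ i)) \<ge> 0" for x by (intro prod_nonneg) auto
    have "emeasure (distr (gauss \<sigma>) (PiM UNIV ?N) (\<lambda>x. \<lambda>i. x $ i)) (Pi\<^sub>E UNIV A) =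
        emeasure (gauss \<sigma>) {x. \<forall>i. x $ i \<in> A i}"
      using A by (subst emeasure_distr) (auto simp: PiE_iff intro!: sets_PiM_I_finite arg_cong2[where f=emeasure])
    also have "\<dots> = (\<integral>\<^sup>+x. (\<Prod>i\<in>UNIV. ennreal (normal_density 0 (\<sigma> i) (x $ i)) * indicator (A i) (x $ i)) \<partial>lborel)"
      unfolding gauss_def
      by (subst emeasure_density)
        (auto intro!: nn_integral_cong simp: prod.distrib prod_ennreal indicator_def prod_zero_iff split: if_splits)
    also have "\<dots> = (\<Prod>i\<in>UNIV. (\<integral>\<^sup>+x. ennreal (normal_density 0 (\<sigma> i) x) * indicator (A i) x \<partial>lborel))"
      by (rule nn_integral_lborel_vec_prod) auto
    also have "\<dots> = (\<Prod>i\<in>UNIV. emeasure (?N i) (A i))"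
      by (auto simp: emeasure_density)
    finally show "emeasure (distr (gauss \<sigma>) (PiM UNIV ?N) (\<lambda>x. \<lambda>i. x $ i)) (Pi\<^sub>E UNIV A) =
      (\<Prod>i\<in>UNIV. emeasure (?N i) (A i))" .
  qed auto
  then have "distr (PiM UNIV ?N) borel (\<lambda>g. \<chi> i. g i) = distr (distr (gauss \<sigma>) (PiM UNIV ?N) (\<lambda>x. \<lambda>i. x $ i)) borel (\<lambda>g. \<chi> i. g i)"
    by simp
  also have "\<dots> = distr (gauss \<sigma>) borel (\<lambda>x. x)"
    by (subst distr_distr) (auto simp: comp_def)
  also have "\<dots> = gauss \<sigma>" by (rule distr_id2) auto
  finally show ?thesis by simp
qed

lemma prob_space_gauss:
  assumes "\<And>i. 0 < \<sigma> i" shows "prob_space (gauss \<sigma>)"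
proof -
  let ?N = "\<lambda>i. density lborel (normal_density 0 (\<sigma> i))"
  interpret N: product_prob_space ?N UNIV
    by (intro product_prob_spaceI prob_space_normal_density assms)
  show ?thesis unfolding gauss_eq_distr_PiM[OF assms]
    by (rule N.prob_space_distr) auto
qed

lemma integral_gauss_prod:
  fixes h :: "'n::finite \<Rightarrow> real \<Rightarrow> 'b::{real_normed_field,banach,second_countable_topology}"
  assumes pos: "\<And>i. 0 < \<sigma> i"
    and int: "\<And>i. integrable (density lborel (normal_density 0 (\<sigma> i))) (h i)"
  shows "(\<integral>x. (\<Prod>i\<in>UNIV. h i (x $ i)) \<partial>gauss \<sigma>) = (\<Prod>i\<in>UNIV. (\<integral>x. h i x \<partial>density lborel (normal_density 0 (\<sigma> i))))"
proof -
  let ?N = "\<lambda>i. density lborel (normal_density 0 (\<sigma> i))"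
  interpret N: product_prob_space ?N UNIV
    by (intro product_prob_spaceI prob_space_normal_density pos)
  have [measurable]: "h i \<in> borel_measurable borel" for i using borel_measurable_integrable[OF int[of i]] by simp
  show ?thesis
    unfolding gauss_eq_distr_PiM[OF pos]
    by (subst integral_distr) (auto intro!: N.product_integral_prod int)
qed

lemma integral_normal_char:
  assumes s: "0 < s"
  shows "(\<integral>x. iexp (t * x) \<partial>density lborel (normal_density 0 s)) = of_real (exp (- (s * t)\<^sup>2 / 2))"
proof -
  have "(\<integral>x. iexp (t * x) \<partial>density lborel (normal_density 0 s)) =
    (\<integral>x. normal_density 0 s x *\<^sub>R iexp (t * x) \<partial>lborel)"
    by (subst integral_density) auto
  \<comment> \<open>The substitution by the factor \<open>s\<close> reduces the claim to the known
    characteristic function of the standard normal law.\<close>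
  also have "\<dots> = s *\<^sub>R (\<integral>x. normal_density 0 s (s * x) *\<^sub>R iexp (t * (s * x)) \<partial>lborel)"
    using s by (subst lborel_integral_real_affine[where c=s and t=0]) auto
  also have "\<dots> = (\<integral>x. std_normal_density x *\<^sub>R iexp ((s * t) * x) \<partial>lborel)"
    using s by (subst integral_scaleR_right[symmetric])
      (auto intro!: Bochner_Integration.integral_cong simp: normal_density_def power_mult_distrib real_sqrt_mult mult_ac)
  also have "\<dots> = char std_normal_distribution (s * t)"
    unfolding char_def by (subst integral_density) auto
  finally show ?thesis by (simp add: char_std_normal_distribution)
qed

lemma exp_i_sum: "finite I \<Longrightarrow> iexp (\<Sum>i\<in>I. a i) = (\<Prod>i\<in>I. iexp (a i))"
  by (simp add: sum_distrib_left exp_sum)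

lemma integral_gauss_char:
  fixes u :: "real^'n"
  assumes pos: "\<And>i. 0 < \<sigma> i"
  shows "(\<integral>x. iexp (u \<bullet> x) \<partial>gauss \<sigma>) = of_real (exp (- (\<Sum>i\<in>UNIV. (\<sigma> i * u $ i)\<^sup>2) / 2))"
proof -
  have i: "integrable (density lborel (normal_density 0 (\<sigma> i))) (\<lambda>x. iexp (u $ i * x))" for i
  proof -
    interpret prob_space "density lborel (normal_density 0 (\<sigma> i))" by (rule prob_space_normal_density[OF pos])
    show ?thesis by (rule integrable_const_bound[where B=1]) (auto simp: norm_exp_i_times)
  qed
  have "(\<integral>x. iexp (u \<bullet> x) \<partial>gauss \<sigma>) = (\<integral>x. (\<Prod>i\<in>UNIV. iexp (u $ i * x $ i)) \<partial>gauss \<sigma>)"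
    by (simp add: inner_vec_def sum_distrib_left exp_sum)
  also have "\<dots> = (\<Prod>i\<in>UNIV. of_real (exp (- (\<sigma> i * u $ i)\<^sup>2 / 2)))"
    by (subst integral_gauss_prod[OF pos i]) (simp only: integral_normal_char[OF pos])
  also have "\<dots> = of_real (exp (- (\<Sum>i\<in>UNIV. (\<sigma> i * u $ i)\<^sup>2) / 2))"
    by (simp add: exp_sum[symmetric] sum_divide_distrib[symmetric] sum_negf flip: of_real_prod)
  finally show ?thesis .
qed

section \<open>Fourier inversion for Gaussian smoothing\<close>

text \<open>Fourier inversion for the variance \<open>\<sigma>\<^sup>2 + R\<close>. The part of the
  characteristic function that belongs to \<open>\<sigma>\<^sup>2\<close> is absorbed into the
  normal law with standard deviation \<open>1 / \<sigma>\<close>, so that a bounded function is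
  integrated against a probability measure.\<close>

lemma normal_density_Fourier:
  assumes s: "0 < \<sigma>" and R: "0 \<le> R"
  shows "complex_of_real (normal_density 0 (sqrt (\<sigma>\<^sup>2 + R)) y) =
    of_real (1 / (\<sigma> * sqrt (2 * pi))) *
    (\<integral>u. iexp (y * u) * of_real (exp (- (R * u\<^sup>2 / 2))) \<partial>density lborel (normal_density 0 (1 / \<sigma>)))"
proof -
  define S where "S = sqrt (\<sigma>\<^sup>2 + R)"
  have S: "0 < S" "S\<^sup>2 = \<sigma>\<^sup>2 + R" using s R unfolding S_def
    by (auto intro!: add_pos_nonneg)
  have eq: "normal_density 0 (1 / \<sigma>) u * exp (- (R * u\<^sup>2 / 2)) = (\<sigma> / S) * normal_density 0 (1 / S) u" for u
  proof -
    have "normal_density 0 (1 / \<sigma>) u * exp (- (R * u\<^sup>2 / 2)) =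
       \<sigma> / sqrt (2 * pi) * (exp (- (u\<^sup>2 * \<sigma>\<^sup>2 / 2)) * exp (- (R * u\<^sup>2 / 2)))"
      using s by (simp add: normal_density_def real_sqrt_divide power_divide real_sqrt_mult field_simps)
    also have "exp (- (u\<^sup>2 * \<sigma>\<^sup>2 / 2)) * exp (- (R * u\<^sup>2 / 2)) = exp (- (u\<^sup>2 * S\<^sup>2 / 2))"
      unfolding S by (simp add: exp_add[symmetric] field_simps)
    also have "\<sigma> / sqrt (2 * pi) * exp (- (u\<^sup>2 * S\<^sup>2 / 2)) = (\<sigma> / S) * normal_density 0 (1 / S) u"
      using S(1) by (simp add: normal_density_def real_sqrt_divide power_divide real_sqrt_mult field_simps)
    finally show ?thesis .
  qed
  have "(\<integral>u. iexp (y * u) * of_real (exp (- (R * u\<^sup>2 / 2))) \<partial>density lborel (normal_density 0 (1 / \<sigma>)))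
     = (\<integral>u. (normal_density 0 (1 / \<sigma>) u) *\<^sub>R (iexp (y * u) * of_real (exp (- (R * u\<^sup>2 / 2)))) \<partial>lborel)"
    by (subst integral_density) auto
  also have "\<dots> = (\<integral>u. (\<sigma> / S) *\<^sub>R (normal_density 0 (1 / S) u *\<^sub>R iexp (y * u)) \<partial>lborel)"
  proof (rule Bochner_Integration.integral_cong[OF refl])
    fix u
    have "(normal_density 0 (1 / \<sigma>) u) *\<^sub>R (iexp (y * u) * complex_of_real (exp (- (R * u\<^sup>2 / 2))))
      = (normal_density 0 (1 / \<sigma>) u * exp (- (R * u\<^sup>2 / 2))) *\<^sub>R iexp (y * u)"
      by (simp add: scaleR_conv_of_real mult_ac del: of_real_exp)
    then show "(normal_density 0 (1 / \<sigma>) u) *\<^sub>R (iexp (y * u) * complex_of_real (exp (- (R * u\<^sup>2 / 2))))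
      = (\<sigma> / S) *\<^sub>R (normal_density 0 (1 / S) u *\<^sub>R iexp (y * u))"
      unfolding eq by simp
  qed
  also have "\<dots> = (\<sigma> / S) *\<^sub>R (\<integral>u. iexp (y * u) \<partial>density lborel (normal_density 0 (1 / S)))"
    by (subst integral_density, simp, simp, simp, simp only: integral_scaleR_right)
  also have "\<dots> = of_real (\<sigma> / S * exp (- (y / S)\<^sup>2 / 2))"
    using S(1) by (subst integral_normal_char) (auto simp: scaleR_conv_of_real simp del: of_real_exp)
  also have "of_real (1 / (\<sigma> * sqrt (2 * pi))) * \<dots> = complex_of_real (normal_density 0 S y)"
    using s S(1) unfolding of_real_mult[symmetric]
    by (intro arg_cong[where f=of_real]) (simp add: normal_density_def real_sqrt_mult field_simps)
  finally show ?thesis unfolding S_def ..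
qed

lemma integrable_bounded_prob:
  fixes f :: "'a \<Rightarrow> 'b::{banach, second_countable_topology}"
  assumes "prob_space M" "f \<in> borel_measurable M" "\<And>x. norm (f x) \<le> B"
  shows "integrable M f"
proof -
  interpret prob_space M by fact
  show ?thesis using assms(2,3) by (intro integrable_const_bound[where B=B]) auto
qed

lemma gauss_density_Fourier:
  fixes y :: "real^'n"
  assumes s: "\<And>i. 0 < \<sigma> i" and R: "\<And>i. 0 \<le> R i"
  shows "complex_of_real (gauss_density (\<lambda>i. sqrt ((\<sigma> i)\<^sup>2 + R i)) y) =
    of_real (\<Prod>i\<in>UNIV. 1 / (\<sigma> i * sqrt (2 * pi))) *
    (\<integral>u. iexp (u \<bullet> y) * of_real (exp (- (\<Sum>i\<in>UNIV. R i * (u $ i)\<^sup>2) / 2)) \<partial>gauss (\<lambda>i. 1 / \<sigma> i))"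
proof -
  let ?h = "\<lambda>i u. iexp (y $ i * u) * of_real (exp (- (R i * u\<^sup>2 / 2)))"
  have pos: "0 < 1 / \<sigma> i" for i using s by auto
  have int: "integrable (density lborel (normal_density 0 (1 / \<sigma> i))) (?h i)" for i
  proof (rule integrable_bounded_prob[where B=1])
    show "norm (?h i u) \<le> 1" for u
      using R[of i] unfolding norm_mult norm_exp_i_times norm_of_real by simp
  qed (auto intro!: prob_space_normal_density pos)
  have "complex_of_real (gauss_density (\<lambda>i. sqrt ((\<sigma> i)\<^sup>2 + R i)) y) =
     of_real (\<Prod>i\<in>UNIV. 1 / (\<sigma> i * sqrt (2 * pi))) *
     (\<Prod>i\<in>UNIV. (\<integral>u. ?h i u \<partial>density lborel (normal_density 0 (1 / \<sigma> i))))"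
    unfolding of_real_prod prod.distrib[symmetric]
    by (intro prod.cong refl normal_density_Fourier s R)
  also have "(\<Prod>i\<in>UNIV. (\<integral>u. ?h i u \<partial>density lborel (normal_density 0 (1 / \<sigma> i)))) =
      (\<integral>u. (\<Prod>i\<in>UNIV. ?h i (u $ i)) \<partial>gauss (\<lambda>i. 1 / \<sigma> i))"
    by (rule integral_gauss_prod[symmetric, OF pos int])
  also have "(\<lambda>u. \<Prod>i\<in>UNIV. ?h i (u $ i)) = (\<lambda>u. iexp (u \<bullet> y) *
      of_real (exp (- (\<Sum>i\<in>UNIV. R i * (u $ i)\<^sup>2) / 2)))"
    by (rule ext) (simp add: inner_vec_def sum_distrib_left exp_sum prod.distrib mult_ac sum_negf[symmetric] sum_divide_distrib)
  finally show ?thesis .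
qed

section \<open>Characteristic functions and convolutions with nondegenerate Gaussians\<close>

definition vchar :: "(real^'n) measure \<Rightarrow> real^'n \<Rightarrow> complex" where
  "vchar \<mu> u = (\<integral>x. iexp (u \<bullet> x) \<partial>\<mu>)"

lemma borel_probabilitiesD:
  assumes "\<mu> \<in> borel_probabilities"
  shows "prob_space \<mu>" "sets \<mu> = sets borel" "space \<mu> = UNIV"
  using assms sets_eq_imp_space_eq[of \<mu> borel] by (auto simp: borel_probabilities_def)

lemma gauss_prob: "(\<And>i. 0 < \<sigma> i) \<Longrightarrow> gauss \<sigma> \<in> borel_probabilities"
  by (simp add: borel_probabilities_def prob_space_gauss)

lemma convolution_prob:
  fixes \<mu> \<nu> :: "(real^'n) measure"
  assumes "\<mu> \<in> borel_probabilities" "\<nu> \<in> borel_probabilities"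
  shows "(\<mu> \<star> \<nu>) \<in> borel_probabilities"
proof -
  note [measurable_cong] = borel_probabilitiesD(2)[OF assms(1)] borel_probabilitiesD(2)[OF assms(2)]
  interpret M: prob_space \<mu> by (rule borel_probabilitiesD[OF assms(1)])
  interpret N: prob_space \<nu> by (rule borel_probabilitiesD[OF assms(2)])
  interpret pair_prob_space \<mu> \<nu> ..
  show ?thesis unfolding borel_probabilities_def convolution_def
    by (auto intro!: prob_space_distr)
qed

lemma integral_convolution:
  fixes \<mu> \<nu> :: "(real^'n) measure" and f :: "real^'n \<Rightarrow> 'b::{banach, second_countable_topology}"
  assumes "\<mu> \<in> borel_probabilities" "\<nu> \<in> borel_probabilities"
    and [measurable]: "f \<in> borel_measurable borel" and B: "\<And>x. norm (f x) \<le> B"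
  shows "(\<integral>x. f x \<partial>(\<mu> \<star> \<nu>)) = (\<integral>x. (\<integral>y. f (x + y) \<partial>\<nu>) \<partial>\<mu>)"
proof -
  note [measurable_cong] = borel_probabilitiesD(2)[OF assms(1)] borel_probabilitiesD(2)[OF assms(2)]
  interpret M: prob_space \<mu> by (rule borel_probabilitiesD[OF assms(1)])
  interpret N: prob_space \<nu> by (rule borel_probabilitiesD[OF assms(2)])
  interpret pair_prob_space \<mu> \<nu> ..
  have int: "integrable (\<mu> \<Otimes>\<^sub>M \<nu>) (case_prod (\<lambda>x y. f (x + y)))"
    by (rule integrable_bounded_prob[where B=B]) (auto simp: B intro: prob_space_axioms)
  show ?thesis unfolding convolution_def
    using integral_fst[OF int] by (simp add: integral_distr case_prod_unfold)
qed

lemma vchar_convolution: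
  assumes "\<mu> \<in> borel_probabilities" "\<nu> \<in> borel_probabilities"
  shows "vchar (\<mu> \<star> \<nu>) u = vchar \<mu> u * vchar \<nu> u"
proof -
  have "vchar (\<mu> \<star> \<nu>) u = (\<integral>x. (\<integral>y. iexp (u \<bullet> (x + y)) \<partial>\<nu>) \<partial>\<mu>)"
    unfolding vchar_def by (rule integral_convolution[where B=1]) (auto simp: assms norm_exp_i_times)
  also have "\<dots> = (\<integral>x. (\<integral>y. iexp (u \<bullet> x) * iexp (u \<bullet> y) \<partial>\<nu>) \<partial>\<mu>)"
    by (simp add: inner_add_right exp_add[symmetric] distrib_left)
  finally show ?thesis by (simp add: vchar_def)
qed

text \<open>The Fourier integrand is bounded by 1 and both measures are probabilities, so the
  integrals may be exchanged. The right-hand side then depends on \<open>\<mu>\<close> only through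
  \<open>vchar \<mu>\<close>.\<close>

lemma integral_gauss_density_vchar:
  fixes \<mu> :: "(real^'n) measure"
  assumes mu: "\<mu> \<in> borel_probabilities"
    and s: "\<And>i. 0 < \<sigma> i" and R: "\<And>i. 0 \<le> R i"
  shows "complex_of_real (\<integral>x. (gauss_density (\<lambda>i. sqrt ((\<sigma> i)\<^sup>2 + R i)) (y - x)) \<partial>\<mu>) =
    of_real (\<Prod>i\<in>UNIV. 1 / (\<sigma> i * sqrt (2 * pi))) *
    (\<integral>u. iexp (u \<bullet> y) * (vchar \<mu> (- u) * of_real (exp (- (\<Sum>i\<in>UNIV. R i * (u $ i)\<^sup>2) / 2))) \<partial>gauss (\<lambda>i. 1 / \<sigma> i))"
proof -
  note [measurable_cong] = borel_probabilitiesD(2)[OF mu]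
  have G: "gauss (\<lambda>i. 1 / \<sigma> i) \<in> borel_probabilities" by (rule gauss_prob) (simp add: s)
  interpret M: prob_space \<mu> by (rule borel_probabilitiesD[OF mu])
  interpret N: prob_space "gauss (\<lambda>i. 1 / \<sigma> i)" by (rule borel_probabilitiesD[OF G])
  interpret pair_prob_space \<mu> "gauss (\<lambda>i. 1 / \<sigma> i)" ..
  let ?k = "\<lambda>u::real^'n. complex_of_real (exp (- (\<Sum>i\<in>UNIV. R i * (u $ i)\<^sup>2) / 2))"
  let ?c = "complex_of_real (\<Prod>i\<in>UNIV. 1 / (\<sigma> i * sqrt (2 * pi)))"
  have k1: "norm (?k u) \<le> 1" for u
    unfolding norm_of_real using R by (simp add: sum_nonneg)
  have "complex_of_real (\<integral>x. (gauss_density (\<lambda>i. sqrt ((\<sigma> i)\<^sup>2 + R i)) (y - x)) \<partial>\<mu>) =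
     (\<integral>x. ?c * (\<integral>u. iexp (u \<bullet> (y - x)) * ?k u \<partial>gauss (\<lambda>i. 1 / \<sigma> i)) \<partial>\<mu>)"
    by (simp only: integral_complex_of_real[symmetric] gauss_density_Fourier[OF s R])
  also have "\<dots> = ?c * (\<integral>x. (\<integral>u. iexp (u \<bullet> (y - x)) * ?k u \<partial>gauss (\<lambda>i. 1 / \<sigma> i)) \<partial>\<mu>)"
    by (rule integral_mult_right_zero)
  also have "(\<integral>x. (\<integral>u. iexp (u \<bullet> (y - x)) * ?k u \<partial>gauss (\<lambda>i. 1 / \<sigma> i)) \<partial>\<mu>) =
     (\<integral>u. (\<integral>x. iexp (u \<bullet> (y - x)) * ?k u \<partial>\<mu>) \<partial>gauss (\<lambda>i. 1 / \<sigma> i))"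
  proof (rule Fubini_integral[symmetric], rule integrable_bounded_prob[where B=1])
    show "norm (case p of (x, u) \<Rightarrow> iexp (u \<bullet> (y - x)) * ?k u) \<le> 1" for p
      using k1 by (auto simp: norm_mult norm_exp_i_times split: prod.split simp del: norm_of_real of_real_exp)
  qed (auto intro: prob_space_axioms)
  also have "\<dots> = (\<integral>u. iexp (u \<bullet> y) * (vchar \<mu> (- u) * ?k u) \<partial>gauss (\<lambda>i. 1 / \<sigma> i))"
  proof (rule Bochner_Integration.integral_cong[OF refl])
    fix u
    have "(\<integral>x. iexp (u \<bullet> (y - x)) * ?k u \<partial>\<mu>) =
      (\<integral>x. iexp (u \<bullet> y) * (iexp (- u \<bullet> x) * ?k u) \<partial>\<mu>)"
      by (rule Bochner_Integration.integral_cong[OF refl])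
        (simp add: inner_diff_right exp_add[symmetric] right_diff_distrib exp_diff exp_minus field_simps del: of_real_exp)
    also have "\<dots> = iexp (u \<bullet> y) * (vchar \<mu> (- u) * ?k u)"
      unfolding vchar_def by (simp only: integral_mult_right_zero integral_mult_left_zero)
    finally show "(\<integral>x. iexp (u \<bullet> (y - x)) * ?k u \<partial>\<mu>) =
      iexp (u \<bullet> y) * (vchar \<mu> (- u) * ?k u)" .
  qed
  finally show ?thesis .
qed

lemma convolution_gauss_density:
  fixes \<mu> :: "(real^'n) measure"
  assumes mu: "\<mu> \<in> borel_probabilities" and s: "\<And>i. 0 < \<sigma> i"
  shows "(\<mu> \<star> gauss \<sigma>) = density lborel (\<lambda>y. ennreal (\<integral>x. (gauss_density \<sigma> (y - x)) \<partial>\<mu>))"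
    (is "_ = density _ ?D")
proof (rule measure_eqI)
  note [measurable_cong] = borel_probabilitiesD(2)[OF mu]
  interpret M: prob_space \<mu> by (rule borel_probabilitiesD[OF mu])
  interpret N: prob_space "gauss \<sigma>" by (rule prob_space_gauss[OF s])
  interpret L: pair_sigma_finite \<mu> "lborel :: (real^'n) measure" ..
  let ?p = "\<lambda>y::real^'n. \<Prod>i\<in>UNIV. normal_density 0 (\<sigma> i) (y $ i)"
  have p0: "?p y \<ge> 0" for y by (intro prod_nonneg) auto
  have pb: "?p y \<le> (\<Prod>i\<in>(UNIV::'n set). 1 / sqrt (2 * pi * (\<sigma> i)\<^sup>2))" for y
    by (intro prod_mono) (auto simp: normal_density_def intro!: divide_right_mono)
  have nn: "ennreal (\<integral>x. ?p (y - x) \<partial>\<mu>) = (\<integral>\<^sup>+x. ennreal (?p (y - x)) \<partial>\<mu>)" for y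
  proof (rule nn_integral_eq_integral[symmetric])
    show "integrable \<mu> (\<lambda>x. ?p (y - x))"
      using p0 pb by (intro integrable_bounded_prob[OF M.prob_space_axioms, where B="\<Prod>i\<in>(UNIV::'n set). 1 / sqrt (2 * pi * (\<sigma> i)\<^sup>2)"])
        (auto simp del: vector_minus_component)
  qed (intro AE_I2 p0)
  fix A assume "A \<in> sets (\<mu> \<star> gauss \<sigma>)"
  then have [measurable]: "A \<in> sets borel" by simp
  have "emeasure (\<mu> \<star> gauss \<sigma>) A = (\<integral>\<^sup>+x. \<integral>\<^sup>+y. indicator A (x + y) \<partial>gauss \<sigma> \<partial>\<mu>)"
    by (rule convolution_emeasure') (auto simp: borel_probabilitiesD[OF mu] M.finite_measure_axioms N.finite_measure_axioms)
  also have "\<dots> = (\<integral>\<^sup>+x. \<integral>\<^sup>+y. ennreal (?p (y - x)) * indicator A y \<partial>lborel \<partial>\<mu>)"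
  proof (rule nn_integral_cong)
    fix x
    have "(\<integral>\<^sup>+y. indicator A (x + y) \<partial>gauss \<sigma>) = (\<integral>\<^sup>+y. ennreal (?p y) * indicator A (x + y) \<partial>lborel)"
      unfolding gauss_def by (subst nn_integral_density) auto
    also have "\<dots> = (\<integral>\<^sup>+y. ennreal (?p (y - x)) * indicator A y \<partial>distr lborel borel ((+) x))"
      by (subst nn_integral_distr) auto
    finally show "(\<integral>\<^sup>+y. indicator A (x + y) \<partial>gauss \<sigma>) = (\<integral>\<^sup>+y. ennreal (?p (y - x)) * indicator A y \<partial>lborel)"
      unfolding lborel_distr_plus .
  qed
  also have "\<dots> = (\<integral>\<^sup>+y. \<integral>\<^sup>+x. ennreal (?p (y - x)) * indicator A y \<partial>\<mu> \<partial>lborel)"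
    by (rule L.Fubini'[symmetric]) measurable
  also have "\<dots> = (\<integral>\<^sup>+y. ?D y * indicator A y \<partial>lborel)"
    unfolding nn by (subst nn_integral_multc) auto
  also have "\<dots> = emeasure (density lborel ?D) A"
    by (subst emeasure_density) auto
  finally show "emeasure (\<mu> \<star> gauss \<sigma>) A = emeasure (density lborel ?D) A" .
qed simp

text \<open>Both measures have the same smooth density, computed by Fourier inversion.\<close>

lemma convolution_gauss_eqI:
  fixes \<alpha> \<mu> :: "(real^'n) measure"
  assumes alpha: "\<alpha> \<in> borel_probabilities" and mu: "\<mu> \<in> borel_probabilities"
    and s: "\<And>i. 0 < \<sigma> i" and R: "\<And>i. 0 \<le> R i"
    and char: "\<And>u. vchar \<alpha> u = vchar \<mu> u * of_real (exp (- (\<Sum>i\<in>UNIV. R i * (u $ i)\<^sup>2) / 2))"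
  shows "(\<alpha> \<star> gauss \<sigma>) = (\<mu> \<star> gauss (\<lambda>i. sqrt ((\<sigma> i)\<^sup>2 + R i)))"
proof -
  have S: "0 < sqrt ((\<sigma> i)\<^sup>2 + R i)" for i using s[of i] R[of i] by (auto intro: add_pos_nonneg)
  have "(\<integral>x. (gauss_density \<sigma> (y - x)) \<partial>\<alpha>) =
     (\<integral>x. (gauss_density (\<lambda>i. sqrt ((\<sigma> i)\<^sup>2 + R i)) (y - x)) \<partial>\<mu>)" for y
  proof -
    \<comment> \<open>The inversion formula is applied to \<open>\<alpha>\<close> with zero in place
      of \<open>R\<close>; the missing factor is supplied by \<open>char\<close>.\<close>
    have "complex_of_real (\<integral>x. (gauss_density (\<lambda>i. sqrt ((\<sigma> i)\<^sup>2 + (\<lambda>_. 0) i)) (y - x)) \<partial>\<alpha>) =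
       complex_of_real (\<integral>x. (gauss_density (\<lambda>i. sqrt ((\<sigma> i)\<^sup>2 + R i)) (y - x)) \<partial>\<mu>)"
      by (subst integral_gauss_density_vchar[OF alpha s], simp, subst integral_gauss_density_vchar[OF mu s R]) (simp add: char)
    then show ?thesis using s by (simp add: less_imp_le)
  qed
  then show ?thesis
    by (simp only: convolution_gauss_density[OF alpha s] convolution_gauss_density[OF mu S])
qed

section \<open>Completion of a covariance matrix and Laplace functionals\<close>

definition quad_form :: "('n \<Rightarrow> 'n \<Rightarrow> real) \<Rightarrow> real^'n::finite \<Rightarrow> real" where
  "quad_form Q u = (\<Sum>i\<in>UNIV. \<Sum>j\<in>UNIV. Q i j * (u $ i * u $ j))"

text \<open>
  The complementary quadratic form is a sum of squares:
  \<open>- q x y = \<bar>q\<bar> / 2 * (x - sgn q * y)\<^sup>2 - \<bar>q\<bar> / 2 * (x\<^sup>2 + y\<^sup>2)\<close>.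
\<close>

lemma diagonalizing_noise:
  fixes Q :: "'n::finite \<Rightarrow> 'n \<Rightarrow> real"
  obtains Z :: "(real^'n) measure" and R :: "'n \<Rightarrow> real"
  where "Z \<in> borel_probabilities" "\<And>i. 0 \<le> R i"
    "\<And>u. vchar Z u = of_real (exp (- ((\<Sum>i\<in>UNIV. R i * (u $ i)\<^sup>2) - quad_form Q u) / 2))"
proof -
  \<comment> \<open>One independent standard normal variable for each pair of indices, realizing one
    square of the sum of squares.\<close>
  define S where "S g = (\<Sum>p\<in>UNIV. (sqrt (\<bar>Q (fst p) (snd p)\<bar> / 2) * g $ p) *\<^sub>R
      (axis (fst p) 1 - sgn (Q (fst p) (snd p)) *\<^sub>R axis (snd p) 1 :: real^'n))" for g :: "real^('n \<times> 'n)"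
  define Z where "Z = distr (gauss (\<lambda>_::'n \<times> 'n. 1)) borel S"
  \<comment> \<open>Each entry \<open>q\<close> leaves \<open>\<bar>q\<bar> / 2\<close> at both of
    its indices, which gives half of a row sum plus half of a column sum.\<close>
  define R where "R i = (\<Sum>j\<in>UNIV. \<bar>Q i j\<bar> + \<bar>Q j i\<bar>) / 2" for i
  have [measurable]: "S \<in> borel_measurable borel" unfolding S_def by measurable
  interpret prob_space "gauss (\<lambda>_::'n \<times> 'n. 1)" by (rule prob_space_gauss) simp
  have "vchar Z u = of_real (exp (- ((\<Sum>i\<in>UNIV. R i * (u $ i)\<^sup>2) - quad_form Q u) / 2))" for u
  proof -
    define c :: "real^('n \<times> 'n)" where
      "c = (\<chi> p. sqrt (\<bar>Q (fst p) (snd p)\<bar> / 2) * (u $ fst p - sgn (Q (fst p) (snd p)) * u $ snd p))"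
    have c: "u \<bullet> S g = c \<bullet> g" for g
      unfolding S_def inner_sum_right c_def inner_vec_def[of "vec_lambda _"]
      by (intro sum.cong) (auto simp: inner_diff_right inner_axis mult_ac)
    have "(\<Sum>p\<in>UNIV. (c $ p)\<^sup>2) =
       (\<Sum>p\<in>UNIV. \<bar>Q (fst p) (snd p)\<bar> / 2 * (u $ fst p)\<^sup>2 + \<bar>Q (fst p) (snd p)\<bar> / 2 * (u $ snd p)\<^sup>2
           - Q (fst p) (snd p) * (u $ fst p * u $ snd p))"
    proof (intro sum.cong refl)
      fix p :: "'n \<times> 'n"
      define q a b where "q = Q (fst p) (snd p)" and "a = u $ fst p" and "b = u $ snd p"
      have "\<bar>q\<bar> / 2 * (a - sgn q * b)\<^sup>2 = \<bar>q\<bar> / 2 * a\<^sup>2 + \<bar>q\<bar> / 2 * b\<^sup>2 - q * (a * b)"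
        by (cases q "0 :: real" rule: linorder_cases) (auto simp: power2_eq_square field_simps)
      then show "(c $ p)\<^sup>2 = \<bar>Q (fst p) (snd p)\<bar> / 2 * (u $ fst p)\<^sup>2 + \<bar>Q (fst p) (snd p)\<bar> / 2 * (u $ snd p)\<^sup>2
           - Q (fst p) (snd p) * (u $ fst p * u $ snd p)"
        by (simp add: c_def power_mult_distrib q_def a_def b_def)
    qed
    also have "\<dots> = (\<Sum>i\<in>UNIV. \<Sum>j\<in>UNIV. \<bar>Q i j\<bar> / 2 * (u $ i)\<^sup>2) + (\<Sum>i\<in>UNIV. \<Sum>j\<in>UNIV. \<bar>Q i j\<bar> / 2 * (u $ j)\<^sup>2)
           - quad_form Q u"
      unfolding UNIV_Times_UNIV[symmetric] quad_form_def sum.cartesian_product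
      by (simp add: sum.distrib sum_subtractf case_prod_unfold)
    also have "(\<Sum>i\<in>UNIV. \<Sum>j\<in>UNIV. \<bar>Q i j\<bar> / 2 * (u $ j)\<^sup>2) = (\<Sum>i\<in>UNIV. \<Sum>j\<in>UNIV. \<bar>Q j i\<bar> / 2 * (u $ i)\<^sup>2)"
      by (rule sum.swap)
    also have "(\<Sum>i\<in>UNIV. \<Sum>j\<in>UNIV. \<bar>Q i j\<bar> / 2 * (u $ i)\<^sup>2) + \<dots> = (\<Sum>i\<in>UNIV. R i * (u $ i)\<^sup>2)"
      unfolding R_def by (simp add: sum.distrib[symmetric] sum_distrib_right sum_divide_distrib add_divide_distrib distrib_right)
    finally have "(\<Sum>p\<in>UNIV. (1 * c $ p)\<^sup>2) = (\<Sum>i\<in>UNIV. R i * (u $ i)\<^sup>2) - quad_form Q u" by simp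
    then show ?thesis
      unfolding vchar_def Z_def
      by (subst integral_distr) (auto simp: c integral_gauss_char[where \<sigma>="\<lambda>_. 1"] simp del: of_real_exp)
  qed
  moreover have "Z \<in> borel_probabilities"
    unfolding borel_probabilities_def Z_def by (auto intro!: prob_space_distr)
  moreover have "0 \<le> R i" for i unfolding R_def by (auto intro!: sum_nonneg)
  ultimately show ?thesis using that by blast
qed

text \<open>\<open>\<alpha>\<close> is the law of a \<open>\<mu>\<close>-distributed vector plus an
  independent centred Gaussian with covariance form \<open>quad_form Q\<close>. Characteristic
  functions are used because this Gaussian may have no density.\<close>

definition gaussian_extension ::
    "('n \<Rightarrow> 'n \<Rightarrow> real) \<Rightarrow> (real^'n::finite) measure \<Rightarrow> (real^'n) measure \<Rightarrow> bool" where
  "gaussian_extension Q \<mu> \<alpha> \<longleftrightarrow> (\<forall>u. vchar \<alpha> u = vchar \<mu> u * of_real (exp (- quad_form Q u / 2)))"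

text \<open>Noise \<open>Z\<close> makes the covariance diagonal with entries \<open>R i\<close>,
  and independent noise of variances \<open>T - R i\<close> raises all of them to \<open>T\<close>.
  The law \<open>N\<close> is chosen before \<open>\<alpha>\<close> and \<open>\<mu>\<close>: one
  and the same convolution has to serve both sequences and all indices.\<close>

lemma isotropic_completion:
  fixes Q :: "'n::finite \<Rightarrow> 'n \<Rightarrow> real"
  obtains T0 :: real where "0 < T0"
    "\<And>T. T0 \<le> T \<Longrightarrow> \<exists>N\<in>borel_probabilities. \<forall>\<alpha>\<in>borel_probabilities. \<forall>\<mu>\<in>borel_probabilities.
      gaussian_extension Q \<mu> \<alpha> \<longrightarrow> (\<alpha> \<star> N) = (\<mu> \<star> gauss (\<lambda>_. sqrt T))"
proof -
  obtain Z :: "(real^'n) measure" and R where Z: "Z \<in> borel_probabilities" and R: "\<And>i. 0 \<le> R i"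
    and vZ: "\<And>u. vchar Z u = of_real (exp (- ((\<Sum>i\<in>UNIV. R i * (u $ i)\<^sup>2) - quad_form Q u) / 2))"
    using diagonalizing_noise[of Q] by metis
  \<comment> \<open>The summand 1 makes every \<open>T - R i\<close> strictly positive, so that the
    last Gaussian is nondegenerate and Fourier inversion applies.\<close>
  define T0 where "T0 = sum R UNIV + 1"
  have R0: "R i < T0" for i
    using R member_le_sum[of i UNIV R] by (auto simp: T0_def)
  show ?thesis
  proof
    show "0 < T0" using R by (auto simp: T0_def sum_nonneg add_nonneg_pos)
    fix T assume T: "T0 \<le> T"
    let ?G = "gauss (\<lambda>i. sqrt (T - R i))"
    have pos: "0 < sqrt (T - R i)" for i using R0[of i] T by simp
    show "\<exists>N\<in>borel_probabilities. \<forall>\<alpha>\<in>borel_probabilities. \<forall>\<mu>\<in>borel_probabilities.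
      gaussian_extension Q \<mu> \<alpha> \<longrightarrow> (\<alpha> \<star> N) = (\<mu> \<star> gauss (\<lambda>_. sqrt T))"
    proof (intro bexI ballI impI)
      show N: "(Z \<star> ?G) \<in> borel_probabilities" by (intro convolution_prob Z gauss_prob pos)
      fix \<alpha> \<mu> :: "(real^'n) measure" assume a: "\<alpha> \<in> borel_probabilities" and m: "\<mu> \<in> borel_probabilities"
        and c: "gaussian_extension Q \<mu> \<alpha>"
      have fin: "\<nu> \<in> borel_probabilities \<Longrightarrow> finite_measure \<nu>" for \<nu> :: "(real^'n) measure"
        by (rule prob_space.finite_measure) (rule borel_probabilitiesD)
      have "(\<alpha> \<star> (Z \<star> ?G)) = ((\<alpha> \<star> Z) \<star> ?G)"
        by (rule convolution_associative)
          (auto simp: borel_probabilitiesD(2)[OF a] borel_probabilitiesD(2)[OF Z] intro!: fin a Z gauss_prob pos)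
      also have "\<dots> = (\<mu> \<star> gauss (\<lambda>i. sqrt ((sqrt (T - R i))\<^sup>2 + R i)))"
      proof (rule convolution_gauss_eqI[OF convolution_prob[OF a Z] m pos R])
        fix u
        have "exp (- quad_form Q u / 2) * exp (- ((\<Sum>i\<in>UNIV. R i * (u $ i)\<^sup>2) - quad_form Q u) / 2) =
          exp (- (\<Sum>i\<in>UNIV. R i * (u $ i)\<^sup>2) / 2)"
          by (simp add: exp_add[symmetric] field_simps)
        then show "vchar (\<alpha> \<star> Z) u = vchar \<mu> u * of_real (exp (- (\<Sum>i\<in>UNIV. R i * (u $ i)\<^sup>2) / 2))"
          by (simp only: vchar_convolution[OF a Z] c[unfolded gaussian_extension_def, rule_format] vZ mult.assoc of_real_mult[symmetric])
      qed
      also have "(\<lambda>i. sqrt ((sqrt (T - R i))\<^sup>2 + R i)) = (\<lambda>_. sqrt T)"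
      proof
        fix i show "sqrt ((sqrt (T - R i))\<^sup>2 + R i) = sqrt T" using R0[of i] T by simp
      qed
      finally show "(\<alpha> \<star> (Z \<star> ?G)) = (\<mu> \<star> gauss (\<lambda>_. sqrt T))" .
    qed
  qed
qed

section \<open>Extension of convergence from small to all Laplace exponents\<close>

lemma power_le_fact_exp:
  fixes x :: real assumes "0 \<le> x" shows "x ^ k \<le> fact k * exp x"
proof -
  have "(\<Sum>n\<in>{k}. x ^ n /\<^sub>R fact n) \<le> (\<Sum>n. x ^ n /\<^sub>R fact n)"
    by (rule sum_le_suminf[OF summable_exp_generic]) (use assms in auto)
  then show ?thesis by (simp add: exp_def field_simps)
qed

lemma power_exp_bound:
  fixes s w :: real
  assumes "0 \<le> s" "0 < w"
  shows "s ^ k \<le> (fact k / w ^ k) * exp (w * s)"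
  using power_le_fact_exp[of "w * s" k] assms by (simp add: power_mult_distrib field_simps)

text \<open>The rate \<open>a\<close> is left open because exponentials with different rates are
  combined. Only \<open>s \<ge> 0\<close> counts: the argument will be a squared norm.\<close>

definition exp_decaying :: "(real \<Rightarrow> real) set" where
  "exp_decaying = {u \<in> borel_measurable borel. \<exists>K a. 0 < a \<and> (\<forall>s\<ge>0. \<bar>u s\<bar> \<le> K * exp (- (a * s)))}"

lemma exp_decayingI:
  "u \<in> borel_measurable borel \<Longrightarrow> 0 < a \<Longrightarrow> (\<And>s. 0 \<le> s \<Longrightarrow> \<bar>u s\<bar> \<le> K * exp (- (a * s))) \<Longrightarrow> u \<in> exp_decaying"
  unfolding exp_decaying_def by blast

lemma exp_decaying_add:
  assumes "u \<in> exp_decaying" "v \<in> exp_decaying" shows "(\<lambda>s. u s + v s) \<in> exp_decaying"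
proof -
  obtain K a where u: "u \<in> borel_measurable borel" "0 < a" "\<And>s. s \<ge> 0 \<Longrightarrow> \<bar>u s\<bar> \<le> K * exp (- (a * s))"
    using assms(1) unfolding exp_decaying_def by blast
  obtain L b where v: "v \<in> borel_measurable borel" "0 < b" "\<And>s. s \<ge> 0 \<Longrightarrow> \<bar>v s\<bar> \<le> L * exp (- (b * s))"
    using assms(2) unfolding exp_decaying_def by blast
  show ?thesis
  proof (rule exp_decayingI)
    show "(\<lambda>s. u s + v s) \<in> borel_measurable borel" using u v by measurable
    show "0 < min a b" using u v by auto
    fix s :: real assume s: "0 \<le> s"
    have "\<bar>u s + v s\<bar> \<le> \<bar>K\<bar> * exp (- (a * s)) + \<bar>L\<bar> * exp (- (b * s))"
      using u(3)[OF s] v(3)[OF s] abs_ge_self[of K] abs_ge_self[of L]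
      by (smt (verit) exp_ge_zero mult_right_mono)
    also have "\<dots> \<le> \<bar>K\<bar> * exp (- (min a b * s)) + \<bar>L\<bar> * exp (- (min a b * s))"
      using s by (intro add_mono mult_left_mono) (auto intro!: mult_right_mono)
    finally show "\<bar>u s + v s\<bar> \<le> (\<bar>K\<bar> + \<bar>L\<bar>) * exp (- (min a b * s))" by (simp add: distrib_right)
  qed
qed

lemma exp_decaying_cmult:
  assumes "u \<in> exp_decaying" shows "(\<lambda>s. c * u s) \<in> exp_decaying"
proof -
  obtain K a where u: "u \<in> borel_measurable borel" "0 < a" "\<And>s. s \<ge> 0 \<Longrightarrow> \<bar>u s\<bar> \<le> K * exp (- (a * s))"
    using assms(1) unfolding exp_decaying_def by blast
  show ?thesis
    by (rule exp_decayingI[of _ a "\<bar>c\<bar> * K"]) (use u in \<open>auto simp: abs_mult mult.assoc intro!: mult_left_mono\<close>)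
qed

lemma exp_decaying_power_exp: "0 < w \<Longrightarrow> (\<lambda>s. s ^ k * exp (- (w * s))) \<in> exp_decaying"
proof (rule exp_decayingI[of _ "w / 2" "fact k / (w / 2) ^ k"])
  fix s :: real assume w: "0 < w" and s: "0 \<le> s"
  have "\<bar>s ^ k * exp (- (w * s))\<bar> = s ^ k * exp (- (w * s))" using s by simp
  also have "\<dots> \<le> fact k / (w / 2) ^ k * exp (w / 2 * s) * exp (- (w * s))"
    using w s by (intro mult_right_mono power_exp_bound) auto
  also have "\<dots> = fact k / (w / 2) ^ k * exp (- (w / 2 * s))"
    by (simp add: mult.assoc exp_add[symmetric])
  finally show "\<bar>s ^ k * exp (- (w * s))\<bar> \<le> fact k / (w / 2) ^ k * exp (- (w / 2 * s))" .
qed auto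

text \<open>\<open>\<Lambda> n\<close> stands for integration against a signed measure. For each
  weight \<open>exp (- (a * s))\<close> the functionals are bounded in the weighted supremum norm
  with a constant \<open>c\<close> common to all \<open>n\<close>; this allows approximation to be
  interchanged with the limit in \<open>n\<close>.\<close>

locale laplace_functionals =
  fixes \<Lambda> :: "nat \<Rightarrow> (real \<Rightarrow> real) \<Rightarrow> real"
  assumes add: "\<And>n u v. u \<in> exp_decaying \<Longrightarrow> v \<in> exp_decaying \<Longrightarrow> \<Lambda> n (\<lambda>s. u s + v s) = \<Lambda> n u + \<Lambda> n v"
    and cmult: "\<And>n c u. u \<in> exp_decaying \<Longrightarrow> \<Lambda> n (\<lambda>s. c * u s) = c * \<Lambda> n u"
    and bound: "\<And>a. 0 < a \<Longrightarrow> \<exists>c. \<forall>n K. \<forall>u\<in>exp_decaying. (\<forall>s\<ge>0. \<bar>u s\<bar> \<le> K * exp (- (a * s))) \<longrightarrow> \<bar>\<Lambda> n u\<bar> \<le> K * c"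
begin

definition null where "null u \<longleftrightarrow> u \<in> exp_decaying \<and> (\<lambda>n. \<Lambda> n u) \<longlonglongrightarrow> 0"

lemma null_add: "null u \<Longrightarrow> null v \<Longrightarrow> null (\<lambda>s. u s + v s)"
  unfolding null_def using tendsto_add[of "\<lambda>n. \<Lambda> n u" 0 sequentially "\<lambda>n. \<Lambda> n v" 0]
  by (auto simp: exp_decaying_add add)

lemma null_cmult: "null u \<Longrightarrow> null (\<lambda>s. c * u s)"
  unfolding null_def using tendsto_mult_right_zero[of "\<lambda>n. \<Lambda> n u" sequentially c]
  by (auto simp: exp_decaying_cmult cmult)

text \<open>By the uniform bound, the functions on which \<open>\<Lambda> n\<close> tends to 0 are
  closed under approximation in a weighted supremum norm.\<close>

lemma null_approx:
  assumes u: "u \<in> exp_decaying" and a: "0 < a"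
    and appr: "\<And>e. 0 < e \<Longrightarrow> \<exists>v. null v \<and> (\<forall>s\<ge>0. \<bar>u s - v s\<bar> \<le> e * exp (- (a * s)))"
  shows "null u"
proof -
  obtain c where c: "\<And>n K u. u \<in> exp_decaying \<Longrightarrow> (\<forall>s\<ge>0. \<bar>u s\<bar> \<le> K * exp (- (a * s))) \<Longrightarrow> \<bar>\<Lambda> n u\<bar> \<le> K * c"
    using bound[OF a] by blast
  have "(\<lambda>n. \<Lambda> n u) \<longlonglongrightarrow> 0"
  proof (rule LIMSEQ_I)
    fix r :: real assume r: "0 < r"
    \<comment> \<open>The constant in \<open>bound\<close> may have any sign or vanish, hence
      \<open>\<bar>c\<bar> + 1\<close>.\<close>
    define e where "e = r / (2 * (\<bar>c\<bar> + 1))"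
    have e: "0 < e" "e * \<bar>c\<bar> < r / 2" using r by (auto simp: e_def field_simps)
    obtain v where v: "null v" "\<forall>s\<ge>0. \<bar>u s - v s\<bar> \<le> e * exp (- (a * s))"
      using appr[OF e(1)] by blast
    obtain N where N: "\<And>n. N \<le> n \<Longrightarrow> \<bar>\<Lambda> n v\<bar> < r / 2"
      using v(1) r LIMSEQ_D[of "\<lambda>n. \<Lambda> n v" 0 "r / 2"] unfolding null_def by auto
    have "norm (\<Lambda> n u - 0) < r" if "N \<le> n" for n
    proof -
      have dv: "v \<in> exp_decaying" using v unfolding null_def by auto
      have d: "(\<lambda>s. u s + (-1) * v s) \<in> exp_decaying"
        using u dv by (intro exp_decaying_add exp_decaying_cmult)
      have "\<Lambda> n (\<lambda>s. u s + (-1) * v s) = \<Lambda> n u - \<Lambda> n v"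
        by (simp only: add[OF u exp_decaying_cmult[OF dv]] cmult[OF dv])
      moreover have "\<bar>\<Lambda> n (\<lambda>s. u s + (-1) * v s)\<bar> \<le> e * c"
        using v(2) by (intro c[OF d]) auto
      moreover have "e * c \<le> e * \<bar>c\<bar>" using e by (intro mult_left_mono) auto
      ultimately show ?thesis using N[OF that] e(2) by simp
    qed
    then show "\<exists>no. \<forall>n\<ge>no. norm (\<Lambda> n u - 0) < r" by blast
  qed
  then show ?thesis using u by (simp add: null_def)
qed

text \<open>Up to sign the functions are derivatives in \<open>w\<close> of
  \<open>exp (- (w * s))\<close>. Difference quotients of the preceding power converge to the next
  one in a weighted norm.\<close>

lemma null_power_exp:
  assumes base: "\<And>w. 0 < w \<Longrightarrow> w < w0 \<Longrightarrow> null (\<lambda>s. exp (- (w * s)))"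
    and w: "0 < w" "w < w0"
  shows "null (\<lambda>s. s ^ k * exp (- (w * s)))"
  using w
proof (induction k arbitrary: w)
  case 0
  then show ?case using base[of w] by simp
next
  case (Suc k)
  show ?case
  proof (rule null_approx)
    show "(\<lambda>s. s ^ Suc k * exp (- (w * s))) \<in> exp_decaying" using Suc by (intro exp_decaying_power_exp)
    show "0 < w / 2" using Suc by simp
    fix e :: real assume e: "0 < e"
    \<comment> \<open>The bound of \<open>s ^ (k + 2)\<close> by \<open>K * exp (w / 4 * s)\<close>;
      two additional powers of \<open>s\<close> come from the second order remainder of the
      difference quotient.\<close>
    define K where "K = fact (k + 2) / (w / 4) ^ (k + 2)"
    have K: "0 < K" using Suc by (auto simp: K_def)
    \<comment> \<open>The first bound keeps \<open>w - t\<close> in the range of the induction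
      hypothesis and lets \<open>exp (t * s)\<close> cost at most \<open>exp (w / 4 * s)\<close>.
      With the power bound, a decay of rate \<open>w / 2\<close> is left. The second bound makes the
      error at most \<open>e\<close>.\<close>
    define t where "t = min (w / 4) (e / K)"
    have t: "0 < t" "t \<le> w / 4" "t * K \<le> e" using Suc e K by (auto simp: t_def min_def field_simps)
    define v where "v s = (1 / t) * (s ^ k * exp (- ((w - t) * s)) + (-1) * (s ^ k * exp (- (w * s))))" for s
    have "null v" unfolding v_def
      using t Suc by (intro null_cmult null_add Suc.IH) auto
    moreover have "\<bar>s ^ Suc k * exp (- (w * s)) - v s\<bar> \<le> e * exp (- (w / 2 * s))" if s: "0 \<le> s" for s
    proof -
      define x where "x = t * s"
      have x: "0 \<le> x" using t s by (simp add: x_def)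
      have ex1: "exp x - 1 \<le> x * exp x"
        \<comment> \<open>This is \<open>1 - x \<le> exp (- x)\<close> multiplied by
          \<open>exp x\<close>; using it twice bounds the remainder by
          \<open>x * (x * exp x)\<close>.\<close>
        using exp_ge_add_one_self[of "- x"] by (simp add: exp_minus field_simps)
      have "exp x - 1 - x \<le> x * (exp x - 1)" using ex1 by (simp add: algebra_simps)
      also have "\<dots> \<le> x * (x * exp x)" using ex1 x by (intro mult_left_mono)
      finally have ub: "\<bar>exp x - 1 - x\<bar> \<le> x * (x * exp x)"
        using exp_ge_add_one_self[of x] by linarith
      have "s ^ Suc k * exp (- (w * s)) - v s = - (s ^ k * exp (- (w * s)) / t) * (exp x - 1 - x)"
      proof -
        have "exp (- ((w - t) * s)) = exp (- (w * s)) * exp x" by (simp add: x_def exp_add[symmetric] algebra_simps)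
        then show ?thesis using t(1) by (simp add: v_def x_def field_simps)
      qed
      then have "\<bar>s ^ Suc k * exp (- (w * s)) - v s\<bar> = s ^ k * exp (- (w * s)) / t * \<bar>exp x - 1 - x\<bar>"
        using s t by (simp add: abs_mult)
      also have "\<dots> \<le> s ^ k * exp (- (w * s)) / t * (x * (x * exp x))"
        using s t by (intro mult_left_mono ub) auto
      also have "\<dots> = t * s ^ (k + 2) * (exp (- (w * s)) * exp x)"
        using t by (simp add: x_def field_simps)
      also have "\<dots> \<le> t * (K * exp (w / 4 * s)) * exp (- (3 * w / 4 * s))"
      proof (intro mult_mono mult_left_mono)
        show "s ^ (k + 2) \<le> K * exp (w / 4 * s)" unfolding K_def using s Suc by (intro power_exp_bound) auto
        have "t * s \<le> w / 4 * s" using t s by (intro mult_right_mono) auto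
        then show "exp (- (w * s)) * exp x \<le> exp (- (3 * w / 4 * s))"
          by (simp add: x_def exp_add[symmetric])
      qed (use t K s in auto)
      also have "\<dots> = t * K * exp (- (w / 2 * s))"
        by (simp add: mult.assoc exp_add[symmetric])
      also have "\<dots> \<le> e * exp (- (w / 2 * s))" using t by (intro mult_right_mono) auto
      finally show ?thesis .
    qed
    ultimately show "\<exists>v. null v \<and> (\<forall>s\<ge>0. \<bar>s ^ Suc k * exp (- (w * s)) - v s\<bar> \<le> e * exp (- (w / 2 * s)))"
      by blast
  qed
qed

lemma null_sum: "finite I \<Longrightarrow> (\<And>i. i \<in> I \<Longrightarrow> null (u i)) \<Longrightarrow> I \<noteq> {} \<Longrightarrow> null (\<lambda>s. \<Sum>i\<in>I. u i s)"
proof (induction I rule: finite_induct)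
  case (insert i I)
  then show ?case by (cases "I = {}") (auto intro!: null_add)
qed simp

text \<open>The Taylor expansion of \<open>exp (- (v * s))\<close> around \<open>w = 4 / 5 * v\<close> converges in the weighted norm.\<close>

lemma null_exp_step:
  assumes base: "\<And>w. 0 < w \<Longrightarrow> w < w0 \<Longrightarrow> null (\<lambda>s. exp (- (w * s)))"
    and v: "0 < v" "v < 5 / 4 * w0"
  shows "null (\<lambda>s. exp (- (v * s)))"
proof -
  define w where "w = 4 / 5 * v"
  have w: "0 < w" "w < w0" "v = 5 / 4 * w" using v by (auto simp: w_def)
  show ?thesis
  proof (rule null_approx)
    show "(\<lambda>s. exp (- (v * s))) \<in> exp_decaying" using exp_decaying_power_exp[OF v(1), of 0] by simp
    show "0 < w / 4" using w by simp
    fix e :: real assume e: "0 < e"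
    obtain N' where N': "(1 / 2) ^ N' < e" using real_arch_pow_inv[of e "1/2"] e by auto
    \<comment> \<open>\<open>null_sum\<close> is stated for nonempty index sets, so the Taylor
      polynomial must have at least one term.\<close>
    define N where "N = Suc N'"
    have N: "(1 / 2) ^ N \<le> e" using N' e by (simp add: N_def)
    define p where "p s = (\<Sum>k<N. ((- (w / 4)) ^ k / fact k) * (s ^ k * exp (- (w * s))))" for s
    have "null p" unfolding p_def
      by (intro null_sum null_cmult null_power_exp[OF base w(1,2)]) (auto simp: N_def)
    moreover have "\<bar>exp (- (v * s)) - p s\<bar> \<le> e * exp (- (w / 4 * s))" if s: "0 \<le> s" for s
    proof -
      define x where "x = w / 4 * s"
      have x: "0 \<le> x" using w s by (simp add: x_def)
      obtain t where t: "\<bar>t\<bar> \<le> \<bar>- x\<bar>" "exp (- x) = (\<Sum>m<N. (- x) ^ m / fact m) + exp t / fact N * (- x) ^ N"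
        using Maclaurin_exp_le[of "- x" N] by blast
      have "p s = exp (- (w * s)) * (\<Sum>m<N. (- x) ^ m / fact m)"
        unfolding p_def sum_distrib_left
      proof (intro sum.cong refl)
        fix m
        have "(- x) ^ m = (- (w / 4)) ^ m * s ^ m" by (simp add: x_def power_mult_distrib[symmetric])
        then show "(- (w / 4)) ^ m / fact m * (s ^ m * exp (- (w * s))) = exp (- (w * s)) * ((- x) ^ m / fact m)"
          by (simp add: mult_ac)
      qed
      moreover have "exp (- (v * s)) = exp (- (w * s)) * exp (- x)"
        unfolding w(3) x_def by (simp add: exp_add[symmetric] field_simps)
      ultimately have "exp (- (v * s)) - p s = exp (- (w * s)) * (exp t / fact N * (- x) ^ N)"
        unfolding t(2) by (simp add: algebra_simps)
      then have "\<bar>exp (- (v * s)) - p s\<bar> = exp (- (w * s)) * (exp t / fact N * x ^ N)"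
        using x by (simp add: abs_mult power_abs)
      \<comment> \<open>Splitting \<open>x ^ N\<close> as \<open>(1 / 2) ^ N * (2 * x) ^ N\<close>
        gains a geometric factor at the price \<open>exp (2 * x)\<close>. Together with the
        remainder factor \<open>exp x\<close>, and as \<open>x = w / 4 * s\<close>, the decay that
        is left is exactly the weight \<open>exp (- (w / 4 * s))\<close>.\<close>
      also have "\<dots> \<le> exp (- (w * s)) * (exp x / fact N * ((1 / 2) ^ N * (fact N * exp (2 * x))))"
      proof (intro mult_mono mult_left_mono divide_right_mono)
        show "exp t \<le> exp x" using t(1) x by auto
        have "x ^ N = (1 / 2) ^ N * (2 * x) ^ N" by (simp add: power_mult_distrib power_divide)
        also have "\<dots> \<le> (1 / 2) ^ N * (fact N * exp (2 * x))"
          using x by (intro mult_left_mono power_le_fact_exp) auto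
        finally show "x ^ N \<le> (1 / 2) ^ N * (fact N * exp (2 * x))" .
      qed (use x in auto)
      also have "\<dots> = (1 / 2) ^ N * exp (- (w / 4 * s))"
        by (simp add: x_def exp_add[symmetric] field_simps)
      also have "\<dots> \<le> e * exp (- (w / 4 * s))" using N by (intro mult_right_mono) auto
      finally show ?thesis .
    qed
    ultimately show "\<exists>p. null p \<and> (\<forall>s\<ge>0. \<bar>exp (- (v * s)) - p s\<bar> \<le> e * exp (- (w / 4 * s)))" by blast
  qed
qed

text \<open>Each Taylor step enlarges the interval of admissible exponents by the fixed factor
  \<open>5 / 4\<close>, so finitely many steps reach \<open>v\<close>.\<close>

lemma null_exp:
  assumes base: "\<And>w. 0 < w \<Longrightarrow> w < w0 \<Longrightarrow> null (\<lambda>s. exp (- (w * s)))"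
    and w0: "0 < w0" and v: "0 < v"
  shows "null (\<lambda>s. exp (- (v * s)))"
proof -
  have "\<forall>w. 0 < w \<longrightarrow> w < (5 / 4) ^ m * w0 \<longrightarrow> null (\<lambda>s. exp (- (w * s)))" for m
  proof (induction m)
    case 0 then show ?case using base by simp
  next
    case (Suc m)
    then show ?case using null_exp_step[of "(5 / 4) ^ m * w0"] by (auto simp: mult.assoc)
  qed
  moreover obtain m where "v / w0 < (5 / 4) ^ m" using real_arch_pow[of "5/4" "v / w0"] by auto
  then have "v < (5 / 4) ^ m * w0" using w0 by (simp add: field_simps)
  ultimately show ?thesis using v by blast
qed

end

section \<open>Gaussian deconvolution in the bounded Lipschitz metric\<close>

lemma gauss_isotropic_density:
  assumes "0 < T"
  shows "(gauss_density (\<lambda>_. sqrt T) (y::real^'n)) =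
    (1 / sqrt (2 * pi * T)) ^ CARD('n) * exp (- (1 / (2 * T) * (norm y)\<^sup>2))"
proof -
  have "(\<Prod>i\<in>UNIV. normal_density 0 (sqrt T) (y $ i)) =
     (\<Prod>i\<in>(UNIV::'n set). 1 / sqrt (2 * pi * T)) * (\<Prod>i\<in>UNIV. exp (- (1 / (2 * T) * (y $ i)\<^sup>2)))"
    unfolding prod.distrib[symmetric] using assms
    by (intro prod.cong) (auto simp: normal_density_def)
  also have "(\<Prod>i\<in>UNIV. exp (- (1 / (2 * T) * (y $ i)\<^sup>2))) = exp (- (1 / (2 * T) * (norm y)\<^sup>2))"
    unfolding exp_sum[OF finite, symmetric] power2_norm_eq_inner inner_vec_def
    by (simp add: sum_negf sum_divide_distrib power2_eq_square)
  finally show ?thesis by simp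
qed

text \<open>Up to a positive constant this is the Gaussian density of variance
  \<open>1 / (2 * a)\<close>, whose total mass is finite.\<close>

lemma integrable_exp_norm_squared:
  assumes a: "0 < a"
  shows "integrable lborel (\<lambda>y::real^'n. exp (- (a * (norm y)\<^sup>2)))"
proof -
  define T where "T = 1 / (2 * a)"
  have T: "0 < T" "a = 1 / (2 * T)" using a by (auto simp: T_def)
  define \<kappa> where "\<kappa> = (1 / sqrt (2 * pi * T)) ^ CARD('n)"
  have k: "0 < \<kappa>" using T by (simp add: \<kappa>_def)
  interpret prob_space "gauss (\<lambda>_::'n. sqrt T)" using T by (intro prob_space_gauss) auto
  have "(\<integral>\<^sup>+y. ennreal (gauss_density (\<lambda>_. sqrt T) (y::real^'n)) \<partial>lborel) = emeasure (gauss (\<lambda>_::'n. sqrt T)) UNIV"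
    unfolding gauss_def by (subst emeasure_density) auto
  also have "\<dots> < \<infinity>" using emeasure_space_1 by simp
  finally have "integrable lborel (\<lambda>y. \<Prod>i\<in>UNIV. normal_density 0 (sqrt T) ((y::real^'n) $ i))"
    by (intro integrableI_nonneg) (auto intro!: prod_nonneg)
  then have "integrable lborel (\<lambda>y::real^'n. \<kappa> * exp (- (a * (norm y)\<^sup>2)))"
    unfolding gauss_isotropic_density[OF T(1)] \<kappa>_def T(2) .
  then show ?thesis using k by simp
qed

text \<open>The first argument only fixes the dimension.\<close>

abbreviation gauss_mass :: "'n::finite itself \<Rightarrow> real \<Rightarrow> real" where
  "gauss_mass _ a \<equiv> (\<integral>y. exp (- (a * (norm (y::real^'n))\<^sup>2)) \<partial>lborel)"

section \<open>Smoothing kernels that are functions of the squared norm\<close>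

lemma integrable_exp_decaying_norm:
  fixes f :: "real^'n \<Rightarrow> real"
  assumes a: "0 < a" and [measurable]: "u \<in> borel_measurable borel" "f \<in> borel_measurable borel"
    and u: "\<And>s. 0 \<le> s \<Longrightarrow> \<bar>u s\<bar> \<le> K * exp (- (a * s))" and f: "\<And>x. \<bar>f x\<bar> \<le> 1"
  shows "integrable lborel (\<lambda>y. u ((norm y)\<^sup>2) * f (x + y))"
    and "\<bar>\<integral>y. u ((norm y)\<^sup>2) * f (x + y) \<partial>lborel\<bar> \<le> K * gauss_mass TYPE('n) a"
proof -
  have le: "norm (u ((norm y)\<^sup>2) * f (x + y)) \<le> K * exp (- (a * (norm y)\<^sup>2))" for y
    using mult_mono[OF u[of "(norm y)\<^sup>2"] f[of "x + y"]] by (simp add: abs_mult order_trans[OF _ u])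
  have i: "integrable lborel (\<lambda>y::real^'n. K * exp (- (a * (norm y)\<^sup>2)))"
    by (intro integrable_mult_right integrable_exp_norm_squared a)
  show int: "integrable lborel (\<lambda>y. u ((norm y)\<^sup>2) * f (x + y))"
    by (rule Bochner_Integration.integrable_bound[OF i]) (use le in \<open>auto intro!: AE_I2 intro: order_trans[OF _ abs_ge_self]\<close>)
  have "norm (\<integral>y. u ((norm y)\<^sup>2) * f (x + y) \<partial>lborel) \<le> (\<integral>y. K * exp (- (a * (norm (y::real^'n))\<^sup>2)) \<partial>lborel)"
    by (rule Bochner_Integration.integral_norm_bound_integral[OF int i le])
  then show "\<bar>\<integral>y. u ((norm y)\<^sup>2) * f (x + y) \<partial>lborel\<bar> \<le> K * gauss_mass TYPE('n) a"
    by simp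
qed

text \<open>The integral of \<open>f\<close> against the convolution of \<open>\<mu>\<close> with
  the kernel \<open>u ((norm y)\<^sup>2)\<close>. It is kept as a functional of \<open>u\<close>:
  for exponentials it is an unnormalized Gaussian smoothing and behaves like a Laplace
  transform.\<close>

definition radial_mean :: "(real^'n) measure \<Rightarrow> (real^'n \<Rightarrow> real) \<Rightarrow> (real \<Rightarrow> real) \<Rightarrow> real" where
  "radial_mean \<mu> f u = (\<integral>x. (\<integral>y. u ((norm y)\<^sup>2) * f (x + y) \<partial>lborel) \<partial>\<mu>)"

text \<open>The bound involves neither \<open>\<mu>\<close> nor \<open>f\<close>, so it survives
  when both change with the index.\<close>

lemma radial_mean_bound:
  fixes f :: "real^'n \<Rightarrow> real"
  assumes mu: "\<mu> \<in> borel_probabilities"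
    and a: "0 < a" and [measurable]: "u \<in> borel_measurable borel" "f \<in> borel_measurable borel"
    and u: "\<And>s. 0 \<le> s \<Longrightarrow> \<bar>u s\<bar> \<le> K * exp (- (a * s))" and f: "\<And>x. \<bar>f x\<bar> \<le> 1"
  shows "integrable \<mu> (\<lambda>x. \<integral>y. u ((norm y)\<^sup>2) * f (x + y) \<partial>lborel)"
    and "\<bar>radial_mean \<mu> f u\<bar> \<le> K * gauss_mass TYPE('n) a"
proof -
  interpret prob_space \<mu> by (rule borel_probabilitiesD[OF mu])
  note [measurable_cong] = borel_probabilitiesD(2)[OF mu]
  have b: "\<bar>\<integral>y. u ((norm y)\<^sup>2) * f (x + y) \<partial>lborel\<bar> \<le> K * gauss_mass TYPE('n) a" for x
    by (rule integrable_exp_decaying_norm(2)[OF a assms(3,4) u f])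
  have m: "(\<lambda>x. \<integral>y. u ((norm y)\<^sup>2) * f (x + y) \<partial>lborel) \<in> borel_measurable \<mu>"
    by measurable
  show i: "integrable \<mu> (\<lambda>x. \<integral>y. u ((norm y)\<^sup>2) * f (x + y) \<partial>lborel)"
    by (rule integrable_bounded_prob[OF prob_space_axioms m]) (unfold real_norm_def, rule b)
  show "\<bar>radial_mean \<mu> f u\<bar> \<le> K * gauss_mass TYPE('n) a"
    unfolding radial_mean_def
    using Bochner_Integration.integral_norm_bound_integral[OF i integrable_const, of "K * gauss_mass TYPE('n) a"] b
    by (simp add: prob_space)
qed

lemma radial_mean_add:
  fixes f :: "real^'n \<Rightarrow> real"
  assumes mu: "\<mu> \<in> borel_probabilities" and u: "u \<in> exp_decaying" and v: "v \<in> exp_decaying"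
    and fm: "f \<in> borel_measurable borel" and f: "\<And>x. \<bar>f x\<bar> \<le> 1"
  shows "radial_mean \<mu> f (\<lambda>s. u s + v s) = radial_mean \<mu> f u + radial_mean \<mu> f v"
proof -
  obtain K a where u: "u \<in> borel_measurable borel" "0 < a" "\<And>s. s \<ge> 0 \<Longrightarrow> \<bar>u s\<bar> \<le> K * exp (- (a * s))"
    using u unfolding exp_decaying_def by blast
  obtain L b where v: "v \<in> borel_measurable borel" "0 < b" "\<And>s. s \<ge> 0 \<Longrightarrow> \<bar>v s\<bar> \<le> L * exp (- (b * s))"
    using v unfolding exp_decaying_def by blast
  note iu = integrable_exp_decaying_norm(1)[OF u(2,1) fm u(3) f]
    and iv = integrable_exp_decaying_norm(1)[OF v(2,1) fm v(3) f]
  note ju = radial_mean_bound(1)[OF mu u(2,1) fm u(3) f]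
    and jv = radial_mean_bound(1)[OF mu v(2,1) fm v(3) f]
  show ?thesis unfolding radial_mean_def
    by (simp add: distrib_right Bochner_Integration.integral_add[OF iu iv] Bochner_Integration.integral_add[OF ju jv])
qed

lemma radial_mean_cmult: "radial_mean \<mu> f (\<lambda>s. c * u s) = c * radial_mean \<mu> f u"
  unfolding radial_mean_def by (simp add: mult.assoc)

lemma integral_convolution_gauss:
  fixes f :: "real^'n \<Rightarrow> real"
  assumes mu: "\<mu> \<in> borel_probabilities" and T: "0 < T"
    and [measurable]: "f \<in> borel_measurable borel" and f: "\<And>x. \<bar>f x\<bar> \<le> 1"
  shows "(\<integral>x. f x \<partial>(\<mu> \<star> gauss (\<lambda>_. sqrt T))) =
    (1 / sqrt (2 * pi * T)) ^ CARD('n) * radial_mean \<mu> f (\<lambda>s. exp (- (1 / (2 * T) * s)))"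
proof -
  have "(\<integral>x. f x \<partial>(\<mu> \<star> gauss (\<lambda>_. sqrt T))) = (\<integral>x. (\<integral>y. f (x + y) \<partial>gauss (\<lambda>_. sqrt T)) \<partial>\<mu>)"
    using T f by (intro integral_convolution[where B=1] mu gauss_prob) auto
  also have "(\<lambda>x. \<integral>y. f (x + y) \<partial>gauss (\<lambda>_. sqrt T)) = (\<lambda>x. \<integral>y. (1 / sqrt (2 * pi * T)) ^ CARD('n) *
      (exp (- (1 / (2 * T) * (norm y)\<^sup>2)) * f (x + y)) \<partial>lborel)"
    unfolding gauss_def
    by (subst integral_density)
      (use T in \<open>auto simp: gauss_isotropic_density[OF T] mult.assoc intro!: AE_I2\<close>)
  finally show ?thesis unfolding radial_mean_def by (simp only: integral_mult_right_zero)
qed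

section \<open>Error of Gaussian smoothing for Lipschitz functions\<close>

lemma abs_integral_le:
  fixes f :: "'a \<Rightarrow> real"
  assumes "prob_space M" and f: "f \<in> borel_measurable M" and B: "\<And>x. x \<in> space M \<Longrightarrow> \<bar>f x\<bar> \<le> B"
  shows "\<bar>\<integral>x. f x \<partial>M\<bar> \<le> B"
proof -
  interpret prob_space M by fact
  have i: "integrable M f" using B by (intro integrable_const_bound[where B=B] f) auto
  have "- B \<le> f x" "f x \<le> B" if "x \<in> space M" for x using B[OF that] by auto
  then have "- B \<le> (\<integral>x. f x \<partial>M)" "(\<integral>x. f x \<partial>M) \<le> B"
    by (auto intro!: integral_ge_const integral_le_const i)
  then show ?thesis by auto
qed

lemma gauss_abs_component:
  assumes s: "0 < s"
  shows "integrable (gauss (\<lambda>_::'n::finite. s)) (\<lambda>y. \<bar>y $ i\<bar>)" "(\<integral>y. \<bar>y $ i\<bar> \<partial>gauss (\<lambda>_::'n. s)) \<le> s"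
proof -
  have hb: "has_bochner_integral lborel (\<lambda>x. normal_density 0 s x * \<bar>x\<bar>) (s * sqrt (2 / pi))"
    using normal_moment_abs_odd[OF s, of 0 0] by simp
  let ?N = "density lborel (normal_density 0 s)"
  have int: "integrable ?N (\<lambda>x. \<bar>x\<bar>)"
    using has_bochner_integral_integrable hb by (subst integrable_density) (auto simp: has_bochner_integral_iff)
  have val: "(\<integral>x. \<bar>x\<bar> \<partial>?N) = s * sqrt (2 / pi)"
    using has_bochner_integral_integral_eq[OF hb] by (subst integral_density) auto
  interpret N: prob_space ?N by (rule prob_space_normal_density[OF s])
  \<comment> \<open>The single component is written as a product with factor 1 in all other
    coordinates, so that the product formula applies.\<close>
  define h where "h j x = (if j = i then \<bar>x\<bar> else 1)" for j :: 'n and x :: real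
  have prod: "(\<Prod>j\<in>UNIV. h j (y $ j)) = \<bar>y $ i\<bar>" for y :: "real^'n"
    by (simp add: h_def prod.If_cases[where P="\<lambda>j. j = i"] prod.delta)
  have hint: "integrable ?N (h j)" for j using int by (cases "j = i") (auto simp: h_def[abs_def])
  have "(\<integral>y. \<bar>y $ i\<bar> \<partial>gauss (\<lambda>_::'n. s)) = (\<Prod>j\<in>UNIV. (\<integral>x. h j x \<partial>?N))"
    unfolding prod[symmetric] by (rule integral_gauss_prod) (use s hint in auto)
  also have "\<dots> = (\<Prod>j\<in>UNIV. if j = i then s * sqrt (2 / pi) else 1)"
    by (intro prod.cong) (use N.prob_space in \<open>auto simp: h_def val\<close>)
  also have "\<dots> = s * sqrt (2 / pi)" by simp
  finally have v: "(\<integral>y. \<bar>y $ i\<bar> \<partial>gauss (\<lambda>_::'n. s)) = s * sqrt (2 / pi)" .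
  moreover have "sqrt (2 / pi) \<le> 1" using pi_gt3 by simp
  ultimately show "(\<integral>y. \<bar>y $ i\<bar> \<partial>gauss (\<lambda>_::'n. s)) \<le> s" using s by (simp add: mult_left_le)
  \<comment> \<open>A non-integrable function has Bochner integral 0, so the positive value found in
    \<open>v\<close> proves integrability.\<close>
  show "integrable (gauss (\<lambda>_::'n::finite. s)) (\<lambda>y. \<bar>y $ i\<bar>)"
    using v s not_integrable_integral_eq by fastforce
qed

lemma gauss_norm_mean:
  assumes s: "0 < s"
  shows "integrable (gauss (\<lambda>_::'n::finite. s)) norm" "(\<integral>y. norm y \<partial>gauss (\<lambda>_::'n. s)) \<le> real CARD('n) * s"
proof -
  have i: "integrable (gauss (\<lambda>_::'n::finite. s)) (\<lambda>y. \<Sum>i\<in>UNIV. \<bar>y $ i\<bar>)"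
    by (intro Bochner_Integration.integrable_sum gauss_abs_component s)
  show j: "integrable (gauss (\<lambda>_::'n::finite. s)) norm"
    by (rule Bochner_Integration.integrable_bound[OF i]) (auto intro!: AE_I2 order_trans[OF norm_le_l1_cart])
  have "(\<integral>y. norm y \<partial>gauss (\<lambda>_::'n. s)) \<le> (\<integral>y. (\<Sum>i\<in>UNIV. \<bar>y $ i\<bar>) \<partial>gauss (\<lambda>_::'n. s))"
    by (intro integral_mono i j norm_le_l1_cart)
  also have "\<dots> = (\<Sum>i\<in>UNIV. (\<integral>y. \<bar>y $ i\<bar> \<partial>gauss (\<lambda>_::'n. s)))"
    by (intro Bochner_Integration.integral_sum gauss_abs_component s)
  also have "\<dots> \<le> (\<Sum>i\<in>(UNIV::'n set). s)" by (intro sum_mono gauss_abs_component s)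
  finally show "(\<integral>y. norm y \<partial>gauss (\<lambda>_::'n. s)) \<le> real CARD('n) * s" by simp
qed

text \<open>The convolution displaces a point by a Gaussian vector whose mean norm is at most
  \<open>real CARD('n) * s\<close>, and \<open>f\<close> changes by no more than the
  displacement.\<close>

lemma lipschitz_gauss_error:
  fixes f :: "real^'n \<Rightarrow> real"
  assumes mu: "\<mu> \<in> borel_probabilities" and s: "0 < s"
    and f: "\<And>x. \<bar>f x\<bar> \<le> 1" and L: "1-lipschitz_on UNIV f"
  shows "\<bar>(\<integral>x. f x \<partial>\<mu>) - (\<integral>x. f x \<partial>(\<mu> \<star> gauss (\<lambda>_. s)))\<bar> \<le> real CARD('n) * s"
proof -
  have [measurable]: "f \<in> borel_measurable borel"
    using lipschitz_on_continuous_on[OF L] by (rule borel_measurable_continuous_onI)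
  note [measurable_cong] = borel_probabilitiesD(2)[OF mu]
  interpret M: prob_space \<mu> by (rule borel_probabilitiesD[OF mu])
  interpret G: prob_space "gauss (\<lambda>_::'n. s)" by (rule prob_space_gauss) (rule s)
  have iG: "integrable (gauss (\<lambda>_::'n. s)) (\<lambda>y. f (x + y))" for x
    using f by (intro integrable_bounded_prob[where B=1] G.prob_space_axioms) auto
  have bd: "\<bar>f x - (\<integral>y. f (x + y) \<partial>gauss (\<lambda>_. s))\<bar> \<le> real CARD('n) * s" for x
  proof -
    have "f x - (\<integral>y. f (x + y) \<partial>gauss (\<lambda>_. s)) = (\<integral>y. f x - f (x + y) \<partial>gauss (\<lambda>_. s))"
      using G.prob_space by (simp add: Bochner_Integration.integral_diff[OF _ iG])
    also have "norm \<dots> \<le> (\<integral>y. norm y \<partial>gauss (\<lambda>_::'n. s))"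
    proof (rule Bochner_Integration.integral_norm_bound_integral)
      show "norm (f x - f (x + y)) \<le> norm y" for y
        using lipschitz_onD[OF L, of x "x + y"] by (simp add: dist_norm norm_minus_commute)
    qed (auto intro!: gauss_norm_mean(1)[OF s] iG)
    finally show ?thesis using gauss_norm_mean(2)[OF s, where 'n='n] by simp
  qed
  have i1: "integrable \<mu> f" using f by (intro integrable_bounded_prob[where B=1] M.prob_space_axioms) auto
  have i2: "integrable \<mu> (\<lambda>x. \<integral>y. f (x + y) \<partial>gauss (\<lambda>_. s))"
    using f by (intro integrable_bounded_prob[where B=1] M.prob_space_axioms)
      (auto intro!: abs_integral_le G.prob_space_axioms)
  have "(\<integral>x. f x \<partial>\<mu>) - (\<integral>x. f x \<partial>(\<mu> \<star> gauss (\<lambda>_. s))) =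
      (\<integral>x. f x - (\<integral>y. f (x + y) \<partial>gauss (\<lambda>_. s)) \<partial>\<mu>)"
    using s f by (subst integral_convolution[where B=1]) (auto simp: mu gauss_prob Bochner_Integration.integral_diff[OF i1 i2])
  also have "\<bar>\<dots>\<bar> \<le> real CARD('n) * s"
    by (rule abs_integral_le[OF M.prob_space_axioms _ bd]) measurable
  finally show ?thesis .
qed

text \<open>Letting the test functions depend on \<open>n\<close> makes this, for probabilities on
  the Borel sets, the convergence of the total variation distances to 0, without a supremum.\<close>

definition asymptotically_equal :: "(nat \<Rightarrow> 'a::topological_space measure) \<Rightarrow> (nat \<Rightarrow> 'a measure) \<Rightarrow> bool" where
  "asymptotically_equal \<alpha> \<beta> \<longleftrightarrow> (\<forall>g :: nat \<Rightarrow> 'a \<Rightarrow> real. (\<forall>n. g n \<in> borel_measurable borel \<and> (\<forall>x. \<bar>g n x\<bar> \<le> 1)) \<longrightarrow>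
     (\<lambda>n. (\<integral>x. g n x \<partial>\<alpha> n) - (\<integral>x. g n x \<partial>\<beta> n)) \<longlonglongrightarrow> 0)"

text \<open>Averaging the translates of \<open>g n\<close> over \<open>N\<close> yields measurable
  functions bounded by 1, which are again admissible for \<open>\<alpha>\<close> and
  \<open>\<beta>\<close>.\<close>

lemma asymptotically_equal_convolution:
  fixes \<alpha> \<beta> :: "nat \<Rightarrow> (real^'n) measure"
  assumes eq: "asymptotically_equal \<alpha> \<beta>" and N: "N \<in> borel_probabilities"
    and a: "\<And>n. \<alpha> n \<in> borel_probabilities" and b: "\<And>n. \<beta> n \<in> borel_probabilities"
  shows "asymptotically_equal (\<lambda>n. \<alpha> n \<star> N) (\<lambda>n. \<beta> n \<star> N)"
  unfolding asymptotically_equal_def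
proof (intro allI impI)
  fix g :: "nat \<Rightarrow> real^'n \<Rightarrow> real" assume g: "\<forall>n. g n \<in> borel_measurable borel \<and> (\<forall>x. \<bar>g n x\<bar> \<le> 1)"
  then have [measurable]: "g n \<in> borel_measurable borel" for n by auto
  note [measurable_cong] = borel_probabilitiesD(2)[OF N]
  interpret N: prob_space N by (rule borel_probabilitiesD[OF N])
  have "(\<lambda>x. \<integral>y. g n (x + y) \<partial>N) \<in> borel_measurable borel" for n by measurable
  moreover have "\<bar>\<integral>y. g n (x + y) \<partial>N\<bar> \<le> 1" for n x
    using g by (intro abs_integral_le N.prob_space_axioms) auto
  ultimately have "(\<lambda>n. (\<integral>x. (\<integral>y. g n (x + y) \<partial>N) \<partial>\<alpha> n) - (\<integral>x. (\<integral>y. g n (x + y) \<partial>N) \<partial>\<beta> n)) \<longlonglongrightarrow> 0"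
    using eq[unfolded asymptotically_equal_def, rule_format, of "\<lambda>n x. \<integral>y. g n (x + y) \<partial>N"] by blast
  moreover have "(\<integral>x. g n x \<partial>(\<alpha> n \<star> N)) = (\<integral>x. (\<integral>y. g n (x + y) \<partial>N) \<partial>\<alpha> n)"
    "(\<integral>x. g n x \<partial>(\<beta> n \<star> N)) = (\<integral>x. (\<integral>y. g n (x + y) \<partial>N) \<partial>\<beta> n)" for n
    using g by (auto intro!: integral_convolution[where B=1] a b N)
  ultimately show "(\<lambda>n. (\<integral>x. g n x \<partial>(\<alpha> n \<star> N)) - (\<integral>x. g n x \<partial>(\<beta> n \<star> N))) \<longlonglongrightarrow> 0"
    by simp
qed

section \<open>Deconvolution with nearly extremal test functions\<close>

lemma bl_dist_bdd_above:
  fixes \<mu> \<nu> :: "('a::metric_space) measure"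
  assumes mu: "\<mu> \<in> borel_probabilities" and nu: "\<nu> \<in> borel_probabilities"
  shows "bdd_above ((\<lambda>f. \<bar>(\<integral>x. f x \<partial>\<mu>) - (\<integral>x. f x \<partial>\<nu>)\<bar>) `
    {f::'a \<Rightarrow> real. (\<forall>x. \<bar>f x\<bar> \<le> 1) \<and> 1-lipschitz_on UNIV f})"
proof (rule bdd_aboveI2)
  fix f :: "'a \<Rightarrow> real" assume f: "f \<in> {f. (\<forall>x. \<bar>f x\<bar> \<le> 1) \<and> 1-lipschitz_on UNIV f}"
  then have "f \<in> borel_measurable borel"
    using lipschitz_on_continuous_on by (intro borel_measurable_continuous_onI) blast
  then have "\<bar>\<integral>x. f x \<partial>\<mu>\<bar> \<le> 1" "\<bar>\<integral>x. f x \<partial>\<nu>\<bar> \<le> 1"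
    using f borel_probabilitiesD[OF mu] borel_probabilitiesD[OF nu]
    by (auto intro!: abs_integral_le simp: measurable_cong_sets[of \<mu> borel] measurable_cong_sets[of \<nu> borel])
  then show "\<bar>(\<integral>x. f x \<partial>\<mu>) - (\<integral>x. f x \<partial>\<nu>)\<bar> \<le> 2" by linarith
qed

lemma bl_dist_nearly_attained:
  fixes \<mu> \<nu> :: "('a::metric_space) measure"
  assumes mu: "\<mu> \<in> borel_probabilities" and nu: "\<nu> \<in> borel_probabilities" and e: "0 < e"
  shows "\<exists>f::'a \<Rightarrow> real. (\<forall>x. \<bar>f x\<bar> \<le> 1) \<and> 1-lipschitz_on UNIV f \<and>
     \<bar>bl_dist \<mu> \<nu>\<bar> \<le> \<bar>(\<integral>x. f x \<partial>\<mu>) - (\<integral>x. f x \<partial>\<nu>)\<bar> + e"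
proof -
  let ?F = "{f::'a \<Rightarrow> real. (\<forall>x. \<bar>f x\<bar> \<le> 1) \<and> 1-lipschitz_on UNIV f}"
  let ?d = "\<lambda>f. \<bar>(\<integral>x. f x \<partial>\<mu>) - (\<integral>x. f x \<partial>\<nu>)\<bar>"
  have zero: "(\<lambda>_. 0) \<in> ?F" by (auto intro!: lipschitz_intros lipschitz_on_mono[OF lipschitz_on_constant])
  note bdd = bl_dist_bdd_above[OF mu nu]
  have "0 \<le> bl_dist \<mu> \<nu>"
    unfolding bl_dist_def using cSUP_upper[OF zero bdd] by simp
  moreover obtain f where "f \<in> ?F" "bl_dist \<mu> \<nu> - e < ?d f"
    using less_cSUP_iff[THEN iffD1, OF _ bdd, of "bl_dist \<mu> \<nu> - e"] zero e unfolding bl_dist_def by force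
  ultimately show ?thesis by (intro exI[of _ f]) auto
qed

text \<open>
  The Gaussian smoothings of \<open>\<mu> n - \<nu> n\<close> with a large variance vanish in the limit, and since they
  depend on the inverse variance like a Laplace transform, so do those with a small variance.
\<close>

theorem bl_dist_deconvolution:
  fixes \<mu> \<nu> \<alpha> \<beta> :: "nat \<Rightarrow> (real^'n) measure"
  assumes m: "\<And>n. \<mu> n \<in> borel_probabilities" and n: "\<And>n. \<nu> n \<in> borel_probabilities"
    and a: "\<And>n. \<alpha> n \<in> borel_probabilities" and b: "\<And>n. \<beta> n \<in> borel_probabilities"
    and ca: "\<And>n. gaussian_extension Q (\<mu> n) (\<alpha> n)" and cb: "\<And>n. gaussian_extension Q (\<nu> n) (\<beta> n)"
    and eq: "asymptotically_equal \<alpha> \<beta>"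
  shows "(\<lambda>n. bl_dist (\<mu> n) (\<nu> n)) \<longlonglongrightarrow> 0"
proof -
  \<comment> \<open>One nearly extremal function per index replaces the supremum; the slack
    \<open>1 / Suc k\<close> vanishes in the limit.\<close>
  have "\<forall>k. \<exists>f::real^'n \<Rightarrow> real. (\<forall>x. \<bar>f x\<bar> \<le> 1) \<and> 1-lipschitz_on UNIV f \<and>
     \<bar>bl_dist (\<mu> k) (\<nu> k)\<bar> \<le> \<bar>(\<integral>x. f x \<partial>\<mu> k) - (\<integral>x. f x \<partial>\<nu> k)\<bar> + 1 / Suc k"
    by (intro allI bl_dist_nearly_attained m n) simp
  then obtain f :: "nat \<Rightarrow> real^'n \<Rightarrow> real" where f: "\<And>k x. \<bar>f k x\<bar> \<le> 1" and L: "\<And>k. 1-lipschitz_on UNIV (f k)"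
    and bl: "\<And>k. \<bar>bl_dist (\<mu> k) (\<nu> k)\<bar> \<le> \<bar>(\<integral>x. f k x \<partial>\<mu> k) - (\<integral>x. f k x \<partial>\<nu> k)\<bar> + 1 / Suc k"
    by metis
  have fm: "f k \<in> borel_measurable borel" for k
    using lipschitz_on_continuous_on[OF L] by (rule borel_measurable_continuous_onI)
  define \<Lambda> where "\<Lambda> k u = radial_mean (\<mu> k) (f k) u - radial_mean (\<nu> k) (f k) u" for k u
  interpret laplace_functionals \<Lambda>
  proof
    fix k c and u v :: "real \<Rightarrow> real"
    show "\<Lambda> k (\<lambda>s. u s + v s) = \<Lambda> k u + \<Lambda> k v" if "u \<in> exp_decaying" "v \<in> exp_decaying"
      unfolding \<Lambda>_def by (simp add: radial_mean_add[OF m that fm f] radial_mean_add[OF n that fm f])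
    show "\<Lambda> k (\<lambda>s. c * u s) = c * \<Lambda> k u"
      unfolding \<Lambda>_def by (simp add: radial_mean_cmult right_diff_distrib)
  next
    fix a :: real assume a: "0 < a"
    show "\<exists>c. \<forall>k K. \<forall>u\<in>exp_decaying. (\<forall>s\<ge>0. \<bar>u s\<bar> \<le> K * exp (- (a * s))) \<longrightarrow> \<bar>\<Lambda> k u\<bar> \<le> K * c"
    proof (intro exI allI ballI impI)
      fix k K u assume u: "u \<in> exp_decaying" and le: "\<forall>s\<ge>0. \<bar>u s\<bar> \<le> K * exp (- (a * s))"
      have um: "u \<in> borel_measurable borel" using u by (simp add: exp_decaying_def)
      show "\<bar>\<Lambda> k u\<bar> \<le> K * (2 * gauss_mass TYPE('n) a)"
        using radial_mean_bound(2)[OF m a um fm le[rule_format] f, of k k]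
          radial_mean_bound(2)[OF n a um fm le[rule_format] f, of k k]
        unfolding \<Lambda>_def by (simp add: algebra_simps)
    qed
  qed
  have gauss_eq: "(\<integral>x. f k x \<partial>(\<mu> k \<star> gauss (\<lambda>_. sqrt T))) - (\<integral>x. f k x \<partial>(\<nu> k \<star> gauss (\<lambda>_. sqrt T))) =
     (1 / sqrt (2 * pi * T)) ^ CARD('n) * \<Lambda> k (\<lambda>s. exp (- (1 / (2 * T) * s)))" if T: "0 < T" for k T
    unfolding \<Lambda>_def right_diff_distrib
    by (simp only: integral_convolution_gauss[OF m T fm f] integral_convolution_gauss[OF n T fm f])
  obtain T0 :: real where T0: "0 < T0" and ex: "\<And>T. T0 \<le> T \<Longrightarrow> \<exists>N\<in>borel_probabilities. \<forall>\<alpha>\<in>borel_probabilities. \<forall>\<mu>\<in>borel_probabilities.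
      gaussian_extension Q \<mu> \<alpha> \<longrightarrow> (\<alpha> \<star> N) = (\<mu> \<star> gauss (\<lambda>_. sqrt T))"
    using isotropic_completion[of Q] by metis
  \<comment> \<open>Small \<open>w\<close> means a variance \<open>T \<ge> T0\<close>, for which the
    added noise \<open>N\<close> exists; the Gaussian normalization is a constant factor and can be
    divided out.\<close>
  have base: "null (\<lambda>s. exp (- (w * s)))" if w: "0 < w" "w < 1 / (2 * T0)" for w
  proof -
    define T where "T = 1 / (2 * w)"
    have T: "T0 \<le> T" "0 < T" "w = 1 / (2 * T)" using w T0 by (auto simp: T_def field_simps)
    obtain N where N: "N \<in> borel_probabilities" and eqN: "\<And>\<alpha> \<mu>. \<alpha> \<in> borel_probabilities \<Longrightarrow> \<mu> \<in> borel_probabilities \<Longrightarrow>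
      gaussian_extension Q \<mu> \<alpha> \<Longrightarrow> (\<alpha> \<star> N) = (\<mu> \<star> gauss (\<lambda>_. sqrt T))" using ex[OF T(1)] by blast
    have "(\<lambda>k. (\<integral>x. f k x \<partial>(\<alpha> k \<star> N)) - (\<integral>x. f k x \<partial>(\<beta> k \<star> N))) \<longlonglongrightarrow> 0"
      using asymptotically_equal_convolution[OF eq N a b] fm f unfolding asymptotically_equal_def by blast
    then have "(\<lambda>k. (1 / sqrt (2 * pi * T)) ^ CARD('n) * \<Lambda> k (\<lambda>s. exp (- (w * s)))) \<longlonglongrightarrow> 0"
      unfolding eqN[OF a m ca] eqN[OF b n cb] gauss_eq[OF T(2)] T(3) by simp
    then have "(\<lambda>k. \<Lambda> k (\<lambda>s. exp (- (w * s)))) \<longlonglongrightarrow> 0"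
      using T(2) tendsto_mult_right_zero[of _ sequentially "1 / (1 / sqrt (2 * pi * T)) ^ CARD('n)"] by fastforce
    then show ?thesis using exp_decaying_power_exp[OF w(1), of 0] by (simp add: null_def)
  qed
  have lim: "(\<lambda>k. (\<integral>x. f k x \<partial>\<mu> k) - (\<integral>x. f k x \<partial>\<nu> k)) \<longlonglongrightarrow> 0"
  proof (rule LIMSEQ_I)
    fix r :: real assume r: "0 < r"
    \<comment> \<open>The smoothing errors for \<open>\<mu> k\<close> and \<open>\<nu> k\<close> are
      then at most \<open>r / 4\<close> each, which leaves \<open>r / 2\<close> for the smoothed
      difference. The standard deviation \<open>s\<close> corresponds to the exponent
      \<open>1 / (2 * s\<^sup>2)\<close>.\<close>
    define s where "s = r / (4 * real CARD('n))"
    have s: "0 < s" "real CARD('n) * s = r / 4" using r by (auto simp: s_def)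
    have "null (\<lambda>y. exp (- (1 / (2 * s\<^sup>2) * y)))" 
      using s T0 by - (rule null_exp[of "1 / (2 * T0)"], rule base, auto)
    then have "(\<lambda>k. (1 / sqrt (2 * pi * s\<^sup>2)) ^ CARD('n) * \<Lambda> k (\<lambda>y. exp (- (1 / (2 * s\<^sup>2) * y)))) \<longlonglongrightarrow> 0"
      unfolding null_def by (intro tendsto_mult_right_zero) auto
    then have "(\<lambda>k. (\<integral>x. f k x \<partial>(\<mu> k \<star> gauss (\<lambda>_. s))) - (\<integral>x. f k x \<partial>(\<nu> k \<star> gauss (\<lambda>_. s)))) \<longlonglongrightarrow> 0"
      using s by (subst (asm) gauss_eq[symmetric]) auto
    from LIMSEQ_D[OF this, of "r / 2"] r obtain k0 where
      k0: "\<And>k. k0 \<le> k \<Longrightarrow> \<bar>(\<integral>x. f k x \<partial>(\<mu> k \<star> gauss (\<lambda>_. s))) - (\<integral>x. f k x \<partial>(\<nu> k \<star> gauss (\<lambda>_. s)))\<bar> < r / 2" by auto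
    have "norm ((\<integral>x. f k x \<partial>\<mu> k) - (\<integral>x. f k x \<partial>\<nu> k) - 0) < r" if "k0 \<le> k" for k
      using k0[OF that] lipschitz_gauss_error[OF m s(1) f L, of k k] lipschitz_gauss_error[OF n s(1) f L, of k k] s(2)
      unfolding real_norm_def by linarith
    then show "\<exists>no. \<forall>k\<ge>no. norm ((\<integral>x. f k x \<partial>\<mu> k) - (\<integral>x. f k x \<partial>\<nu> k) - 0) < r" by blast
  qed
  have "(\<lambda>k. \<bar>(\<integral>x. f k x \<partial>\<mu> k) - (\<integral>x. f k x \<partial>\<nu> k)\<bar> + 1 / Suc k) \<longlonglongrightarrow> 0"
    using tendsto_add[OF tendsto_rabs_zero[OF lim] LIMSEQ_inverse_real_of_nat] by (simp add: divide_inverse)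
  then show ?thesis
    by (rule Lim_null_comparison[rotated]) (use bl in auto)
qed

section \<open>Observability and the Euler scheme\<close>

lemma matrix_pow_Suc_right: "matrix_pow A (Suc k) = matrix_pow A k ** A"
  by (induction k) (simp_all add: matrix_mul_assoc)

text \<open>The kernel of the first \<open>n\<close> blocks, for any number of blocks. This
  decreasing chain of subspaces takes the place of the Cayley-Hamilton theorem.\<close>

definition unobservable :: "real^'d^'d \<Rightarrow> real^'d^'q \<Rightarrow> nat \<Rightarrow> (real^'d) set" where
  "unobservable A C n = {x. \<forall>k<n. C *v (matrix_pow A k *v x) = 0}"

lemma subspace_unobservable: "subspace (unobservable A C n)"
  unfolding unobservable_def subspace_def
  by (auto simp: matrix_vector_right_distrib matrix_vector_mult_scaleR)

text \<open>Once the chain stops at \<open>n\<close>, its member is invariant under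
  \<open>A\<close>, so it contains the whole orbit of \<open>x\<close>.\<close>

lemma unobservable_stable:
  assumes eq: "unobservable A C n = unobservable A C (Suc n)" and x: "x \<in> unobservable A C n"
  shows "C *v (matrix_pow A k *v x) = 0"
proof -
  have "matrix_pow A k *v x \<in> unobservable A C n"
  proof (induction k)
    case 0 then show ?case using x by simp
  next
    case (Suc k)
    have "C *v (matrix_pow A j *v (A *v (matrix_pow A k *v x))) = 0" if "j < n" for j
    proof -
      have "C *v (matrix_pow A (Suc j) *v (matrix_pow A k *v x)) = 0"
        using Suc[unfolded eq] that by (simp only: unobservable_def mem_Collect_eq Suc_less_eq)
      then show ?thesis by (simp only: matrix_pow_Suc_right matrix_vector_mul_assoc[symmetric])
    qed
    then show ?case by (simp only: unobservable_def mem_Collect_eq matrix_pow.simps matrix_vector_mul_assoc[symmetric])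
      blast
  qed
  \<comment> \<open>Membership for \<open>Suc n\<close> blocks includes block 0, also in the case
    \<open>n = 0\<close>.\<close>
  then show ?thesis unfolding eq by (auto simp: unobservable_def)
qed

text \<open>The dimensions of the unobservable subspaces decrease strictly until these become constant.\<close>

lemma unobservable_CARD:
  fixes A :: "real^'d^'d"
  assumes x: "x \<in> unobservable A C CARD('d)"
  shows "C *v (matrix_pow A k *v x) = 0"
proof (cases "\<exists>n<CARD('d). unobservable A C n = unobservable A C (Suc n)")
  case True
  then obtain n where n: "n < CARD('d)" "unobservable A C n = unobservable A C (Suc n)" by blast
  then have "x \<in> unobservable A C n" using x by (auto simp: unobservable_def)
  then show ?thesis using unobservable_stable[OF n(2)] by blast
next
  case False
  have "n \<le> CARD('d) \<Longrightarrow> dim (unobservable A C n) + n \<le> CARD('d)" for n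
  proof (induction n)
    case 0 then show ?case using dim_subset_UNIV_cart[of "unobservable A C 0"] by simp
  next
    case (Suc n)
    have "unobservable A C (Suc n) \<subset> unobservable A C n"
    proof
      show "unobservable A C (Suc n) \<subseteq> unobservable A C n" by (auto simp: unobservable_def)
      show "unobservable A C (Suc n) \<noteq> unobservable A C n" using False Suc.prems by (metis Suc_le_eq)
    qed
    then have "dim (unobservable A C (Suc n)) < dim (unobservable A C n)"
      by (intro dim_psubset) (simp add: subspace_unobservable span_eq_iff[THEN iffD2])
    then show ?case using Suc by simp
  qed
  from this[of "CARD('d)"] have "dim (unobservable A C CARD('d)) = 0" by simp
  then have "x = 0" using x by auto
  then show ?thesis by (simp add: matrix_vector_mult_0_right)
qed

lemma full_rank_observability_matrix:
  fixes A :: "real^'d^'d" and C :: "real^'d^'q"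
  shows "full_rank (observability_matrix A C) \<longleftrightarrow>
    (\<forall>x. (\<forall>k. C *v (matrix_pow A k *v x) = 0) \<longrightarrow> x = 0)"
proof -
  let ?O = "observability_matrix A C"
  have bij: "bij_betw (to_nat_on (UNIV::'d set)) UNIV {..<CARD('d)}" by (rule to_nat_on_finite) simp
  have comp: "(?O *v x) $ (a, j) = (C *v (matrix_pow A (to_nat_on UNIV a) *v x)) $ j" for x a j
    by (simp add: observability_matrix_def matrix_vector_mult_def[of "vec_lambda _"] matrix_vector_mul_assoc)
      (simp add: matrix_vector_mult_def)
  have ker: "?O *v x = 0 \<longleftrightarrow> (\<forall>k. C *v (matrix_pow A k *v x) = 0)" for x
  proof
    assume 0: "?O *v x = 0"
    have "C *v (matrix_pow A k *v x) = 0" if "k < CARD('d)" for k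
    proof -
      obtain a where "k = to_nat_on UNIV (a::'d)" using bij \<open>k < _\<close> by (auto simp: bij_betw_def image_iff set_eq_iff)
      then show ?thesis using comp[of x a] 0 by (simp add: vec_eq_iff)
    qed
    then have "x \<in> unobservable A C CARD('d)" by (simp add: unobservable_def)
    then show "\<forall>k. C *v (matrix_pow A k *v x) = 0" using unobservable_CARD by blast
  qed (auto simp: vec_eq_iff comp)
  \<comment> \<open>The index type \<open>'q\<close> is nonempty, so the minimum in
    \<open>full_rank\<close> is the number of columns.\<close>
  have "full_rank ?O \<longleftrightarrow> rank ?O = CARD('d)" by (simp add: full_rank_def)
  also have "\<dots> \<longleftrightarrow> (\<forall>x. ?O *v x = 0 \<longrightarrow> x = 0)"
    unfolding full_rank_injective by (rule linear_injective_0) (rule matrix_vector_mul_linear)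
  finally show ?thesis unfolding ker .
qed

section \<open>The matrix exponential and the observations of the noiseless system\<close>

definition flow :: "real^'d^'d \<Rightarrow> real \<Rightarrow> real^'d \<Rightarrow> real^'d" where
  "flow A t x = (\<Sum>k. (t ^ k / fact k) *\<^sub>R (matrix_pow A k *v x))"

lemma flow_sums: "(\<lambda>k. (t ^ k / fact k) *\<^sub>R (matrix_pow A k *v x)) sums flow A t x"
  unfolding flow_def
proof (rule summable_sums, rule summable_comparison_test')
  define a where "a = onorm ((*v) A)"
  have a: "norm (A *v y) \<le> a * norm y" for y
    unfolding a_def by (rule onorm) (rule matrix_vector_mul_bounded_linear)
  have a0: "0 \<le> a" unfolding a_def by (rule onorm_pos_le) (rule matrix_vector_mul_bounded_linear)
  have p: "norm (matrix_pow A k *v x) \<le> a ^ k * norm x" for k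
  proof (induction k)
    case (Suc k)
    have "norm (matrix_pow A (Suc k) *v x) \<le> a * norm (matrix_pow A k *v x)"
      using a by (simp add: matrix_vector_mul_assoc[symmetric])
    also have "\<dots> \<le> a * (a ^ k * norm x)" using Suc a0 by (intro mult_left_mono)
    finally show ?case by (simp add: mult.assoc)
  qed simp
  show "summable (\<lambda>k. ((\<bar>t\<bar> * a) ^ k /\<^sub>R fact k) * norm x)"
    by (intro summable_mult2 summable_exp_generic)
  show "norm ((t ^ k / fact k) *\<^sub>R (matrix_pow A k *v x)) \<le> ((\<bar>t\<bar> * a) ^ k /\<^sub>R fact k) * norm x" if "0 \<le> k" for k
    using mult_left_mono[OF p[of k], of "\<bar>t\<bar> ^ k / fact k"]
    by (simp add: power_abs power_mult_distrib field_simps)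
qed

lemma linear_flow: "linear (flow A t)"
proof
  show "flow A t (x + y) = flow A t x + flow A t y" for x y
    using sums_add[OF flow_sums[of t A x] flow_sums[of t A y]] flow_sums[of t A "x + y"]
    by (simp add: matrix_vector_right_distrib scaleR_add_right sums_unique2)
  show "flow A t (c *\<^sub>R x) = c *\<^sub>R flow A t x" for c x
    using bounded_linear.sums[OF bounded_linear_scaleR_right flow_sums[of t A x], of c] flow_sums[of t A "c *\<^sub>R x"]
    by (simp add: matrix_vector_mult_scaleR mult.commute sums_unique2)
qed

lemma flow_0 [simp]: "flow A 0 x = x"
proof -
  have "(\<lambda>k. (0 ^ k / fact k) *\<^sub>R (matrix_pow A k *v x)) sums (\<Sum>k\<in>{0}. (0 ^ k / fact k) *\<^sub>R (matrix_pow A k *v x))"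
    by (rule sums_finite) auto
  then show ?thesis using flow_sums[of 0 A x] by (auto dest: sums_unique2)
qed

text \<open>Every component is an everywhere convergent scalar power series and may be
  differentiated term by term. The resulting series is the flow of \<open>A *v x\<close>, and
  \<open>A\<close> commutes with the flow.\<close>

lemma flow_has_vector_derivative: "((\<lambda>t. flow A t x) has_vector_derivative A *v flow A t x) (at t within S)"
proof -
  have comp: "(\<lambda>k. ((matrix_pow A k *v y) $ i / fact k) * t ^ k) sums (flow A t y $ i)" for y t i
    using bounded_linear.sums[OF bounded_linear_vec_nth flow_sums[of t A y], of i] by (simp add: mult.commute)
  have "((\<lambda>t. flow A t x $ i) has_real_derivative (A *v flow A t x) $ i) (at t)" for i
  proof -
    let ?c = "\<lambda>k. (matrix_pow A k *v x) $ i / fact k"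
    have "((\<lambda>t. \<Sum>k. ?c k * t ^ k) has_real_derivative (\<Sum>k. diffs ?c k * t ^ k)) (at t)"
      by (rule termdiffs_strong_converges_everywhere) (use comp in \<open>auto intro: sums_summable\<close>)
    moreover have "(\<lambda>t. \<Sum>k. ?c k * t ^ k) = (\<lambda>t. flow A t x $ i)"
      using sums_unique[OF comp] by auto
    moreover have "diffs ?c k * t ^ k = ((matrix_pow A k *v (A *v x)) $ i / fact k) * t ^ k" for k
    proof -
      have "matrix_pow A k *v (A *v x) = matrix_pow A (Suc k) *v x"
        by (simp only: matrix_vector_mul_assoc matrix_pow_Suc_right)
      then show ?thesis by (simp add: diffs_def del: matrix_pow.simps of_nat_Suc)
    qed
    then have "(\<Sum>k. diffs ?c k * t ^ k) = flow A t (A *v x) $ i"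
      using sums_unique[OF comp[where y="A *v x"]] by simp
    moreover have "flow A t (A *v x) = A *v flow A t x"
    proof -
      have "(\<lambda>k. A *v ((t ^ k / fact k) *\<^sub>R (matrix_pow A k *v x))) sums (A *v flow A t x)"
        by (rule bounded_linear.sums[OF matrix_vector_mul_bounded_linear flow_sums])
      moreover have "A *v ((t ^ k / fact k) *\<^sub>R (matrix_pow A k *v x)) = (t ^ k / fact k) *\<^sub>R (matrix_pow A k *v (A *v x))" for k
        using matrix_pow_Suc_right[of A k]
        by (simp add: matrix_vector_mult_scaleR matrix_vector_mul_assoc)
      ultimately show ?thesis using flow_sums[of t A "A *v x"] by (simp add: sums_unique2)
    qed
    ultimately show ?thesis by simp
  qed
  then have "((\<lambda>t. flow A t x) has_derivative (\<lambda>h. h *\<^sub>R (A *v flow A t x))) (at t)"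
    by (subst has_derivative_componentwise_within)
      (auto simp: Basis_vec_def inner_axis has_field_derivative_def mult_commute_abs)
  then show ?thesis unfolding has_vector_derivative_def by (rule has_derivative_at_withinI)
qed

lemma continuous_on_flow: "continuous_on S (\<lambda>t. flow A t x)"
  by (rule continuous_on_vector_derivative) (rule flow_has_vector_derivative)

lemma continuous_on_matrix_mult [continuous_intros]:
  fixes A :: "real^'n^'m"
  shows "continuous_on S f \<Longrightarrow> continuous_on S (\<lambda>s. A *v f s)"
  by (rule bounded_linear.continuous_on[OF matrix_vector_mul_bounded_linear])

lemma flow_integral:
  assumes "0 \<le> t" shows "flow A t x = x + integral {0..t} (\<lambda>s. A *v flow A s x)"
proof -
  have "((\<lambda>s. A *v flow A s x) has_integral (flow A t x - flow A 0 x)) {0..t}"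
    using assms flow_has_vector_derivative by (intro fundamental_theorem_of_calculus) auto
  then show ?thesis by (simp add: integral_unique)
qed

text \<open>The contribution of the initial condition \<open>x\<close> to the observation at time
  \<open>t\<close>.\<close>

definition obs_flow :: "real^'d^'d \<Rightarrow> real^'d^'q \<Rightarrow> real \<Rightarrow> real^'d \<Rightarrow> real^'q" where
  "obs_flow A C t x = integral {0..t} (\<lambda>s. C *v flow A s x)"

lemma linear_obs_flow: "linear (obs_flow A C t)"
proof
  have i: "(\<lambda>s. C *v flow A s x) integrable_on {0..t}" for x
    by (intro integrable_continuous_real continuous_intros continuous_on_flow)
  show "obs_flow A C t (x + y) = obs_flow A C t x + obs_flow A C t y" for x y
    unfolding obs_flow_def by (simp add: linear_add[OF linear_flow] matrix_vector_right_distrib integral_add[OF i i])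
  show "obs_flow A C t (c *\<^sub>R x) = c *\<^sub>R obs_flow A C t x" for c x
    unfolding obs_flow_def by (simp add: linear_scale[OF linear_flow] matrix_vector_mult_scaleR)
qed

lemma obs_flow_eq_0:
  assumes "\<And>k. C *v (matrix_pow A k *v x) = 0" shows "obs_flow A C t x = 0"
proof -
  have "C *v flow A s x = 0" for s
  proof -
    have "(\<lambda>k. C *v ((s ^ k / fact k) *\<^sub>R (matrix_pow A k *v x))) sums (C *v flow A s x)"
      by (rule bounded_linear.sums[OF matrix_vector_mul_bounded_linear flow_sums])
    then show ?thesis using assms by (simp add: matrix_vector_mult_scaleR sums_unique2[OF _ sums_zero])
  qed
  then show ?thesis by (simp add: obs_flow_def)
qed

text \<open>Repeated differentiation of the vanishing function produces \<open>C\<close>, then one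
  more factor \<open>A\<close> each time; the values at \<open>t = 0\<close> are the claim.\<close>

lemma obs_flow_eq_0D:
  assumes 0: "\<And>t. 0 \<le> t \<Longrightarrow> obs_flow A C t x = 0"
  shows "C *v (matrix_pow A k *v x) = 0"
proof -
  \<comment> \<open>Only times \<open>t \<ge> 0\<close> are covered by the hypothesis, so
    derivatives are taken within \<open>{0..1}\<close>, one-sided at the point 0 that is used in the
    end.\<close>
  have *: "(C ** matrix_pow A k) *v flow A t x = 0" if "t \<in> {0..1}" for t
    using that
  proof (induction k arbitrary: t)
    case 0
    have "((\<lambda>u. integral {0..u} (\<lambda>s. C *v flow A s x)) has_vector_derivative C *v flow A t x) (at t within {0..1})"
      by (rule integral_has_vector_derivative) (use 0 in \<open>auto intro!: continuous_intros continuous_on_flow\<close>)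
    moreover have "((\<lambda>u. integral {0..u} (\<lambda>s. C *v flow A s x)) has_vector_derivative 0) (at t within {0..1})"
      by (rule has_vector_derivative_transform[OF \<open>t \<in> {0..1}\<close> _ has_vector_derivative_const[of 0]])
        (use assms in \<open>auto simp: obs_flow_def\<close>)
    ultimately show ?case
      using vector_derivative_unique_within_closed_interval[of 0 1 t] 0 by (auto simp: cbox_interval)
  next
    case (Suc k)
    have "((\<lambda>u. (C ** matrix_pow A k) *v flow A u x) has_vector_derivative (C ** matrix_pow A k) *v (A *v flow A t x)) (at t within {0..1})"
      by (rule bounded_linear.has_vector_derivative[OF matrix_vector_mul_bounded_linear flow_has_vector_derivative])
    moreover have "((\<lambda>u. (C ** matrix_pow A k) *v flow A u x) has_vector_derivative 0) (at t within {0..1})"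
      by (rule has_vector_derivative_transform[OF \<open>t \<in> {0..1}\<close> _ has_vector_derivative_const[of 0]])
        (use Suc in auto)
    ultimately have "(C ** matrix_pow A k) *v (A *v flow A t x) = 0"
      using vector_derivative_unique_within_closed_interval[of 0 1 t] Suc by (auto simp: cbox_interval)
    then show ?case
      by (simp only: matrix_vector_mul_assoc matrix_pow_Suc_right matrix_mul_assoc[symmetric])
  qed
  from *[of 0] show ?thesis by (simp add: matrix_vector_mul_assoc)
qed

text \<open>A least squares estimate recovers \<open>x\<close> from finitely many of the observations \<open>\<Phi> t x\<close>.\<close>

lemma finite_reconstruction:
  fixes \<Phi> :: "'t \<Rightarrow> real^'d \<Rightarrow> real^'q"
  assumes lin: "\<And>t. linear (\<Phi> t)" and inj: "\<And>x. (\<And>t. t \<in> S \<Longrightarrow> \<Phi> t x = 0) \<Longrightarrow> x = 0"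
  obtains F and P :: "'t \<Rightarrow> real^'q^'d" where "finite F" "F \<subseteq> S" "\<And>x. (\<Sum>t\<in>F. P t *v \<Phi> t x) = x"
proof -
  define N where "N F = {x. \<forall>t\<in>F. \<Phi> t x = 0}" for F
  have sub: "subspace (N F)" for F
    unfolding N_def subspace_def by (auto simp: linear_0[OF lin] linear_add[OF lin] linear_scale[OF lin])
  \<comment> \<open>Among all finite sets of times, one whose common kernel has least dimension. A
    further time cannot shrink that kernel, so every \<open>\<Phi> t\<close> with
    \<open>t \<in> S\<close> vanishes on it.\<close>
  obtain F where F: "finite F" "F \<subseteq> S" and least: "\<And>F'. finite F' \<Longrightarrow> F' \<subseteq> S \<Longrightarrow> dim (N F) \<le> dim (N F')"
    using ex_has_least_nat[of "\<lambda>F. finite F \<and> F \<subseteq> S" "{}" "\<lambda>F. dim (N F)"] by blast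
  have N0: "x = 0" if x: "x \<in> N F" for x
  proof (rule inj, rule ccontr)
    fix t assume t: "t \<in> S" "\<Phi> t x \<noteq> 0"
    have "N (insert t F) \<subset> N F" using x t by (auto simp: N_def)
    then have "dim (N (insert t F)) < dim (N F)"
      by (intro dim_psubset) (simp add: sub span_eq_iff[THEN iffD2])
    then show False using least[of "insert t F"] F t by auto
  qed
  \<comment> \<open>The operator of the normal equations: \<open>x \<bullet> G x\<close> is the sum
    of the squared norms of the observations, whence injectivity. The matrices \<open>P t\<close>
    are a left inverse of \<open>G\<close> composed with the adjoints.\<close>
  define G where "G x = (\<Sum>t\<in>F. adjoint (\<Phi> t) (\<Phi> t x))" for x
  have linG: "linear G" unfolding G_def
    by (rule linear_compose_sum) (auto intro: linear_compose[OF lin adjoint_linear[OF lin], unfolded o_def])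
  have "inj G"
  proof (subst linear_injective_0[OF linG], intro allI impI)
    fix x assume "G x = 0"
    then have "0 = x \<bullet> G x" by simp
    also have "\<dots> = (\<Sum>t\<in>F. \<Phi> t x \<bullet> \<Phi> t x)"
      unfolding G_def inner_sum_right by (simp add: adjoint_works[OF lin])
    finally have "\<forall>t\<in>F. \<Phi> t x \<bullet> \<Phi> t x = 0" using F by (subst (asm) eq_commute, subst (asm) sum_nonneg_eq_0_iff) auto
    then show "x = 0" by (intro N0) (auto simp: N_def)
  qed
  then obtain H where H: "linear H" "H \<circ> G = id" using linear_injective_left_inverse[OF linG] by blast
  show ?thesis
  proof (rule that[OF F])
    fix x
    have l: "linear (\<lambda>y. H (adjoint (\<Phi> t) y))" for t
      by (rule linear_compose[OF adjoint_linear[OF lin] H(1), unfolded o_def])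
    have "(\<Sum>t\<in>F. matrix (\<lambda>y. H (adjoint (\<Phi> t) y)) *v \<Phi> t x) = (\<Sum>t\<in>F. H (adjoint (\<Phi> t) (\<Phi> t x)))"
      by (simp add: matrix_works l)
    also have "\<dots> = H (G x)" unfolding G_def by (rule linear_sum[OF H(1), symmetric])
    finally show "(\<Sum>t\<in>F. matrix (\<lambda>y. H (adjoint (\<Phi> t) y)) *v \<Phi> t x) = x"
      using H(2) by (simp add: fun_eq_iff)
  qed
qed

section \<open>Pathwise convergence of the Euler scheme\<close>

primrec euler :: "real^'d^'d \<Rightarrow> real \<Rightarrow> (nat \<Rightarrow> real^'d) \<Rightarrow> nat \<Rightarrow> real^'d" where
  "euler A h \<beta> 0 = 0"
| "euler A h \<beta> (Suc j) = euler A h \<beta> j + h *\<^sub>R (A *v euler A h \<beta> j) + \<beta> j"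

text \<open>Only the noise part is approximated: the scheme starts at 0, since by linearity the
  initial condition enters through \<open>obs_flow\<close>. The integral becomes a Riemann
  sum.\<close>

definition euler_obs :: "real^'d^'d \<Rightarrow> real^'p^'d \<Rightarrow> real^'d^'q \<Rightarrow> real^'r^'q \<Rightarrow> real \<Rightarrow> nat \<Rightarrow>
    (nat \<Rightarrow> real^'p) \<Rightarrow> (nat \<Rightarrow> real^'r) \<Rightarrow> real^'q" where
  "euler_obs A B C D h k w v = h *\<^sub>R (\<Sum>j<k. C *v euler A h (\<lambda>i. B *v w i) j) + (\<Sum>j<k. D *v v j)"

definition increments :: "(real \<Rightarrow> 'a::real_vector) \<Rightarrow> real \<Rightarrow> nat \<Rightarrow> 'a" where
  "increments f h i = f (real (Suc i) * h) - f (real i * h)"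

lemma sum_increments: "(\<Sum>i<k. increments f h i) = f (real k * h) - f 0"
  unfolding increments_def by (induction k) auto

lemma integral_step_error:
  fixes f :: "real \<Rightarrow> 'a::euclidean_space"
  assumes f: "continuous_on {p..p + h} f" and h: "0 \<le> h" and e: "\<And>s. s \<in> {p..p + h} \<Longrightarrow> norm (f s - z) \<le> e"
  shows "norm (integral {p..p + h} f - h *\<^sub>R z) \<le> h * e"
proof -
  have i: "f integrable_on {p..p + h}" using f by (rule integrable_continuous_real)
  have "integral {p..p + h} f - h *\<^sub>R z = integral {p..p + h} (\<lambda>s. f s - z)"
    using h by (simp add: Henstock_Kurzweil_Integration.integral_diff[OF i integrable_const_ivl])
  also have "norm \<dots> \<le> e * (p + h - p)"
    by (rule integral_bound) (use h f e in \<open>auto intro!: continuous_intros\<close>)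
  finally show ?thesis by (simp add: mult.commute)
qed

text \<open>A discrete Gronwall estimate: one step multiplies the error by at most
  \<open>1 + h * a\<close> and adds at most \<open>h * (a * e)\<close>. The oscillation
  \<open>e\<close> of \<open>x\<close> during a step replaces a Taylor remainder, because the noise
  paths need not be differentiable.\<close>

lemma euler_error:
  fixes x b :: "real \<Rightarrow> real^'d" and A :: "real^'d^'d"
  assumes x: "continuous_on {0..} x" and eq: "\<And>t. 0 \<le> t \<Longrightarrow> x t = integral {0..t} (\<lambda>s. A *v x s) + b t"
    and b0: "b 0 = 0" and h: "0 < h" and a: "\<And>y. norm (A *v y) \<le> a * norm y" "0 \<le> a"
    and e: "\<And>j s. j < k \<Longrightarrow> s \<in> {real j * h..real (Suc j) * h} \<Longrightarrow> norm (x s - x (real j * h)) \<le> e"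
    and j: "j \<le> k"
  shows "norm (x (real j * h) - euler A h (increments b h) j) \<le> real j * h * (a * e) * (1 + h * a) ^ j"
  using j
proof (induction j)
  case 0
  then show ?case using eq[of 0] b0 by simp
next
  case (Suc j)
  let ?p = "real j * h"
  have p: "0 \<le> ?p" "real (Suc j) * h = ?p + h" using h by (auto simp: algebra_simps)
  have xc: "continuous_on S x" if "S \<subseteq> {0..}" for S using x that by (rule continuous_on_subset)
  have sub: "{?p..?p + h} \<subseteq> {0..}" using p(1) by (metis atLeastAtMost_iff atLeast_iff order_trans subsetI)
  have e0: "0 \<le> e" using e[of j ?p] Suc.prems h by (auto simp: algebra_simps)
  have "x (?p + h) = x ?p + integral {?p..?p + h} (\<lambda>s. A *v x s) + increments b h j"
  proof -
    have "integral {0..?p} (\<lambda>s. A *v x s) + integral {?p..?p + h} (\<lambda>s. A *v x s) = integral {0..?p + h} (\<lambda>s. A *v x s)"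
      using p h by (intro Henstock_Kurzweil_Integration.integral_combine integrable_continuous_real continuous_intros xc) auto
    then show ?thesis using eq[of ?p] eq[of "?p + h"] p h by (simp add: increments_def algebra_simps)
  qed
  then have "x (real (Suc j) * h) - euler A h (increments b h) (Suc j) =
      (x ?p - euler A h (increments b h) j) + h *\<^sub>R (A *v (x ?p - euler A h (increments b h) j)) +
      (integral {?p..?p + h} (\<lambda>s. A *v x s) - h *\<^sub>R (A *v x ?p))" (is "_ = ?d + h *\<^sub>R (A *v ?d) + ?r")
    by (simp only: p(2)) (simp add: matrix_vector_mult_diff_distrib algebra_simps)
  also have "norm \<dots> \<le> norm ?d + h * (a * norm ?d) + h * (a * e)"
  proof (intro norm_triangle_le add_mono order_refl)
    show "norm (h *\<^sub>R (A *v ?d)) \<le> h * (a * norm ?d)" using h a by (simp add: mult_left_mono)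
    show "norm ?r \<le> h * (a * e)"
    proof (rule integral_step_error)
      fix s assume s: "s \<in> {?p..?p + h}"
      have "norm (A *v x s - A *v x ?p) \<le> a * norm (x s - x ?p)"
        using a(1)[of "x s - x ?p"] by (simp add: matrix_vector_mult_diff_distrib)
      also have "\<dots> \<le> a * e" using e[of j s] s Suc.prems a p by (intro mult_left_mono) auto
      finally show "norm (A *v x s - A *v x ?p) \<le> a * e" .
    qed (use h in \<open>auto intro: continuous_on_matrix_mult[OF xc[OF sub]]\<close>)
  qed
  also have "\<dots> = (1 + h * a) * norm ?d + h * (a * e)" by (simp add: algebra_simps)
  \<comment> \<open>The new error is enlarged by a power of \<open>1 + h * a\<close>, which is at
    least 1, to match the closed form.\<close>
  also have "\<dots> \<le> (1 + h * a) * (real j * h * (a * e) * (1 + h * a) ^ j) + h * (a * e) * (1 + h * a) ^ Suc j"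
  proof (rule add_mono)
    show "(1 + h * a) * norm ?d \<le> (1 + h * a) * (real j * h * (a * e) * (1 + h * a) ^ j)"
      using Suc h a by (intro mult_left_mono Suc.IH) auto
    have "1 \<le> (1 + h * a) ^ Suc j" using h a by (intro one_le_power) auto
    then show "h * (a * e) \<le> h * (a * e) * (1 + h * a) ^ Suc j"
      using h a e0 mult_left_mono[of 1 "(1 + h * a) ^ Suc j" "h * (a * e)"] by simp
  qed
  also have "\<dots> = real (Suc j) * h * (a * e) * (1 + h * a) ^ Suc j" by (simp add: algebra_simps)
  finally show ?case .
qed


abbreviation mesh :: "nat \<Rightarrow> real" where
  "mesh m \<equiv> 1 / real (Suc m)"

text \<open>The number of steps counts those completed by time \<open>t\<close>; the last piece,
  shorter than the mesh, is dropped.\<close>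

abbreviation euler_approx :: "real^'d^'d \<Rightarrow> real^'p^'d \<Rightarrow> real^'d^'q \<Rightarrow> real^'r^'q \<Rightarrow> nat \<Rightarrow> real \<Rightarrow>
    (nat \<Rightarrow> real^'p) \<Rightarrow> (nat \<Rightarrow> real^'r) \<Rightarrow> real^'q" where
  "euler_approx A B C D m t \<equiv> euler_obs A B C D (mesh m) (nat \<lfloor>t * real (Suc m)\<rfloor>)"

text \<open>A deterministic statement about single paths. The noise is additive, so the scheme
  converges path by path for continuous \<open>x\<close> and \<open>v\<close>, and no stochastic
  integral occurs.\<close>

lemma euler_obs_tendsto:
  fixes x :: "real \<Rightarrow> real^'d" and w :: "real \<Rightarrow> real^'p" and y :: "real \<Rightarrow> real^'q" and v :: "real \<Rightarrow> real^'r"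
  assumes x: "continuous_on {0..} x" and v: "continuous_on {0..} v"
    and xeq: "\<And>t. 0 \<le> t \<Longrightarrow> x t = integral {0..t} (\<lambda>s. A *v x s) + B *v w t"
    and yeq: "\<And>t. 0 \<le> t \<Longrightarrow> y t = integral {0..t} (\<lambda>s. C *v x s) + D *v v t"
    and 0: "w 0 = 0" "v 0 = 0" and t: "0 \<le> t"
  shows "(\<lambda>m. euler_approx A B C D m t (increments w (mesh m)) (increments v (mesh m))) \<longlonglongrightarrow> y t"
proof (rule LIMSEQ_I)
  fix r :: real assume r: "0 < r"
  define a where "a = onorm ((*v) A)"
  define c where "c = onorm ((*v) C)"
  have a: "norm (A *v z) \<le> a * norm z" "0 \<le> a" for z
    unfolding a_def by (intro onorm onorm_pos_le matrix_vector_mul_bounded_linear)+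
  have c: "norm (C *v z) \<le> c * norm z" "0 \<le> c" for z
    unfolding c_def by (intro onorm onorm_pos_le matrix_vector_mul_bounded_linear)+
  \<comment> \<open>Collects the error over time \<open>t\<close>: in each step \<open>x\<close>
    oscillates by \<open>e\<close> and the scheme is off by at most
    \<open>t * (a * e) * exp (t * a)\<close>, both passed through \<open>C\<close>. Half of
    \<open>r\<close> is reserved for this, half for the dropped last piece.\<close>
  define K where "K = t * (c * (1 + t * a * exp (t * a)))"
  have K: "0 \<le> K" using t a c by (simp add: K_def)
  define e where "e = r / (2 * (K + 1))"
  have e: "0 < e" "K * e < r / 2" using r K by (auto simp: e_def field_simps)
  have xc: "continuous_on S x" if "S \<subseteq> {0..}" for S using x that by (rule continuous_on_subset)
  have ucont: "uniformly_continuous_on {0..t} x"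
    by (intro compact_uniformly_continuous xc) auto
  obtain d1 where d1: "0 < d1" "\<And>s s'. s \<in> {0..t} \<Longrightarrow> s' \<in> {0..t} \<Longrightarrow> dist s' s < d1 \<Longrightarrow> dist (x s') (x s) < e"
    using ucont e(1) unfolding uniformly_continuous_on_def by meson
  have "continuous_on {0..t} (\<lambda>t. integral {0..t} (\<lambda>s. C *v x s) + D *v v t)"
    by (intro continuous_intros indefinite_integral_continuous_1 integrable_continuous_real xc
      continuous_on_subset[OF v]) auto
  then have "continuous_on {0..t} y" by (rule continuous_on_eq) (simp add: yeq)
  then obtain d2 where d2: "0 < d2" "\<And>s. s \<in> {0..t} \<Longrightarrow> dist s t < d2 \<Longrightarrow> dist (y s) (y t) < r / 2"
    using t r unfolding continuous_on_iff by (metis atLeastAtMost_iff half_gt_zero order_refl)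
  obtain m0 where m0: "1 / real (Suc m0) < min d1 d2"
    using reals_Archimedean[of "min d1 d2"] d1 d2 by (auto simp: inverse_eq_divide)
  have "norm (euler_approx A B C D m t (increments w (mesh m)) (increments v (mesh m)) - y t) < r" if m: "m0 \<le> m" for m
  proof -
    define h where "h = mesh m"
    define k where "k = nat \<lfloor>t * real (Suc m)\<rfloor>"
    have "mesh m \<le> 1 / real (Suc m0)" using m by (intro divide_left_mono) auto
    then have h: "0 < h" "h < d1" "h < d2" using m0 by (auto simp: h_def)
    have k: "real k * h \<le> t" "t < real k * h + h"
    proof -
      have "0 \<le> t * real (Suc m)" using t by simp
      then have "real k \<le> t * real (Suc m)" "t * real (Suc m) < real k + 1"
        unfolding k_def by (auto simp: of_nat_nat)
      then show "real k * h \<le> t" "t < real k * h + h" by (auto simp: h_def field_simps)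
    qed
    have jk: "real j * h \<le> t" if "j \<le> k" for j
      using that k(1) h mult_right_mono[of "real j" "real k" h] by linarith
    have mod: "norm (x s - x (real j * h)) \<le> e" if j: "j < k" and s: "s \<in> {real j * h..real (Suc j) * h}" for j s
    proof -
      have "real (Suc j) * h = real j * h + h" by (simp add: algebra_simps)
      then have "s \<in> {0..t}" "real j * h \<in> {0..t}" "dist s (real j * h) \<le> h"
        using s h j jk[of "Suc j"] jk[of j] order_trans[of 0 "real j * h" s] by (auto simp: dist_real_def)
      then show ?thesis using d1(2)[of "real j * h" s] h by (simp add: dist_norm)
    qed
    let ?E = "t * (a * e) * exp (t * a)"
    let ?\<epsilon> = "\<lambda>j. euler A h (\<lambda>i. B *v increments w h i) j"
    have inc: "increments (\<lambda>t. B *v w t) h = (\<lambda>i. B *v increments w h i)"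
      by (simp add: fun_eq_iff increments_def matrix_vector_mult_diff_distrib)
    have err: "norm (x (real j * h) - ?\<epsilon> j) \<le> ?E" if j: "j \<le> k" for j
    proof -
      have "norm (x (real j * h) - ?\<epsilon> j) \<le> real j * h * (a * e) * (1 + h * a) ^ j"
        unfolding inc[symmetric] using 0 by (intro euler_error[OF x xeq _ h(1) a mod j]) auto
      also have "\<dots> \<le> t * (a * e) * exp (h * a) ^ j"
        using jk[OF j] h a e t by (intro mult_mono power_mono) auto
      also have "\<dots> \<le> ?E"
      proof (rule mult_left_mono)
        show "exp (h * a) ^ j \<le> exp (t * a)"
          using jk[OF j] a by (auto simp: exp_of_nat_mult[symmetric] mult.assoc[symmetric] intro!: mult_right_mono)
      qed (use t a e in auto)
      finally show ?thesis .
    qed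
    have int: "norm (integral {0..real j * h} (\<lambda>s. C *v x s) - h *\<^sub>R (\<Sum>i<j. C *v ?\<epsilon> i)) \<le> real j * h * (c * (e + ?E))"
      if "j \<le> k" for j
      using that
    proof (induction j)
      case (Suc j)
      let ?p = "real j * h"
      have p: "0 \<le> ?p" "real (Suc j) * h = ?p + h" using h by (auto simp: algebra_simps)
      have sub: "{?p..?p + h} \<subseteq> {0..}" using p(1) by (metis atLeastAtMost_iff atLeast_iff order_trans subsetI)
      have "integral {0..?p} (\<lambda>s. C *v x s) + integral {?p..?p + h} (\<lambda>s. C *v x s) = integral {0..?p + h} (\<lambda>s. C *v x s)"
        using p h by (intro Henstock_Kurzweil_Integration.integral_combine integrable_continuous_real continuous_intros xc) auto
      then have "integral {0..real (Suc j) * h} (\<lambda>s. C *v x s) - h *\<^sub>R (\<Sum>i<Suc j. C *v ?\<epsilon> i) =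
        (integral {0..?p} (\<lambda>s. C *v x s) - h *\<^sub>R (\<Sum>i<j. C *v ?\<epsilon> i)) + (integral {?p..?p + h} (\<lambda>s. C *v x s) - h *\<^sub>R (C *v ?\<epsilon> j))"
        unfolding p(2) by (simp add: algebra_simps)
      also have "norm \<dots> \<le> real j * h * (c * (e + ?E)) + h * (c * (e + ?E))"
      proof (intro norm_triangle_le add_mono)
        show "norm (integral {?p..?p + h} (\<lambda>s. C *v x s) - h *\<^sub>R (C *v ?\<epsilon> j)) \<le> h * (c * (e + ?E))"
        proof (rule integral_step_error)
          fix s assume s: "s \<in> {?p..?p + h}"
          have "norm (C *v x s - C *v ?\<epsilon> j) \<le> c * norm (x s - ?\<epsilon> j)"
            using c(1)[of "x s - ?\<epsilon> j"] by (simp add: matrix_vector_mult_diff_distrib)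
          also have "x s - ?\<epsilon> j = (x s - x ?p) + (x ?p - ?\<epsilon> j)" by simp
          also have "c * norm \<dots> \<le> c * (e + ?E)"
            using mod[of j s] s Suc.prems p err[of j] c by (intro mult_left_mono norm_triangle_le add_mono) auto
          finally show "norm (C *v x s - C *v ?\<epsilon> j) \<le> c * (e + ?E)" .
        qed (use h in \<open>auto intro: continuous_on_matrix_mult[OF xc[OF sub]]\<close>)
      qed (use Suc in auto)
      finally show ?case unfolding p(2) by (simp add: algebra_simps)
    qed simp
    have "euler_obs A B C D h k (increments w h) (increments v h) =
        h *\<^sub>R (\<Sum>i<k. C *v ?\<epsilon> i) + D *v v (real k * h)"
      unfolding euler_obs_def using sum_increments[of v h k] 0
      by (simp add: linear_sum[OF matrix_vector_mul_linear, of D, symmetric])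
    then have "norm (y (real k * h) - euler_obs A B C D h k (increments w h) (increments v h)) \<le> real k * h * (c * (e + ?E))"
      using int[of k] yeq[of "real k * h"] h by simp
    also have "\<dots> \<le> t * (c * (e + ?E))"
      using jk[of k] c e a t by (intro mult_right_mono) auto
    also have "\<dots> = K * e" by (simp add: K_def algebra_simps)
    finally have 1: "norm (y (real k * h) - euler_obs A B C D h k (increments w h) (increments v h)) < r / 2"
      using e by simp
    have 2: "norm (y (real k * h) - y t) < r / 2"
      using d2(2)[of "real k * h"] k h by (auto simp: dist_norm)
    show ?thesis
      using norm_triangle_ineq4[of "y (real k * h) - y t" "y (real k * h) - euler_obs A B C D h k (increments w h) (increments v h)"] 1 2
      unfolding h_def[symmetric] k_def[symmetric] by (simp add: algebra_simps)
  qed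
  then show "\<exists>no. \<forall>m\<ge>no. norm (euler_approx A B C D m t (increments w (mesh m)) (increments v (mesh m)) - y t) < r" by blast
qed

text \<open>Linear functions of the first \<open>K\<close> increments, given by their adjoints:
  \<open>u \<bullet> f w v\<close> is the exponent of a characteristic function, and linearity of
  the coefficients in \<open>u\<close> makes the resulting variance a quadratic form.\<close>

definition increment_functional ::
    "nat \<Rightarrow> ((nat \<Rightarrow> real^'p) \<Rightarrow> (nat \<Rightarrow> real^'r) \<Rightarrow> real^'e) \<Rightarrow> bool" where
  "increment_functional K f \<longleftrightarrow> (\<exists>a c. (\<forall>i. linear (a i) \<and> linear (c i)) \<and>
     (\<forall>u w v. u \<bullet> f w v = (\<Sum>i<K. a i u \<bullet> w i + c i u \<bullet> v i)))"

lemma increment_functionalI: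
  "(\<And>i. linear (a i)) \<Longrightarrow> (\<And>i. linear (c i)) \<Longrightarrow> (\<And>u w v. u \<bullet> f w v = (\<Sum>i<K. a i u \<bullet> w i + c i u \<bullet> v i)) \<Longrightarrow>
    increment_functional K f"
  unfolding increment_functional_def by blast

lemma increment_functional_0: "increment_functional K (\<lambda>w v. 0)"
  by (rule increment_functionalI[of "\<lambda>_ _. 0" "\<lambda>_ _. 0"]) (auto simp: linear_zero)

lemma linear_if: "linear (\<lambda>u. if P then u else 0)"
  by (cases P) (auto intro!: linearI)

lemma increment_functional_w:
  assumes "i < K" shows "increment_functional K (\<lambda>w v. w i)"
  by (rule increment_functionalI[of "\<lambda>j u. if j = i then u else 0" "\<lambda>_ _. 0"])
    (use assms in \<open>auto simp: linear_zero linear_if if_distrib[of "\<lambda>x. x \<bullet> _"] sum.delta cong: if_cong\<close>)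

lemma increment_functional_v:
  assumes "i < K" shows "increment_functional K (\<lambda>w v. v i)"
  by (rule increment_functionalI[of "\<lambda>_ _. 0" "\<lambda>j u. if j = i then u else 0"])
    (use assms in \<open>auto simp: linear_zero linear_if if_distrib[of "\<lambda>x. x \<bullet> _"] sum.delta cong: if_cong\<close>)

lemma increment_functional_add:
  assumes "increment_functional K f" "increment_functional K g"
  shows "increment_functional K (\<lambda>w v. f w v + g w v)"
proof -
  obtain a c where f: "\<And>i. linear (a i)" "\<And>i. linear (c i)" "\<And>u w v. u \<bullet> f w v = (\<Sum>i<K. a i u \<bullet> w i + c i u \<bullet> v i)"
    using assms(1) unfolding increment_functional_def by blast
  obtain a' c' where g: "\<And>i. linear (a' i)" "\<And>i. linear (c' i)" "\<And>u w v. u \<bullet> g w v = (\<Sum>i<K. a' i u \<bullet> w i + c' i u \<bullet> v i)"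
    using assms(2) unfolding increment_functional_def by blast
  show ?thesis
    by (rule increment_functionalI[of "\<lambda>i u. a i u + a' i u" "\<lambda>i u. c i u + c' i u"])
      (auto simp: f g linear_compose_add inner_add_left inner_add_right sum.distrib)
qed

lemma increment_functional_matrix:
  fixes E :: "real^'e^'f"
  assumes "increment_functional K f"
  shows "increment_functional K (\<lambda>w v. E *v f w v)"
proof -
  obtain a c where f: "\<And>i. linear (a i)" "\<And>i. linear (c i)" "\<And>u w v. u \<bullet> f w v = (\<Sum>i<K. a i u \<bullet> w i + c i u \<bullet> v i)"
    using assms(1) unfolding increment_functional_def by blast
  have l: "linear (\<lambda>u. u v* E)" unfolding transpose_matrix_vector[symmetric] by (rule matrix_vector_mul_linear)
  show ?thesis
    by (rule increment_functionalI[of "\<lambda>i u. a i (u v* E)" "\<lambda>i u. c i (u v* E)"])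
      (auto simp: f dot_lmul_matrix[symmetric] intro!: linear_compose[OF l, unfolded o_def])
qed

lemma increment_functional_scaleR:
  fixes f :: "(nat \<Rightarrow> real^'p) \<Rightarrow> (nat \<Rightarrow> real^'r) \<Rightarrow> real^'e"
  assumes "increment_functional K f" shows "increment_functional K (\<lambda>w v. r *\<^sub>R f w v)"
proof -
  have "(r *\<^sub>R mat 1) *v x = r *\<^sub>R x" for x :: "real^'e"
    by (simp add: scaleR_matrix_vector_assoc[symmetric])
  then show ?thesis using increment_functional_matrix[OF assms, of "r *\<^sub>R mat 1"] by (simp only:)
qed

lemma increment_functional_sum:
  "finite I \<Longrightarrow> (\<And>i. i \<in> I \<Longrightarrow> increment_functional K (f i)) \<Longrightarrow> increment_functional K (\<lambda>w v. \<Sum>i\<in>I. f i w v)"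
  by (induction I rule: finite_induct) (auto intro: increment_functional_0 increment_functional_add)

lemma increment_functional_euler:
  "j \<le> K \<Longrightarrow> increment_functional K (\<lambda>w (v :: nat \<Rightarrow> real^'r). euler A h (\<lambda>i. B *v w i) j)"
proof (induction j)
  case 0 then show ?case by (simp add: increment_functional_0)
next
  case (Suc j)
  then have IH: "increment_functional K (\<lambda>w (v :: nat \<Rightarrow> real^'r). euler A h (\<lambda>i. B *v w i) j)"
    by (intro Suc.IH) (use Suc.prems in simp)
  show ?case unfolding euler.simps
    by (intro increment_functional_add increment_functional_scaleR increment_functional_matrix IH increment_functional_w)
      (use Suc.prems in auto)
qed

lemma increment_functional_euler_obs:
  "k \<le> K \<Longrightarrow> increment_functional K (euler_obs A B C D h k)"
  unfolding euler_obs_def[abs_def]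
  by (intro increment_functional_add increment_functional_scaleR increment_functional_matrix
      increment_functional_sum increment_functional_euler increment_functional_v) auto

section \<open>Increments of Wiener processes\<close>

lemma linear_inner_eq:
  fixes f :: "real^'n \<Rightarrow> real^'m"
  assumes "linear f"
  shows "f u \<bullet> f u = (\<Sum>i\<in>UNIV. \<Sum>j\<in>UNIV. (f (axis i 1) \<bullet> f (axis j 1)) * (u $ i * u $ j))"
proof -
  have "(\<Sum>i\<in>UNIV. u $ i *\<^sub>R axis i 1) = u"
    using basis_expansion[of u] by (simp add: scalar_mult_eq_scaleR)
  then have "f u = (\<Sum>i\<in>UNIV. u $ i *\<^sub>R f (axis i 1))"
    using linear_sum[OF assms, of "\<lambda>i. u $ i *\<^sub>R axis i 1" UNIV]
    by (simp add: linear_scale[OF assms])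
  then show ?thesis
    by (simp add: inner_sum_left inner_sum_right sum_distrib_left mult_ac inner_commute)
qed

abbreviation inc_space :: "nat \<Rightarrow> (nat \<Rightarrow> 'a::topological_space) measure" where
  "inc_space K \<equiv> PiM {..<K} (\<lambda>_. borel)"

definition noise :: "real \<Rightarrow> nat \<Rightarrow> ((nat \<Rightarrow> real^'p) \<times> (nat \<Rightarrow> real^'r)) measure" where
  "noise h K = (PiM {..<K} (\<lambda>_. gauss (\<lambda>_. sqrt h))) \<Otimes>\<^sub>M (PiM {..<K} (\<lambda>_. gauss (\<lambda>_. sqrt h)))"

lemma prob_space_PiM_gauss: "0 < s \<Longrightarrow> prob_space (PiM I (\<lambda>_. gauss (\<lambda>_. s)))"
  by (intro prob_space_PiM prob_space_gauss)

lemma sets_PiM_gauss: "sets (PiM I (\<lambda>_. gauss \<sigma>)) = sets (PiM I (\<lambda>_. borel))"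
  by (intro sets_PiM_cong) auto

lemma integral_PiM_gauss_char:
  fixes a :: "nat \<Rightarrow> real^'n"
  assumes h: "0 < h"
  shows "(\<integral>w. iexp (\<Sum>i<K. a i \<bullet> w i) \<partial>PiM {..<K} (\<lambda>_. gauss (\<lambda>_. sqrt h))) =
    of_real (exp (- (h * (\<Sum>i<K. a i \<bullet> a i)) / 2))"
proof -
  interpret product_prob_space "\<lambda>_. gauss (\<lambda>_::'n. sqrt h)" "{..<K}"
    by (intro product_prob_spaceI prob_space_gauss) (use h in auto)
  have int: "integrable (gauss (\<lambda>_::'n. sqrt h)) (\<lambda>x. iexp (a i \<bullet> x))" for i
    by (rule integrable_bounded_prob[where B=1]) (use h in \<open>auto intro!: prob_space_gauss\<close>)
  have "(\<integral>w. iexp (\<Sum>i<K. a i \<bullet> w i) \<partial>PiM {..<K} (\<lambda>_. gauss (\<lambda>_. sqrt h))) =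
     (\<integral>w. (\<Prod>i<K. iexp (a i \<bullet> w i)) \<partial>PiM {..<K} (\<lambda>_. gauss (\<lambda>_. sqrt h)))"
    by (simp only: exp_i_sum[OF finite_lessThan])
  also have "\<dots> = (\<Prod>i<K. (\<integral>x. iexp (a i \<bullet> x) \<partial>gauss (\<lambda>_. sqrt h)))"
    by (rule product_integral_prod) (auto intro: int)
  also have "\<dots> = (\<Prod>i<K. of_real (exp (- (h * (a i \<bullet> a i)) / 2)))"
    using h by (subst integral_gauss_char)
      (auto simp: power_mult_distrib inner_vec_def sum_distrib_left power2_eq_square[of "_ $ _"] simp del: of_real_exp)
  also have "\<dots> = of_real (exp (- (h * (\<Sum>i<K. a i \<bullet> a i)) / 2))"
    by (simp only: of_real_prod[symmetric] exp_sum[OF finite_lessThan, symmetric])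
      (simp add: sum_negf sum_divide_distrib[symmetric] sum_distrib_left)
  finally show ?thesis .
qed

text \<open>\<open>Q\<close> is \<open>h\<close> times the sum of the Gram matrices of the adjoint
  coefficients. Its symmetry is recorded for the later recovery of coefficients by
  polarization.\<close>

lemma noise_char:
  fixes f :: "(nat \<Rightarrow> real^'p) \<Rightarrow> (nat \<Rightarrow> real^'r) \<Rightarrow> real^'e"
  assumes f: "increment_functional K f" and h: "0 < h"
  obtains Q where "\<And>i j. Q i j = Q j i"
    "\<And>u. (\<integral>p. iexp (u \<bullet> f (fst p) (snd p)) \<partial>noise h K) = of_real (exp (- quad_form Q u / 2))"
proof -
  obtain a c where l: "\<And>i. linear (a i)" "\<And>i. linear (c i)"
    and f: "\<And>u w v. u \<bullet> f w v = (\<Sum>i<K. a i u \<bullet> w i + c i u \<bullet> v i)"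
    using f unfolding increment_functional_def by blast
  let ?W = "PiM {..<K} (\<lambda>_. gauss (\<lambda>_::'p. sqrt h))" and ?V = "PiM {..<K} (\<lambda>_. gauss (\<lambda>_::'r. sqrt h))"
  interpret W: prob_space ?W by (rule prob_space_PiM_gauss) (use h in simp)
  interpret V: prob_space ?V by (rule prob_space_PiM_gauss) (use h in simp)
  interpret pair_prob_space ?W ?V ..
  define Q where "Q i j = h * (\<Sum>k<K. a k (axis i 1) \<bullet> a k (axis j 1)) + h * (\<Sum>k<K. c k (axis i 1) \<bullet> c k (axis j 1))" for i j
  have sq: "(\<Sum>i\<in>UNIV. \<Sum>j\<in>UNIV. (\<Sum>k<K. b k (axis i 1) \<bullet> b k (axis j 1)) * (u $ i * u $ j)) = (\<Sum>k<K. b k u \<bullet> b k u)"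
    if "\<And>k. linear (b k)" for b :: "nat \<Rightarrow> real^'e \<Rightarrow> real^'n::finite" and u
    unfolding linear_inner_eq[OF that] sum_distrib_right
    by (simp only: sum.swap[where A="UNIV :: 'e set" and B="{..<K}"])
  show ?thesis
  proof
    show "Q i j = Q j i" for i j by (simp add: Q_def inner_commute)
    fix u
    let ?g = "\<lambda>w. iexp (\<Sum>i<K. a i u \<bullet> w i)" and ?k = "\<lambda>v. iexp (\<Sum>i<K. c i u \<bullet> v i)"
    have "(\<integral>p. iexp (u \<bullet> f (fst p) (snd p)) \<partial>noise h K) = (\<integral>p. ?g (fst p) * ?k (snd p) \<partial>(?W \<Otimes>\<^sub>M ?V))"
      unfolding noise_def f by (simp add: sum.distrib distrib_left exp_add)
    also have "\<dots> = (\<integral>w. (\<integral>v. ?g w * ?k v \<partial>?V) \<partial>?W)"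
    proof (subst integral_fst'[symmetric])
      show "integrable (?W \<Otimes>\<^sub>M ?V) (\<lambda>p. ?g (fst p) * ?k (snd p))"
        by (rule integrable_bounded_prob[where B=1]) (auto simp: norm_mult norm_exp_i_times intro: prob_space_axioms)
    qed simp
    also have "\<dots> = (\<integral>w. ?g w \<partial>?W) * (\<integral>v. ?k v \<partial>?V)"
      by (simp only: integral_mult_right_zero integral_mult_left_zero)
    also have "\<dots> = of_real (exp (- (h * (\<Sum>i<K. a i u \<bullet> a i u)) / 2) * exp (- (h * (\<Sum>i<K. c i u \<bullet> c i u)) / 2))"
      by (simp only: integral_PiM_gauss_char[OF h] of_real_mult)
    also have "exp (- (h * (\<Sum>i<K. a i u \<bullet> a i u)) / 2) * exp (- (h * (\<Sum>i<K. c i u \<bullet> c i u)) / 2) = exp (- quad_form Q u / 2)"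
    proof -
      have "quad_form Q u = h * (\<Sum>i<K. a i u \<bullet> a i u) + h * (\<Sum>i<K. c i u \<bullet> c i u)"
      proof -
        have lin: "(\<Sum>i\<in>UNIV. \<Sum>j\<in>UNIV. (h * S i j + h * T i j) * g i j) =
            h * (\<Sum>i\<in>UNIV. \<Sum>j\<in>UNIV. S i j * g i j) + h * (\<Sum>i\<in>UNIV. \<Sum>j\<in>UNIV. T i j * g i j)"
          for S T g :: "'e \<Rightarrow> 'e \<Rightarrow> real"
          by (simp add: distrib_right sum.distrib sum_distrib_left mult.assoc)
        show ?thesis
          unfolding sq[OF l(1), symmetric] sq[OF l(2), symmetric] quad_form_def Q_def by (rule lin)
      qed
      then show ?thesis by (simp add: exp_add[symmetric] field_simps)
    qed
    finally show "(\<integral>p. iexp (u \<bullet> f (fst p) (snd p)) \<partial>noise h K) = of_real (exp (- quad_form Q u / 2))" .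
  qed
qed

text \<open>Points of \<open>inc_space K\<close> are undefined outside \<open>{..<K}\<close>; this
  identifies the function on increment sequences with one on that space.\<close>

lemma increment_functional_restrict:
  assumes "increment_functional K f" shows "f (restrict w {..<K}) (restrict v {..<K}) = f w v"
proof -
  have "u \<bullet> f (restrict w {..<K}) (restrict v {..<K}) = u \<bullet> f w v" for u
    using assms unfolding increment_functional_def by auto
  then show ?thesis using vector_eq_ldot by blast
qed

lemma increment_functional_measurable:
  fixes f :: "(nat \<Rightarrow> real^'p) \<Rightarrow> (nat \<Rightarrow> real^'r) \<Rightarrow> real^'e"
  assumes "increment_functional K f"
  shows "(\<lambda>p. f (fst p) (snd p)) \<in> borel_measurable (inc_space K \<Otimes>\<^sub>M inc_space K)"
proof -
  obtain a c where f: "\<And>u w v. u \<bullet> f w v = (\<Sum>i<K. a i u \<bullet> w i + c i u \<bullet> v i)"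
    using assms unfolding increment_functional_def by blast
  have "(\<lambda>p. f (fst p) (snd p) \<bullet> b) \<in> borel_measurable (inc_space K \<Otimes>\<^sub>M inc_space K)" for b
    unfolding inner_commute[of _ b] f by measurable
  then show ?thesis by (subst borel_measurable_euclidean_space) auto
qed

lemma sets_noise: "sets (noise h K) = sets (inc_space K \<Otimes>\<^sub>M inc_space K)"
  unfolding noise_def by (intro sets_pair_measure_cong sets_PiM_gauss)

section \<open>Path space and the joint law of the increments\<close>

lemma space_path_space: "space path_space = (\<Pi>\<^sub>E t\<in>{0..}. UNIV)"
  by (simp add: path_space_def space_PiM)

lemma measurable_path:
  assumes "\<And>t. 0 \<le> t \<Longrightarrow> Z t \<in> borel_measurable M"
  shows "path Z \<in> measurable M path_space"
  unfolding path_def[abs_def] path_space_def by (intro measurable_restrict) (use assms in auto)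

lemma path_space_component: "0 \<le> t \<Longrightarrow> (\<lambda>z. z t) \<in> borel_measurable path_space"
  unfolding path_space_def by (rule measurable_component_singleton) simp

definition path_increments :: "real \<Rightarrow> nat \<Rightarrow> (real \<Rightarrow> 'a::real_vector) \<Rightarrow> nat \<Rightarrow> 'a" where
  "path_increments h K z = (\<lambda>i\<in>{..<K}. increments z h i)"

lemma measurable_path_increments:
  assumes "0 \<le> h"
  shows "path_increments h K \<in> measurable path_space (PiM {..<K} (\<lambda>_. borel :: (real^'n) measure))"
  unfolding path_increments_def[abs_def] increments_def
  by (intro measurable_restrict borel_measurable_diff path_space_component) (use assms in auto)

lemma path_increments_path: "0 \<le> h \<Longrightarrow> path_increments h K (path Z \<omega>) = path_increments h K (\<lambda>t. Z t \<omega>)"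
  unfolding path_increments_def increments_def path_def by (auto simp: fun_eq_iff)

text \<open>It suffices to compare rectangles, where the product formula is independence of
  preimages; the assumptions \<open>A\<close> and \<open>B\<close> place these in the two set
  systems.\<close>

lemma (in prob_space) distr_pair_indep_set:
  assumes ind: "indep_set \<A> \<B>"
    and G[measurable]: "G1 \<in> measurable M N1" "G2 \<in> measurable M N2"
    and A: "\<And>A. A \<in> sets N1 \<Longrightarrow> G1 -` A \<inter> space M \<in> \<A>" and B: "\<And>B. B \<in> sets N2 \<Longrightarrow> G2 -` B \<inter> space M \<in> \<B>"
  shows "distr M (N1 \<Otimes>\<^sub>M N2) (\<lambda>\<omega>. (G1 \<omega>, G2 \<omega>)) = distr M N1 G1 \<Otimes>\<^sub>M distr M N2 G2"
proof (rule pair_measure_eqI[symmetric])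
  interpret N1: prob_space "distr M N1 G1" by (rule prob_space_distr) fact
  interpret N2: prob_space "distr M N2 G2" by (rule prob_space_distr) fact
  show "sigma_finite_measure (distr M N1 G1)" "sigma_finite_measure (distr M N2 G2)" by unfold_locales
  fix S T assume "S \<in> sets (distr M N1 G1)" "T \<in> sets (distr M N2 G2)"
  then have ST [measurable]: "S \<in> sets N1" "T \<in> sets N2" by auto
  have "(\<lambda>\<omega>. (G1 \<omega>, G2 \<omega>)) -` (S \<times> T) \<inter> space M = (G1 -` S \<inter> space M) \<inter> (G2 -` T \<inter> space M)" by auto
  then have "emeasure (distr M (N1 \<Otimes>\<^sub>M N2) (\<lambda>\<omega>. (G1 \<omega>, G2 \<omega>))) (S \<times> T) = prob ((G1 -` S \<inter> space M) \<inter> (G2 -` T \<inter> space M))"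
    by (subst emeasure_distr) (auto simp: emeasure_eq_measure)
  also have "prob ((G1 -` S \<inter> space M) \<inter> (G2 -` T \<inter> space M)) = prob (G1 -` S \<inter> space M) * prob (G2 -` T \<inter> space M)"
    using ind A[OF ST(1)] B[OF ST(2)] unfolding indep_sets2_eq by blast
  also have "ennreal \<dots> = emeasure (distr M N1 G1) S * emeasure (distr M N2 G2) T"
    using ST by (simp add: emeasure_distr emeasure_eq_measure ennreal_mult)
  finally show "emeasure (distr M N1 G1) S * emeasure (distr M N2 G2) T = emeasure (distr M (N1 \<Otimes>\<^sub>M N2) (\<lambda>\<omega>. (G1 \<omega>, G2 \<omega>))) (S \<times> T)"
    by simp
qed (simp cong: sets_pair_measure_cong)

lemma process_eventsI:
  assumes F: "F \<in> measurable path_space N" and Z: "\<And>t. 0 \<le> t \<Longrightarrow> Z t \<in> borel_measurable M" and A: "A \<in> sets N"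
  shows "(\<lambda>\<omega>. F (path Z \<omega>)) -` A \<inter> space M \<in> process_events M Z"
proof -
  have "F -` A \<inter> space path_space \<in> sets path_space" using F A by (rule measurable_sets)
  moreover have "(\<lambda>\<omega>. F (path Z \<omega>)) -` A \<inter> space M = path Z -` (F -` A \<inter> space path_space) \<inter> space M"
    using measurable_space[OF measurable_path[of Z M]] Z by auto
  ultimately show ?thesis unfolding process_events_def by blast
qed

lemma wiener_measurable: "wiener_process M W \<Longrightarrow> 0 \<le> t \<Longrightarrow> W t \<in> borel_measurable M"
  by (auto simp: wiener_process_def)

lemma wiener_increments_law:
  fixes W :: "real \<Rightarrow> 'w \<Rightarrow> real^'n"
  assumes W: "wiener_process M W" and h: "0 < h" and K: "0 < K"
  shows "distr M (inc_space K) (\<lambda>\<omega>. path_increments h K (\<lambda>t. W t \<omega>)) = PiM {..<K} (\<lambda>_. gauss (\<lambda>_. sqrt h))"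
proof -
  interpret prob_space M using W by (simp add: wiener_process_def)
  let ?D = "\<lambda>i \<omega>. W (real (Suc i) * h) \<omega> - W (real i * h) \<omega>"
  have law: "distr M borel (?D i) = gauss (\<lambda>_. sqrt h)" for i
  proof -
    have "0 \<le> real i * h \<and> real i * h < real (Suc i) * h" using h by auto
    then have "distributed M lborel (?D i) (\<lambda>x. ennreal (\<Prod>j\<in>UNIV. normal_density 0 (sqrt (real (Suc i) * h - real i * h)) (x $ j)))"
      using W unfolding wiener_process_def by blast
    moreover have "real (Suc i) * h - real i * h = h" by (simp add: algebra_simps)
    ultimately have "distr M lborel (?D i) = gauss (\<lambda>_. sqrt h)"
      unfolding distributed_def gauss_def by (simp only:)
    then show ?thesis by (simp add: distr_cong[OF refl sets_lborel refl])
  qed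
  have "\<forall>(t::nat \<Rightarrow> real) m. 0 \<le> t 0 \<and> strict_mono t \<longrightarrow>
      indep_vars (\<lambda>_. borel) (\<lambda>i \<omega>. W (t (Suc i)) \<omega> - W (t i) \<omega>) {..<m}"
    using W unfolding wiener_process_def by (elim conjE)
  from this[THEN spec, THEN spec, THEN mp, of "\<lambda>i. real i * h" K]
  have "indep_vars (\<lambda>_. borel) ?D {..<K}" using h by (auto simp: strict_mono_def)
  moreover have rv: "random_variable borel (?D i)" for i
    using h by (intro borel_measurable_diff wiener_measurable[OF W]) auto
  \<comment> \<open>Independence is expressed as a product law for a nonempty index set, hence
    \<open>0 < K\<close>.\<close>
  ultimately have "distr M (inc_space K) (\<lambda>\<omega>. \<lambda>i\<in>{..<K}. ?D i \<omega>) = PiM {..<K} (\<lambda>i. distr M borel (?D i))"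
    using K by (subst (asm) indep_vars_iff_distr_eq_PiM) auto
  then show ?thesis unfolding law path_increments_def increments_def .
qed

lemma noise_law:
  fixes W :: "real \<Rightarrow> 'w \<Rightarrow> real^'p" and V :: "real \<Rightarrow> 'w \<Rightarrow> real^'r"
  assumes W: "wiener_process M W" and V: "wiener_process M V"
    and ind: "prob_space.indep_set M (process_events M W) (process_events M V)" and h: "0 < h" and K: "0 < K"
  shows "distr M (inc_space K \<Otimes>\<^sub>M inc_space K)
     (\<lambda>\<omega>. (path_increments h K (\<lambda>t. W t \<omega>), path_increments h K (\<lambda>t. V t \<omega>))) = noise h K"
proof -
  interpret prob_space M using W by (simp add: wiener_process_def)
  have h0: "0 \<le> h" using h by simp
  have m: "(\<lambda>\<omega>. path_increments h K (path Z \<omega>)) \<in> measurable M (inc_space K)"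
    if "wiener_process M Z" for Z :: "real \<Rightarrow> 'w \<Rightarrow> real^'n::finite"
    by (rule measurable_compose[OF measurable_path measurable_path_increments[OF h0]]) (rule wiener_measurable[OF that])
  show ?thesis
    unfolding noise_def wiener_increments_law[OF W h K, symmetric] wiener_increments_law[OF V h K, symmetric]
    unfolding path_increments_path[OF h0, symmetric]
    by (intro distr_pair_indep_set[OF ind] m W V process_eventsI[where N="inc_space K"]
        measurable_path_increments h0 wiener_measurable[OF W] wiener_measurable[OF V])
qed

section \<open>The observation process as a limit of the Euler scheme\<close>

text \<open>Summing over \<open>F\<close> gives one number of increments that suffices for all times
  in \<open>F\<close>; \<open>Suc\<close> keeps it positive.\<close>

lemma increment_functional_euler_approx:
  assumes F: "finite F" and t: "t \<in> F"
  shows "increment_functional (Suc (\<Sum>t\<in>F. nat \<lfloor>t * real (Suc m)\<rfloor>)) (euler_approx A B C D m t)"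
  using member_le_sum[OF t, of "\<lambda>t. nat \<lfloor>t * real (Suc m)\<rfloor>"] F
  by (intro increment_functional_euler_obs) auto

lemma increment_functional_statistic:
  assumes F: "finite F"
  shows "increment_functional (Suc (\<Sum>t\<in>F. nat \<lfloor>t * real (Suc m)\<rfloor>)) (\<lambda>w v. \<Sum>t\<in>F. P t *v euler_approx A B C D m t w v)"
  by (intro increment_functional_sum F increment_functional_matrix increment_functional_euler_approx)

text \<open>The characteristic function of the noise part of the reconstruction, with the Euler
  approximation in place of the observations. It is determined by the matrices, the times and the
  mesh, whatever the realization and the initial law.\<close>

definition statistic_char :: "real^'d^'d \<Rightarrow> real^'p^'d \<Rightarrow> real^'d^'q \<Rightarrow> real^'r^'q \<Rightarrow>
    real set \<Rightarrow> (real \<Rightarrow> real^'q^'e) \<Rightarrow> nat \<Rightarrow> real^'e \<Rightarrow> complex" where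
  "statistic_char A B C D F P m u =
    (\<integral>p. iexp (u \<bullet> (\<Sum>t\<in>F. P t *v euler_approx A B C D m t (fst p) (snd p)))
      \<partial>noise (mesh m) (Suc (\<Sum>t\<in>F. nat \<lfloor>t * real (Suc m)\<rfloor>)))"

lemma statistic_char_gaussian:
  assumes "finite F"
  obtains Q where "\<And>i j. Q i j = Q j i" "\<And>u. statistic_char A B C D F P m u = of_real (exp (- quad_form Q u / 2))"
proof -
  have h: "0 < mesh m" by simp
  show ?thesis
    by (rule noise_char[OF increment_functional_statistic[OF assms, of m P A B C D] h])
      (rule that, assumption, unfold statistic_char_def, assumption)
qed

lemma continuous_on_half_line:
  fixes f :: "real \<Rightarrow> 'a::metric_space"
  assumes "\<And>T. 0 \<le> T \<Longrightarrow> continuous_on {0..T} f" shows "continuous_on {0..} f"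
  unfolding continuous_on_iff
proof (intro ballI allI impI)
  fix t e :: real assume t: "t \<in> {0..}" and e: "0 < e"
  have "continuous_on {0..t + 1} f" using t by (intro assms) auto
  then obtain d where d: "0 < d" "\<And>s. s \<in> {0..t + 1} \<Longrightarrow> dist s t < d \<Longrightarrow> dist (f s) (f t) < e"
    using t e unfolding continuous_on_iff by (metis atLeastAtMost_iff atLeast_iff less_add_one less_imp_le)
  show "\<exists>d>0. \<forall>s\<in>{0..}. dist s t < d \<longrightarrow> dist (f s) (f t) < e"
    by (intro exI[of _ "min d 1"]) (use d in \<open>auto simp: dist_real_def\<close>)
qed

text \<open>Subtracting the noiseless solution removes the initial condition and leaves equations of
  the same form started at 0.\<close>

lemma euler_approx_tendsto:
  fixes x :: "real \<Rightarrow> real^'d" and w :: "real \<Rightarrow> real^'p" and y :: "real \<Rightarrow> real^'q" and v :: "real \<Rightarrow> real^'r"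
  assumes w: "continuous_on {0..} w" "w 0 = 0" and v: "continuous_on {0..} v" "v 0 = 0"
    and x: "\<And>t. 0 \<le> t \<Longrightarrow> (\<lambda>s. A *v x s) integrable_on {0..t} \<and> x t = x0 + integral {0..t} (\<lambda>s. A *v x s) + B *v w t"
    and y: "\<And>t. 0 \<le> t \<Longrightarrow> y t = integral {0..t} (\<lambda>s. C *v x s) + D *v v t"
    and t: "0 \<le> t"
  shows "(\<lambda>m. euler_approx A B C D m t (increments w (mesh m)) (increments v (mesh m)))
    \<longlonglongrightarrow> y t - obs_flow A C t x0"
proof -
  \<comment> \<open>Continuity comes from the equation itself: an indefinite integral plus a
    continuous noise path.\<close>
  have xc: "continuous_on {0..} x"
  proof (rule continuous_on_half_line)
    fix T :: real assume "0 \<le> T"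
    then have "continuous_on {0..T} (\<lambda>t. x0 + integral {0..t} (\<lambda>s. A *v x s) + B *v w t)"
      using x by (intro continuous_intros indefinite_integral_continuous_1 continuous_on_subset[OF w(1)]) auto
    then show "continuous_on {0..T} x" by (rule continuous_on_eq) (use x in auto)
  qed
  have int: "(\<lambda>s. E *v x s) integrable_on {0..t}" for E :: "real^'d^'n" and t
    by (intro integrable_continuous_real continuous_intros continuous_on_subset[OF xc]) auto
  have intf: "(\<lambda>s. E *v flow A s x0) integrable_on {0..t}" for E :: "real^'d^'n" and t
    by (intro integrable_continuous_real continuous_intros continuous_on_flow)
  show ?thesis
  proof (rule euler_obs_tendsto[where x="\<lambda>t. x t - flow A t x0" and y="\<lambda>t. y t - obs_flow A C t x0"])
    show "continuous_on {0..} (\<lambda>t. x t - flow A t x0)" by (intro continuous_intros xc continuous_on_flow)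
    fix t :: real assume t: "0 \<le> t"
    show "x t - flow A t x0 = integral {0..t} (\<lambda>s. A *v (x s - flow A s x0)) + B *v w t"
      using x[OF t] flow_integral[OF t, of A x0]
      by (simp add: matrix_vector_mult_diff_distrib Henstock_Kurzweil_Integration.integral_diff[OF int intf])
    show "y t - obs_flow A C t x0 = integral {0..t} (\<lambda>s. C *v (x s - flow A s x0)) + D *v v t"
      using y[OF t]
      by (simp add: obs_flow_def matrix_vector_mult_diff_distrib Henstock_Kurzweil_Integration.integral_diff[OF int intf])
  qed (use w v t in auto)
qed

section \<open>Realizations of the model and their Euler limits\<close>

locale filtering_model =
  fixes A :: "real^'d^'d" and B :: "real^'p^'d" and C :: "real^'d^'q" and D :: "real^'r^'q"
    and M :: "'w measure" and W :: "real \<Rightarrow> 'w \<Rightarrow> real^'p" and V :: "real \<Rightarrow> 'w \<Rightarrow> real^'r"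
    and X :: "real \<Rightarrow> 'w \<Rightarrow> real^'d" and Y :: "real \<Rightarrow> 'w \<Rightarrow> real^'q"
  assumes model: "linear_filtering_model A B C D M W V X Y"
begin

lemma wiener: "wiener_process M W" "wiener_process M V"
  using model by (auto simp: linear_filtering_model_def)

sublocale prob_space M using wiener by (simp add: wiener_process_def)

lemma measurable_X: "0 \<le> t \<Longrightarrow> X t \<in> borel_measurable M"
  and measurable_Y: "0 \<le> t \<Longrightarrow> Y t \<in> borel_measurable M"
  using model by (auto simp: linear_filtering_model_def)

abbreviation w_inc :: "nat \<Rightarrow> 'w \<Rightarrow> nat \<Rightarrow> real^'p" where
  "w_inc m \<omega> \<equiv> increments (\<lambda>t. W t \<omega>) (mesh m)"

abbreviation v_inc :: "nat \<Rightarrow> 'w \<Rightarrow> nat \<Rightarrow> real^'r" where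
  "v_inc m \<omega> \<equiv> increments (\<lambda>t. V t \<omega>) (mesh m)"

lemma AE_euler_approx:
  "AE \<omega> in M. \<forall>t\<ge>0. (\<lambda>m. euler_approx A B C D m t (w_inc m \<omega>) (v_inc m \<omega>)) \<longlonglongrightarrow> Y t \<omega> - obs_flow A C t (X 0 \<omega>)"
proof -
  note w = wiener[unfolded wiener_process_def, THEN conjunct2, THEN conjunct2]
    and m = model[unfolded linear_filtering_model_def, THEN conjunct2, THEN conjunct2, THEN conjunct2, THEN conjunct2,
      THEN conjunct2, THEN conjunct2]
  from w[THEN conjunct1] w[THEN conjunct2, THEN conjunct1] m[THEN conjunct1] m[THEN conjunct2]
  show ?thesis
  proof eventually_elim
    case (elim \<omega>)
    show ?case
    proof (intro allI impI)
      fix t :: real assume "0 \<le> t"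
      then show "(\<lambda>m. euler_approx A B C D m t (w_inc m \<omega>) (v_inc m \<omega>)) \<longlonglongrightarrow> Y t \<omega> - obs_flow A C t (X 0 \<omega>)"
        using elim(5,6) by - (rule euler_approx_tendsto[where x="\<lambda>t. X t \<omega>", OF elim(3,1,4,2)], blast+)
    qed
  qed
qed

lemma measurable_w_inc: "(\<lambda>\<omega>. w_inc m \<omega> i) \<in> borel_measurable M"
  and measurable_v_inc: "(\<lambda>\<omega>. v_inc m \<omega> i) \<in> borel_measurable M"
  unfolding increments_def
  by (intro borel_measurable_diff wiener_measurable[OF wiener(1)] wiener_measurable[OF wiener(2)]; simp)+

lemma measurable_increment_functional:
  assumes "increment_functional K f"
  shows "(\<lambda>\<omega>. f (w_inc m \<omega>) (v_inc m \<omega>)) \<in> borel_measurable M"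
proof -
  note [measurable] = measurable_w_inc measurable_v_inc
  obtain a c where f: "\<And>u w v. u \<bullet> f w v = (\<Sum>i<K. a i u \<bullet> w i + c i u \<bullet> v i)"
    using assms unfolding increment_functional_def by blast
  have "(\<lambda>\<omega>. f (w_inc m \<omega>) (v_inc m \<omega>) \<bullet> b) \<in> borel_measurable M" for b
    unfolding inner_commute[of _ b] f by measurable
  then show ?thesis by (subst borel_measurable_euclidean_space) auto
qed

lemma noise_distr:
  assumes "0 < K"
  shows "distr M (inc_space K \<Otimes>\<^sub>M inc_space K)
     (\<lambda>\<omega>. (restrict (w_inc m \<omega>) {..<K}, restrict (v_inc m \<omega>) {..<K})) = noise (mesh m) K"
  using noise_law[OF wiener, of "mesh m" K] model assms
  by (simp add: linear_filtering_model_def path_increments_def[abs_def])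

lemma measurable_inc_pair [measurable]:
  "(\<lambda>\<omega>. (restrict (w_inc m \<omega>) {..<K}, restrict (v_inc m \<omega>) {..<K})) \<in>
    measurable M (inc_space K \<Otimes>\<^sub>M inc_space K)"
  by (intro measurable_Pair measurable_restrict measurable_w_inc measurable_v_inc)

lemma expectation_increments:
  fixes F :: "(nat \<Rightarrow> real^'p) \<times> (nat \<Rightarrow> real^'r) \<Rightarrow> 'b::{banach, second_countable_topology}"
  assumes K: "0 < K" and F: "F \<in> borel_measurable (inc_space K \<Otimes>\<^sub>M inc_space K)"
    and res: "\<And>w v. F (restrict w {..<K}, restrict v {..<K}) = F (w, v)"
  shows "expectation (\<lambda>\<omega>. F (w_inc m \<omega>, v_inc m \<omega>)) = (\<integral>p. F p \<partial>noise (mesh m) K)"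
  unfolding noise_distr[OF K, symmetric] by (subst integral_distr[OF measurable_inc_pair F]) (simp add: res)

text \<open>The integrals on the left do not depend on the realization of the model.\<close>

lemma expectation_prod_observations:
  fixes \<phi> :: "real \<Rightarrow> real^'q \<Rightarrow> real"
  assumes J: "finite J" "J \<subseteq> {0..}" and \<phi>: "\<And>t. continuous_on UNIV (\<phi> t)" "\<And>t y. \<bar>\<phi> t y\<bar> \<le> 1"
    and null: "AE \<omega> in M. \<forall>t. obs_flow A C t (X 0 \<omega>) = 0"
  shows "(\<lambda>m. \<integral>p. (\<Prod>t\<in>J. \<phi> t (euler_approx A B C D m t (fst p) (snd p)))
      \<partial>noise (mesh m) (Suc (\<Sum>t\<in>J. nat \<lfloor>t * real (Suc m)\<rfloor>)))
    \<longlonglongrightarrow> expectation (\<lambda>\<omega>. \<Prod>t\<in>J. \<phi> t (Y t \<omega>))"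
proof -
  have \<phi>m [measurable]: "\<phi> t \<in> borel_measurable borel" for t
    by (rule borel_measurable_continuous_onI) (rule \<phi>)
  define K where "K m = Suc (\<Sum>t\<in>J. nat \<lfloor>t * real (Suc m)\<rfloor>)" for m
  have inc: "increment_functional (K m) (euler_approx A B C D m t)" if "t \<in> J" for m t
    unfolding K_def by (rule increment_functional_euler_approx[OF J(1) that])
  define F where "F m p = (\<Prod>t\<in>J. \<phi> t (euler_approx A B C D m t (fst p) (snd p)))" for m p
  have Fm: "F m \<in> borel_measurable (inc_space (K m) \<Otimes>\<^sub>M inc_space (K m))" for m
    unfolding F_def[abs_def]
    by (intro borel_measurable_prod measurable_compose[OF increment_functional_measurable \<phi>m] inc)
  have "F m (restrict w {..<K m}, restrict v {..<K m}) = F m (w, v)" for m w v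
    unfolding F_def by (intro prod.cong refl) (simp only: fst_conv snd_conv increment_functional_restrict[OF inc])
  then have eq: "expectation (\<lambda>\<omega>. F m (w_inc m \<omega>, v_inc m \<omega>)) = (\<integral>p. F m p \<partial>noise (mesh m) (K m))" for m
    by (intro expectation_increments Fm) (simp add: K_def)
  have le: "\<bar>\<Prod>t\<in>J. \<phi> t (g t)\<bar> \<le> 1" for g
    unfolding abs_prod by (rule prod_le_1) (use \<phi>(2) in auto)
  have "(\<lambda>m. expectation (\<lambda>\<omega>. F m (w_inc m \<omega>, v_inc m \<omega>))) \<longlonglongrightarrow>
      expectation (\<lambda>\<omega>. \<Prod>t\<in>J. \<phi> t (Y t \<omega>))"
  proof (rule integral_dominated_convergence[where w="\<lambda>_. 1"])
    show "(\<lambda>\<omega>. \<Prod>t\<in>J. \<phi> t (Y t \<omega>)) \<in> borel_measurable M"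
      using J by (intro borel_measurable_prod measurable_compose[OF _ \<phi>m] measurable_Y) auto
    show "(\<lambda>\<omega>. F m (w_inc m \<omega>, v_inc m \<omega>)) \<in> borel_measurable M" for m
      unfolding F_def fst_conv snd_conv
      by (intro borel_measurable_prod measurable_compose[OF _ \<phi>m] measurable_increment_functional[OF inc])
    \<comment> \<open>By \<open>null\<close> the initial condition does not contribute, so the
      scheme converges to the observations themselves.\<close>
    show "AE \<omega> in M. (\<lambda>m. F m (w_inc m \<omega>, v_inc m \<omega>)) \<longlonglongrightarrow> (\<Prod>t\<in>J. \<phi> t (Y t \<omega>))"
      using AE_euler_approx null
    proof eventually_elim
      case (elim \<omega>)
      show ?case unfolding F_def fst_conv snd_conv
        by (intro tendsto_prod continuous_on_tendsto_compose[OF \<phi>(1)]) (use elim J in auto)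
    qed
    show "AE \<omega> in M. norm (F m (w_inc m \<omega>, v_inc m \<omega>)) \<le> 1" for m
      unfolding F_def real_norm_def by (intro AE_I2 le)
  qed simp
  then show ?thesis unfolding eq unfolding F_def K_def .
qed

text \<open>\<open>X 0\<close> is independent of the pair of noise processes, so its joint law with
  the increments is a product and the characteristic function factorizes.\<close>

lemma expectation_initial_increments:
  assumes K: "0 < K" and f: "increment_functional K f"
  shows "expectation (\<lambda>\<omega>. iexp (u \<bullet> (X 0 \<omega> + f (w_inc m \<omega>) (v_inc m \<omega>)))) =
    vchar (distr M borel (X 0)) u * (\<integral>p. iexp (u \<bullet> f (fst p) (snd p)) \<partial>noise (mesh m) K)"
proof -
  let ?N = "PiM {..<K} (\<lambda>_. borel :: (real^'p) measure) \<Otimes>\<^sub>M PiM {..<K} (\<lambda>_. borel :: (real^'r) measure)"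
  let ?G = "\<lambda>\<omega>. (restrict (w_inc m \<omega>) {..<K}, restrict (v_inc m \<omega>) {..<K})"
  let ?Z = "\<lambda>t \<omega>. (W t \<omega>, V t \<omega>)"
  define h where "h = mesh m"
  have h: "0 \<le> h" by (simp add: h_def)
  \<comment> \<open>The increments as a measurable function of the path of the pair
    \<open>(W, V)\<close>; this puts their events into the \<open>process_events\<close> of the
    pair.\<close>
  define F where "F z = (path_increments h K (\<lambda>t. fst (z t)), path_increments h K (\<lambda>t. snd (z t)))"
    for z :: "real \<Rightarrow> (real^'p) \<times> (real^'r)"
  have comp: "(\<lambda>z. fst (z t) :: real^'p) \<in> borel_measurable path_space" "(\<lambda>z. snd (z t) :: real^'r) \<in> borel_measurable path_space" if "0 \<le> t" for t
    by (rule measurable_compose[OF path_space_component[OF that]], intro borel_measurable_continuous_onI continuous_intros)+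
  have Fm: "F \<in> measurable path_space ?N"
    unfolding F_def[abs_def] path_increments_def increments_def
    by (intro measurable_Pair measurable_restrict borel_measurable_diff comp) (use h in auto)
  have Zm: "?Z t \<in> borel_measurable M" if "0 \<le> t" for t
    using wiener_measurable[OF wiener(1) that] wiener_measurable[OF wiener(2) that] by (rule borel_measurable_Pair)
  have G: "?G \<omega> = F (path ?Z \<omega>)" for \<omega>
    using h unfolding F_def path_increments_def increments_def path_def h_def[symmetric] by (auto simp: fun_eq_iff)
  have X0: "X 0 \<in> borel_measurable M" by (rule measurable_X) simp
  have "distr M (borel \<Otimes>\<^sub>M ?N) (\<lambda>\<omega>. (X 0 \<omega>, ?G \<omega>)) = distr M borel (X 0) \<Otimes>\<^sub>M distr M ?N ?G"
  proof (rule distr_pair_indep_set)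
    show "indep_set {X 0 -` E \<inter> space M |E. E \<in> sets borel} (process_events M ?Z)"
      using model by (simp add: linear_filtering_model_def)
    show "?G -` E \<inter> space M \<in> process_events M ?Z" if "E \<in> sets ?N" for E
      unfolding G by (rule process_eventsI[OF Fm Zm that])
  qed (rule X0, rule measurable_inc_pair, blast)
  then have law: "distr M (borel \<Otimes>\<^sub>M ?N) (\<lambda>\<omega>. (X 0 \<omega>, ?G \<omega>)) = distr M borel (X 0) \<Otimes>\<^sub>M noise h K"
    unfolding noise_distr[OF K] h_def .
  note fm = increment_functional_measurable[OF f]
  have [measurable]: "(\<lambda>p. f (fst p) (snd p)) \<in> borel_measurable ?N" by (rule fm)
  have [measurable_cong]: "sets (noise h K) = sets ?N" by (rule sets_noise)
  interpret X0: prob_space "distr M borel (X 0)" by (rule prob_space_distr) fact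
  interpret N: prob_space "noise h K :: ((nat \<Rightarrow> real^'p) \<times> (nat \<Rightarrow> real^'r)) measure"
    unfolding h_def noise_distr[OF K, symmetric] by (rule prob_space_distr[OF measurable_inc_pair])
  interpret XN: pair_prob_space "distr M borel (X 0)" "noise h K :: ((nat \<Rightarrow> real^'p) \<times> (nat \<Rightarrow> real^'r)) measure" ..
  let ?e = "\<lambda>p. iexp (u \<bullet> (fst p + f (fst (snd p)) (snd (snd p))))"
  have "expectation (\<lambda>\<omega>. iexp (u \<bullet> (X 0 \<omega> + f (w_inc m \<omega>) (v_inc m \<omega>)))) =
     expectation (\<lambda>\<omega>. ?e (X 0 \<omega>, ?G \<omega>))"
    by (simp only: fst_conv snd_conv increment_functional_restrict[OF f])
  also have "\<dots> = (\<integral>p. ?e p \<partial>distr M (borel \<Otimes>\<^sub>M ?N) (\<lambda>\<omega>. (X 0 \<omega>, ?G \<omega>)))"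
    by (rule integral_distr[OF measurable_Pair[OF X0 measurable_inc_pair], symmetric]) measurable
  also have "\<dots> = (\<integral>x. (\<integral>p. ?e (x, p) \<partial>noise h K) \<partial>distr M borel (X 0))"
    unfolding law
    by (rule XN.integral_fst'[symmetric], rule integrable_bounded_prob[where B=1])
      (auto simp: norm_exp_i_times intro: XN.prob_space_axioms)
  also have "\<dots> = (\<integral>x. (\<integral>p. iexp (u \<bullet> x) * iexp (u \<bullet> f (fst p) (snd p)) \<partial>noise h K) \<partial>distr M borel (X 0))"
    by (simp add: inner_add_right distrib_left exp_add)
  also have "\<dots> = vchar (distr M borel (X 0)) u * (\<integral>p. iexp (u \<bullet> f (fst p) (snd p)) \<partial>noise h K)"
    unfolding vchar_def by (simp only: integral_mult_right_zero integral_mult_left_zero)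
  finally show ?thesis unfolding h_def .
qed

text \<open>The assumption on \<open>P\<close> turns the contributions of the initial condition into
  exactly \<open>X 0\<close>, so \<open>X 0\<close> plus the Euler statistic converges almost surely
  to the statistic of the observations. Bounded convergence passes to characteristic
  functions.\<close>

lemma vchar_statistic_tendsto:
  fixes P :: "real \<Rightarrow> real^'q^'d"
  assumes F: "finite F" "F \<subseteq> {0..}" and P: "\<And>x. (\<Sum>t\<in>F. P t *v obs_flow A C t x) = x"
  shows "(\<lambda>m. vchar (distr M borel (X 0)) u * statistic_char A B C D F P m u)
    \<longlonglongrightarrow> vchar (distr M borel (\<lambda>\<omega>. \<Sum>t\<in>F. P t *v Y t \<omega>)) u"
proof -
  define K where "K m = Suc (\<Sum>t\<in>F. nat \<lfloor>t * real (Suc m)\<rfloor>)" for m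
  let ?f = "\<lambda>m w v. \<Sum>t\<in>F. P t *v euler_approx A B C D m t w v"
  have inc: "increment_functional (K m) (?f m)" for m
    unfolding K_def by (rule increment_functional_statistic[OF F(1)])
  have X0 [measurable]: "X 0 \<in> borel_measurable M" by (rule measurable_X) simp
  have [measurable]: "(\<lambda>x. P t *v x) \<in> borel_measurable borel" for t
    by (intro borel_measurable_continuous_onI continuous_intros)
  have Ym [measurable]: "(\<lambda>\<omega>. \<Sum>t\<in>F. P t *v Y t \<omega>) \<in> borel_measurable M"
    using F by (intro borel_measurable_sum measurable_compose[OF measurable_Y]) auto
  have [measurable]: "(\<lambda>\<omega>. ?f m (w_inc m \<omega>) (v_inc m \<omega>)) \<in> borel_measurable M" for m
    by (rule measurable_increment_functional[OF inc])
  have "(\<lambda>m. expectation (\<lambda>\<omega>. iexp (u \<bullet> (X 0 \<omega> + ?f m (w_inc m \<omega>) (v_inc m \<omega>))))) \<longlonglongrightarrow>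
     expectation (\<lambda>\<omega>. iexp (u \<bullet> (\<Sum>t\<in>F. P t *v Y t \<omega>)))"
  proof (rule integral_dominated_convergence[where w="\<lambda>_. 1"])
    show "AE \<omega> in M. (\<lambda>m. iexp (u \<bullet> (X 0 \<omega> + ?f m (w_inc m \<omega>) (v_inc m \<omega>)))) \<longlonglongrightarrow>
        iexp (u \<bullet> (\<Sum>t\<in>F. P t *v Y t \<omega>))"
      using AE_euler_approx
    proof eventually_elim
      case (elim \<omega>)
      have "(\<lambda>m. X 0 \<omega> + ?f m (w_inc m \<omega>) (v_inc m \<omega>)) \<longlonglongrightarrow> X 0 \<omega> + (\<Sum>t\<in>F. P t *v (Y t \<omega> - obs_flow A C t (X 0 \<omega>)))"
        by (intro tendsto_intros bounded_linear.tendsto[OF matrix_vector_mul_bounded_linear]) (use elim F in auto)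
      also have "X 0 \<omega> + (\<Sum>t\<in>F. P t *v (Y t \<omega> - obs_flow A C t (X 0 \<omega>))) = (\<Sum>t\<in>F. P t *v Y t \<omega>)"
        by (simp add: matrix_vector_mult_diff_distrib sum_subtractf P)
      finally show ?case by (intro tendsto_intros)
    qed
    show "(\<lambda>\<omega>. iexp (u \<bullet> (X 0 \<omega> + ?f m (w_inc m \<omega>) (v_inc m \<omega>)))) \<in> borel_measurable M" for m
      by measurable
    show "(\<lambda>\<omega>. iexp (u \<bullet> (\<Sum>t\<in>F. P t *v Y t \<omega>))) \<in> borel_measurable M"
      by measurable
  qed (simp_all add: norm_exp_i_times del: of_nat_Suc)
  also have "expectation (\<lambda>\<omega>. iexp (u \<bullet> (\<Sum>t\<in>F. P t *v Y t \<omega>))) = vchar (distr M borel (\<lambda>\<omega>. \<Sum>t\<in>F. P t *v Y t \<omega>)) u"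
    unfolding vchar_def by (subst integral_distr) auto
  finally show ?thesis
    unfolding statistic_char_def K_def[symmetric] by (subst (asm) expectation_initial_increments[OF _ inc]) (auto simp: K_def)
qed

end

section \<open>Uniform observability\<close>

lemma quad_form_scaleR: "quad_form Q (c *\<^sub>R u) = c\<^sup>2 * quad_form Q u"
  unfolding quad_form_def by (simp add: sum_distrib_left power2_eq_square mult_ac)

lemma quad_form_polarization:
  assumes sym: "\<And>i j. Q i j = Q j i"
  shows "Q a b = (quad_form Q (axis a 1 + axis b 1) - quad_form Q (axis a 1) - quad_form Q (axis b 1)) / 2"
proof -
  have del: "(\<Sum>j\<in>UNIV. g j * (axis c (1::real) :: real^'a) $ j) = g c" for g and c :: 'a
    by (simp add: axis_def if_distrib[of "\<lambda>x. _ * x"] cong: if_cong)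
  have q: "quad_form Q u = (\<Sum>i\<in>UNIV. (\<Sum>j\<in>UNIV. Q i j * u $ j) * u $ i)" for u
    unfolding quad_form_def by (simp add: sum_distrib_right sum_distrib_left mult_ac)
  show ?thesis unfolding q
    by (simp add: distrib_left sum.distrib del) (simp add: distrib_right sum.distrib del sym[of b a])
qed

lemma tendsto_quad_form:
  assumes "\<And>i j. (\<lambda>m. Q m i j) \<longlonglongrightarrow> Q' i j" shows "(\<lambda>m. quad_form (Q m) u) \<longlonglongrightarrow> quad_form Q' u"
  unfolding quad_form_def by (intro tendsto_intros assms)

text \<open>
  The limit cannot vanish at \<open>u\<close>, for then it would vanish at \<open>u / n\<close> for all \<open>n\<close>, contradicting
  continuity at \<open>0\<close>.
\<close>

lemma vchar_gaussian_limit: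
  fixes \<mu> :: "(real^'n) measure"
  assumes mu: "\<mu> \<in> borel_probabilities" and sym: "\<And>m i j. Q m i j = Q m j i"
    and lim: "\<And>u. (\<lambda>m. complex_of_real (exp (- quad_form (Q m) u / 2))) \<longlonglongrightarrow> vchar \<mu> u"
  obtains Q' where "\<And>u. vchar \<mu> u = of_real (exp (- quad_form Q' u / 2))"
proof -
  interpret prob_space \<mu> by (rule borel_probabilitiesD[OF mu])
  note [measurable_cong] = borel_probabilitiesD(2)[OF mu]
  define r where "r u = Re (vchar \<mu> u)" for u
  have limr: "(\<lambda>m. exp (- quad_form (Q m) u / 2)) \<longlonglongrightarrow> r u" for u
    using tendsto_Re[OF lim[of u]] by (simp add: r_def)
  have vr: "vchar \<mu> u = of_real (r u)" for u
    using LIMSEQ_unique[OF lim[of u] tendsto_of_real[OF limr[of u]]] .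
  have r0: "0 \<le> r u" for u by (rule LIMSEQ_le_const[OF limr]) (auto intro: less_imp_le)
  have rpos: "0 < r u" for u
  proof (rule ccontr)
    assume "\<not> 0 < r u"
    then have ru: "r u = 0" using r0[of u] by simp
    have "r ((1 / real (Suc n)) *\<^sub>R u) = 0" for n
    proof -
      \<comment> \<open>The forms are homogeneous of degree 2, so this power carries the value at
        \<open>u / (n + 1)\<close> back to the value at \<open>u\<close>.\<close>
      let ?k = "(Suc n)\<^sup>2"
      have "exp (- quad_form (Q m) ((1 / real (Suc n)) *\<^sub>R u) / 2) ^ ?k = exp (- quad_form (Q m) u / 2)" for m
        by (simp add: exp_of_nat_mult[symmetric] quad_form_scaleR power_divide field_simps del: of_nat_Suc)
      then have "(\<lambda>m. exp (- quad_form (Q m) u / 2)) \<longlonglongrightarrow> r ((1 / real (Suc n)) *\<^sub>R u) ^ ?k"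
        using tendsto_power[OF limr, of "(1 / real (Suc n)) *\<^sub>R u" ?k] by simp
      then have "r ((1 / real (Suc n)) *\<^sub>R u) ^ ?k = 0" using LIMSEQ_unique limr ru by metis
      then show ?thesis by simp
    qed
    then have "vchar \<mu> ((1 / real (Suc n)) *\<^sub>R u) = 0" for n using vr by simp
    moreover have "(\<lambda>n. vchar \<mu> ((1 / real (Suc n)) *\<^sub>R u)) \<longlonglongrightarrow> (\<integral>x. 1 \<partial>\<mu>)"
      unfolding vchar_def
    proof (rule integral_dominated_convergence[where w="\<lambda>_. 1"])
      show "AE x in \<mu>. (\<lambda>n. iexp ((1 / real (Suc n)) *\<^sub>R u \<bullet> x)) \<longlonglongrightarrow> 1"
      proof (intro AE_I2)
        fix x
        have "(\<lambda>n. iexp ((1 / real (Suc n)) *\<^sub>R u \<bullet> x)) \<longlonglongrightarrow> iexp (0 *\<^sub>R u \<bullet> x)"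
          using LIMSEQ_inverse_real_of_nat unfolding inverse_eq_divide by (intro tendsto_intros)
        then show "(\<lambda>n. iexp ((1 / real (Suc n)) *\<^sub>R u \<bullet> x)) \<longlonglongrightarrow> 1" by simp
      qed
    qed (auto simp: norm_exp_i_times)
    ultimately have "(\<lambda>n::nat. 0 :: complex) \<longlonglongrightarrow> 1" using prob_space by simp
    then show False using LIMSEQ_unique[OF tendsto_const[of "0::complex"]] by fastforce
  qed
  define g where "g u = - 2 * ln (r u)" for u
  have limq: "(\<lambda>m. quad_form (Q m) u) \<longlonglongrightarrow> g u" for u
  proof -
    have "(\<lambda>m. - 2 * ln (exp (- quad_form (Q m) u / 2))) \<longlonglongrightarrow> g u"
      unfolding g_def by (intro tendsto_intros limr) (use rpos[of u] in simp)
    then show ?thesis by simp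
  qed
  \<comment> \<open>Polarization converts convergence of the forms into convergence of their
    coefficients; therefore the limit \<open>g\<close> is itself a quadratic form.\<close>
  define Q' where "Q' i j = (g (axis i 1 + axis j 1) - g (axis i 1) - g (axis j 1)) / 2" for i j
  have "(\<lambda>m. Q m i j) \<longlonglongrightarrow> Q' i j" for i j
    unfolding Q'_def by (subst quad_form_polarization[OF sym]) (intro tendsto_intros limq, simp)
  then have "quad_form Q' u = g u" for u
    using LIMSEQ_unique[OF tendsto_quad_form limq] by blast
  then have "exp (- quad_form Q' u / 2) = r u" for u using rpos[of u] by (simp add: g_def)
  then show ?thesis using that[of Q'] vr by simp
qed

section \<open>Restriction to the observation field and total variation\<close>

lemma subalgebra_observation_field:
  fixes N :: "(real \<Rightarrow> 'a::second_countable_topology \<times> 'b::second_countable_topology) measure"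
  assumes N: "sets N = sets path_space"
  shows "subalgebra N observation_field"
    and "path (\<lambda>t z. snd (z t)) \<in> measurable (observation_field :: (real \<Rightarrow> 'a \<times> 'b) measure) path_space"
proof -
  have sp: "space N = space path_space" by (rule sets_eq_imp_space_eq[OF N])
  have "(\<lambda>z. snd (z t)) \<in> borel_measurable (path_space :: (real \<Rightarrow> 'a \<times> 'b) measure)" if "0 \<le> t" for t
    by (rule measurable_compose[OF path_space_component[OF that]]) (intro borel_measurable_continuous_onI continuous_intros)
  then have m: "path (\<lambda>t z. snd (z t)) \<in> measurable (path_space :: (real \<Rightarrow> 'a \<times> 'b) measure) path_space"
    by (rule measurable_path)
  then show "path (\<lambda>t z. snd (z t)) \<in> measurable (observation_field :: (real \<Rightarrow> 'a \<times> 'b) measure) path_space"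
    unfolding observation_field_def by (intro measurable_vimage_algebra1) (auto simp: measurable_def)
  show "subalgebra N observation_field"
    unfolding subalgebra_def observation_field_def sp N
    by (intro conjI sets_image_in_sets[OF refl m]) simp
qed

abbreviation observation_law ::
    "'w measure \<Rightarrow> (real \<Rightarrow> 'w \<Rightarrow> 'a::topological_space) \<Rightarrow> (real \<Rightarrow> 'w \<Rightarrow> 'b::topological_space) \<Rightarrow>
     (real \<Rightarrow> 'a \<times> 'b) measure" where
  "observation_law M X Y \<equiv> restr_to_subalg (signal_observation_law M X Y) observation_field"

lemma tv_dist_upper:
  fixes P Q :: "'a measure"
  assumes "prob_space P" "prob_space Q" and sets: "sets P = sets Q"
    and f: "f \<in> borel_measurable P" "\<And>x. x \<in> space P \<Longrightarrow> \<bar>f x\<bar> \<le> 1"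
  shows "\<bar>(\<integral>x. f x \<partial>P) - (\<integral>x. f x \<partial>Q)\<bar> \<le> tv_dist P Q"
  unfolding tv_dist_def
proof (rule cSUP_upper)
  have "\<bar>(\<integral>x. f x \<partial>P) - (\<integral>x. f x \<partial>Q)\<bar> \<le> 2" if "f \<in> borel_measurable P" "\<forall>x\<in>space P. \<bar>f x\<bar> \<le> 1" for f :: "'a \<Rightarrow> real"
  proof -
    have "\<bar>\<integral>x. f x \<partial>P\<bar> \<le> 1" "\<bar>\<integral>x. f x \<partial>Q\<bar> \<le> 1"
      using that abs_integral_le[OF assms(1), of f 1] abs_integral_le[OF assms(2), of f 1] sets_eq_imp_space_eq[OF sets]
      by (simp_all add: measurable_cong_sets[OF sets refl])
    then show ?thesis by linarith
  qed
  note two = this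
  show "bdd_above ((\<lambda>f :: 'a \<Rightarrow> real. \<bar>(\<integral>x. f x \<partial>P) - (\<integral>x. f x \<partial>Q)\<bar>) ` {f \<in> borel_measurable P. \<forall>x\<in>space P. \<bar>f x\<bar> \<le> 1})"
    by (rule bdd_aboveI[where M=2]) (use two in blast)
qed (use f in auto)

lemma tv_dist_self: "tv_dist P P = 0"
proof -
  have "(\<lambda>_. 0) \<in> {f \<in> borel_measurable P. \<forall>x\<in>space P. \<bar>f x\<bar> \<le> (1::real)}" by simp
  then have "{f \<in> borel_measurable P. \<forall>x\<in>space P. \<bar>f x\<bar> \<le> (1::real)} \<noteq> {}" by blast
  then show ?thesis unfolding tv_dist_def diff_self abs_zero by (rule cSUP_const)
qed

context filtering_model
begin

lemma measurable_XY: "path (\<lambda>t \<omega>. (X t \<omega>, Y t \<omega>)) \<in> measurable M path_space"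
  by (intro measurable_path borel_measurable_Pair measurable_X measurable_Y)

lemma sets_law: "sets (signal_observation_law M X Y) = sets path_space"
  by (simp add: signal_observation_law_def)

lemma prob_space_law: "prob_space (signal_observation_law M X Y)"
  unfolding signal_observation_law_def by (rule prob_space_distr[OF measurable_XY])

lemma path_snd_path: "path (\<lambda>t z. snd (z t)) (path (\<lambda>t \<omega>. (X t \<omega>, Y t \<omega>)) \<omega>) = path Y \<omega>"
  by (auto simp: path_def fun_eq_iff)

lemma integral_observation:
  fixes g :: "(real \<Rightarrow> real^'q) \<Rightarrow> real"
  assumes g: "g \<in> borel_measurable path_space"
  shows "(\<integral>z. g (path (\<lambda>t z. snd (z t)) z) \<partial>observation_law M X Y) =
    expectation (\<lambda>\<omega>. g (path Y \<omega>))"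
proof -
  note sub = subalgebra_observation_field[OF sets_law]
  have m: "(\<lambda>z. g (path (\<lambda>t z. snd (z t)) z)) \<in> borel_measurable (observation_field :: (real \<Rightarrow> (real^'d) \<times> (real^'q)) measure)"
    using sub(2) g by (rule measurable_compose)
  have "(\<lambda>z. g (path (\<lambda>t z. snd (z t)) z)) \<in> borel_measurable (path_space :: (real \<Rightarrow> (real^'d) \<times> (real^'q)) measure)"
    using measurable_from_subalg[OF sub(1) m] by (simp add: measurable_cong_sets[OF sets_law refl])
  then have "(\<integral>z. g (path (\<lambda>t z. snd (z t)) z) \<partial>signal_observation_law M X Y) = expectation (\<lambda>\<omega>. g (path Y \<omega>))"
    unfolding signal_observation_law_def by (subst integral_distr[OF measurable_XY]) (simp_all add: path_snd_path)
  then show ?thesis by (simp add: integral_subalgebra2[OF sub(1) m])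
qed

text \<open>The sets of \<open>observation_field\<close> are such preimages, so equality of
  restricted laws reduces to equality of the laws of \<open>path Y\<close>.\<close>

lemma emeasure_observation:
  assumes E: "E \<in> sets path_space"
  shows "emeasure (observation_law M X Y)
      (path (\<lambda>t z. snd (z t)) -` E \<inter> space path_space) = emeasure (distr M path_space (path Y)) E"
proof -
  let ?A = "path (\<lambda>t z. snd (z t)) -` E \<inter> space (path_space :: (real \<Rightarrow> (real^'d) \<times> (real^'q)) measure)"
  note sub = subalgebra_observation_field[OF sets_law]
  have A: "?A \<in> sets observation_field"
    unfolding observation_field_def by (rule in_vimage_algebra[OF E])
  then have A': "?A \<in> sets path_space"
    using sub(1) sets_law by (auto simp: subalgebra_def)
  have Ym: "path Y \<in> measurable M path_space" by (intro measurable_path measurable_Y)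
  have "emeasure (observation_law M X Y) ?A = emeasure (signal_observation_law M X Y) ?A"
    by (rule emeasure_restr_to_subalg[OF sub(1) A])
  also have "\<dots> = emeasure M (path (\<lambda>t \<omega>. (X t \<omega>, Y t \<omega>)) -` ?A \<inter> space M)"
    unfolding signal_observation_law_def by (rule emeasure_distr[OF measurable_XY A'])
  also have "path (\<lambda>t \<omega>. (X t \<omega>, Y t \<omega>)) -` ?A \<inter> space M = path Y -` E \<inter> space M"
    using measurable_space[OF measurable_XY] by (auto simp: path_snd_path)
  also have "emeasure M (path Y -` E \<inter> space M) = emeasure (distr M path_space (path Y)) E"
    by (rule emeasure_distr[OF Ym E, symmetric])
  finally show ?thesis .
qed

end

text \<open>The empty set is treated separately because \<open>infdist y {}\<close> is 0, which
  would give the value 1 instead of 0.\<close>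

definition closed_approx :: "'a::metric_space set \<Rightarrow> nat \<Rightarrow> 'a \<Rightarrow> real" where
  "closed_approx K n y = (if K = {} then 0 else max 0 (1 - real n * infdist y K))"

lemma closed_approx:
  shows "continuous_on UNIV (closed_approx K n)" "\<bar>closed_approx K n y\<bar> \<le> 1"
    and "closed K \<Longrightarrow> (\<lambda>n. closed_approx K n y) \<longlonglongrightarrow> indicator K y"
proof -
  show "continuous_on UNIV (closed_approx K n)"
    unfolding closed_approx_def by (cases "K = {}") (auto intro!: continuous_intros)
  show "\<bar>closed_approx K n y\<bar> \<le> 1" unfolding closed_approx_def by (auto simp: infdist_nonneg)
  assume K: "closed K"
  consider "K = {}" | "y \<in> K" | "K \<noteq> {}" "y \<notin> K" by blast
  then show "(\<lambda>n. closed_approx K n y) \<longlonglongrightarrow> indicator K y"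
  proof cases
    case 3
    then have pos: "0 < infdist y K" using K infdist_pos_not_in_closed by blast
    obtain N where N: "1 / infdist y K < real N" using reals_Archimedean2 by blast
    have "closed_approx K n y = 0" if "N \<le> n" for n
    proof -
      have "1 \<le> real N * infdist y K" using N pos by (simp add: field_simps)
      also have "\<dots> \<le> real n * infdist y K" using that pos by (intro mult_right_mono) auto
      finally show ?thesis by (simp add: closed_approx_def)
    qed
    then have "eventually (\<lambda>n. closed_approx K n y = 0) sequentially" by (auto simp: eventually_sequentially)
    then have "(\<lambda>n. closed_approx K n y) \<longlonglongrightarrow> 0" by (rule tendsto_eventually)
    then show ?thesis using 3 by simp
  next
    case 2
    then have "closed_approx K n y = 1" for n by (auto simp: closed_approx_def)
    then show ?thesis using 2 by simp
  qed (simp add: closed_approx_def)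
qed

section \<open>Uniqueness of laws on path space\<close>

abbreviation cylinder :: "real set \<Rightarrow> (real \<Rightarrow> 'b set) \<Rightarrow> (real \<Rightarrow> 'b::topological_space) set" where
  "cylinder J K \<equiv> {z \<in> space path_space. \<forall>t\<in>J. z t \<in> K t}"

lemma sets_cylinder:
  assumes J: "finite J" "J \<subseteq> {0..}" and K: "\<And>t. closed (K t)"
  shows "(cylinder J K) \<in> sets path_space"
proof (intro sets.sets_Collect_finite_All J(1))
  fix t assume "t \<in> J"
  then show "{z \<in> space path_space. z t \<in> K t} \<in> sets path_space"
    using measurable_sets[OF path_space_component, of t "K t"] J K by (auto simp: vimage_def Int_def conj_commute)
qed

text \<open>Cylinders over closed sets form an intersection-stable generator.\<close>

lemma path_measure_eqI:
  fixes P Q :: "(real \<Rightarrow> 'b::metric_space) measure"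
  assumes P: "prob_space P" "sets P = sets path_space" and Q: "sets Q = sets path_space"
    and eq: "\<And>J K. finite J \<Longrightarrow> J \<subseteq> {0..} \<Longrightarrow> (\<And>t. closed (K t)) \<Longrightarrow>
      emeasure P (cylinder J K) = emeasure Q (cylinder J K)"
  shows "P = Q"
proof -
  let ?\<Omega> = "space (path_space :: (real \<Rightarrow> 'b) measure)"
  let ?E = "{(cylinder J K) |J K. finite J \<and> J \<subseteq> {0..} \<and> (\<forall>t. closed (K t))} :: (real \<Rightarrow> 'b) set set"
  have mem: "(cylinder J K) \<in> ?E" if "finite J" "J \<subseteq> {0..}" "\<And>t. closed (K t)" for J and K :: "real \<Rightarrow> 'b set"
    using that by blast
  have Om: "?\<Omega> \<in> ?E" using mem[of "{}" "\<lambda>_. UNIV"] by simp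
  have E\<Omega>: "?E \<subseteq> Pow ?\<Omega>" by auto
  have gen: "sets path_space = sigma_sets ?\<Omega> ?E"
  proof
    let ?N = "sigma ?\<Omega> ?E"
    have N: "space ?N = ?\<Omega>" "sets ?N = sigma_sets ?\<Omega> ?E" using E\<Omega> by (auto simp: space_measure_of_conv)
    have "(\<lambda>z. z t) \<in> borel_measurable ?N" if t: "0 \<le> t" for t
    proof (rule borel_measurableI)
      fix S :: "'b set" assume "open S"
      then have "{z \<in> ?\<Omega>. \<forall>s\<in>{t}. z s \<in> (\<lambda>_. - S) s} \<in> ?E" using t by (intro mem) auto
      then have "{z \<in> ?\<Omega>. \<forall>s\<in>{t}. z s \<in> - S} \<in> sets ?N" unfolding N by (rule sigma_sets.Basic)
      then have "space ?N - {z \<in> ?\<Omega>. \<forall>s\<in>{t}. z s \<in> - S} \<in> sets ?N" by (rule sets.compl_sets)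
      also have "space ?N - {z \<in> ?\<Omega>. \<forall>s\<in>{t}. z s \<in> - S} = (\<lambda>z. z t) -` S \<inter> space ?N"
        unfolding N by auto
      finally show "(\<lambda>z. z t) -` S \<inter> space ?N \<in> sets ?N" .
    qed
    then have "{z \<in> space ?N. z t \<in> S} \<in> sets ?N" if "t \<in> {0..}" "S \<in> sets borel" for t S
      using measurable_sets[of "\<lambda>z. z t" ?N borel S] that by (auto simp: vimage_def Int_def conj_commute)
    then have "sets (PiM {0..} (\<lambda>_. borel)) \<subseteq> sets ?N"
    proof (intro sets_PiM_in_sets)
      show "space ?N = (\<Pi>\<^sub>E t\<in>{0..}. space borel)" using N(1) by (simp only: space_path_space space_borel)
    qed
    then show "sets path_space \<subseteq> sigma_sets ?\<Omega> ?E"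
      unfolding N(2)[symmetric] by (simp only: path_space_def)
    show "sigma_sets ?\<Omega> ?E \<subseteq> sets path_space" using sets_cylinder by (intro sets.sigma_sets_subset) auto
  qed
  show ?thesis
  proof (rule measure_eqI_generator_eq[where A="\<lambda>_. ?\<Omega>" and E="?E" and \<Omega>="?\<Omega>"])
    show "Int_stable ?E"
    proof (rule Int_stableI)
      fix a b assume "a \<in> ?E" "b \<in> ?E"
      then obtain J J' and K K' :: "real \<Rightarrow> 'b set" where
        a: "a = (cylinder J K)" "finite J" "J \<subseteq> {0..}" "\<And>t. closed (K t)" and
        b: "b = (cylinder J' K')" "finite J'" "J' \<subseteq> {0..}" "\<And>t. closed (K' t)" by blast
      \<comment> \<open>Each family is extended by \<open>UNIV\<close> outside its own times, so
        that both cylinders can be written over \<open>J \<union> J'\<close>.\<close>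
      let ?L = "\<lambda>t. (if t \<in> J then K t else UNIV) \<inter> (if t \<in> J' then K' t else UNIV)"
      have "a \<inter> b = {z \<in> ?\<Omega>. \<forall>t\<in>J \<union> J'. z t \<in> ?L t}" unfolding a b by auto
      also have "\<dots> \<in> ?E" using a b by (intro mem) auto
      finally show "a \<inter> b \<in> ?E" .
    qed
    show "emeasure P S = emeasure Q S" if "S \<in> ?E" for S using that eq by blast
    show "range (\<lambda>_. ?\<Omega>) \<subseteq> ?E" using Om by blast
    show "emeasure P ?\<Omega> \<noteq> \<infinity>"
      using prob_space.emeasure_space_1[OF P(1)] sets_eq_imp_space_eq[OF P(2)] by simp
  qed (use E\<Omega> P Q gen in auto)
qed

text \<open>Expectations of products of continuous functions of the observations are limits of one
  and the same sequence of noise integrals. Continuous functions come first because the scheme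
  converges only pathwise; \<open>closed_approx\<close> then leads to closed cylinders.\<close>

lemma observation_law_unique:
  fixes C :: "real^'d^'q"
  assumes M1: "filtering_model A B C D M1 W1 V1 X1 Y1" and M2: "filtering_model A B C D M2 W2 V2 X2 Y2"
    and X1: "AE \<omega> in M1. \<forall>t. obs_flow A C t (X1 0 \<omega>) = 0" and X2: "AE \<omega> in M2. \<forall>t. obs_flow A C t (X2 0 \<omega>) = 0"
  shows "distr M1 path_space (path Y1) = distr M2 path_space (path Y2)"
proof -
  interpret M1: filtering_model A B C D M1 W1 V1 X1 Y1 by fact
  interpret M2: filtering_model A B C D M2 W2 V2 X2 Y2 by fact
  have Y1m: "path Y1 \<in> measurable M1 path_space" by (intro measurable_path M1.measurable_Y)
  have Y2m: "path Y2 \<in> measurable M2 path_space" by (intro measurable_path M2.measurable_Y)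
  have eq: "M1.expectation (\<lambda>\<omega>. \<Prod>t\<in>J. \<phi> t (Y1 t \<omega>)) = M2.expectation (\<lambda>\<omega>. \<Prod>t\<in>J. \<phi> t (Y2 t \<omega>))"
    if J: "finite J" "J \<subseteq> {0..}" and \<phi>: "\<And>t. continuous_on UNIV (\<phi> t)" "\<And>t y. \<bar>\<phi> t y\<bar> \<le> 1"
    for J and \<phi> :: "real \<Rightarrow> real^'q \<Rightarrow> real"
    by (rule LIMSEQ_unique[OF M1.expectation_prod_observations[OF J \<phi> X1] M2.expectation_prod_observations[OF J \<phi> X2]])
  have lim: "(\<lambda>n. \<integral>\<omega>. (\<Prod>t\<in>J. closed_approx (K t) n (Y t \<omega>)) \<partial>M) \<longlonglongrightarrow> measure M {\<omega>\<in>space M. \<forall>t\<in>J. Y t \<omega> \<in> K t}"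
    if "prob_space M" and Y: "\<And>t. 0 \<le> t \<Longrightarrow> Y t \<in> borel_measurable M" and J: "finite J" "J \<subseteq> {0..}" and K: "\<And>t. closed (K t)"
    for M :: "'z measure" and Y :: "real \<Rightarrow> 'z \<Rightarrow> real^'q" and J K
  proof -
    interpret prob_space M by fact
    have [measurable]: "closed_approx (K t) n \<in> borel_measurable borel" for t n
      by (rule borel_measurable_continuous_onI) (rule closed_approx)
    have [measurable]: "Y t \<in> borel_measurable M" if "t \<in> J" for t using J Y that by auto
    have [measurable]: "K t \<in> sets borel" for t using K by auto
    have [measurable]: "{\<omega>\<in>space M. \<forall>t\<in>J. Y t \<omega> \<in> K t} \<in> sets M"
      using J by (intro sets.sets_Collect_finite_All) measurable
    have ind: "(\<Prod>t\<in>J. indicator (K t) (Y t \<omega>)) = (indicator {\<omega>\<in>space M. \<forall>t\<in>J. Y t \<omega> \<in> K t} \<omega> :: real)" if "\<omega> \<in> space M" for \<omega>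
      using that J by (auto simp: indicator_def intro!: prod.neutral prod_zero)
    have "(\<lambda>n. \<integral>\<omega>. (\<Prod>t\<in>J. closed_approx (K t) n (Y t \<omega>)) \<partial>M) \<longlonglongrightarrow> (\<integral>\<omega>. indicator {\<omega>\<in>space M. \<forall>t\<in>J. Y t \<omega> \<in> K t} \<omega> \<partial>M)"
    proof (rule integral_dominated_convergence[where w="\<lambda>_. 1"])
      show "AE \<omega> in M. (\<lambda>n. \<Prod>t\<in>J. closed_approx (K t) n (Y t \<omega>)) \<longlonglongrightarrow> indicator {\<omega>\<in>space M. \<forall>t\<in>J. Y t \<omega> \<in> K t} \<omega>"
      proof (intro AE_I2)
        fix \<omega> assume "\<omega> \<in> space M"
        show "(\<lambda>n. \<Prod>t\<in>J. closed_approx (K t) n (Y t \<omega>)) \<longlonglongrightarrow> indicator {\<omega>\<in>space M. \<forall>t\<in>J. Y t \<omega> \<in> K t} \<omega>"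
          unfolding ind[OF \<open>\<omega> \<in> space M\<close>, symmetric] by (intro tendsto_prod closed_approx K)
      qed
      show "AE \<omega> in M. norm (\<Prod>t\<in>J. closed_approx (K t) n (Y t \<omega>)) \<le> 1" for n
        unfolding real_norm_def abs_prod by (intro AE_I2 prod_le_1) (use closed_approx(2) in auto)
    qed auto
    then show ?thesis by simp
  qed
  show ?thesis
  proof (rule path_measure_eqI)
    show "prob_space (distr M1 path_space (path Y1))" by (rule M1.prob_space_distr[OF Y1m])
    fix J :: "real set" and K :: "real \<Rightarrow> (real^'q) set"
    assume J: "finite J" "J \<subseteq> {0..}" and K: "\<And>t. closed (K t)"
    note S = sets_cylinder[OF J K]
    have pre: "path Y -` (cylinder J K) \<inter> space M = {\<omega>\<in>space M. \<forall>t\<in>J. Y t \<omega> \<in> K t}"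
      for Y :: "real \<Rightarrow> 'z \<Rightarrow> real^'q" and M :: "'z measure"
      using J(2) by (auto simp: path_def space_path_space)
    have "measure M1 {\<omega>\<in>space M1. \<forall>t\<in>J. Y1 t \<omega> \<in> K t} = measure M2 {\<omega>\<in>space M2. \<forall>t\<in>J. Y2 t \<omega> \<in> K t}"
    proof (rule LIMSEQ_unique)
      show "(\<lambda>n. \<integral>\<omega>. (\<Prod>t\<in>J. closed_approx (K t) n (Y1 t \<omega>)) \<partial>M1) \<longlonglongrightarrow> measure M1 {\<omega>\<in>space M1. \<forall>t\<in>J. Y1 t \<omega> \<in> K t}"
        by (rule lim) (use M1.prob_space_axioms M1.measurable_Y J K in auto)
      have "(\<lambda>n. \<integral>\<omega>. (\<Prod>t\<in>J. closed_approx (K t) n (Y2 t \<omega>)) \<partial>M2) \<longlonglongrightarrow> measure M2 {\<omega>\<in>space M2. \<forall>t\<in>J. Y2 t \<omega> \<in> K t}"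
        by (rule lim) (use M2.prob_space_axioms M2.measurable_Y J K in auto)
      then show "(\<lambda>n. \<integral>\<omega>. (\<Prod>t\<in>J. closed_approx (K t) n (Y1 t \<omega>)) \<partial>M1) \<longlonglongrightarrow> measure M2 {\<omega>\<in>space M2. \<forall>t\<in>J. Y2 t \<omega> \<in> K t}"
        by (subst eq[OF J closed_approx(1) closed_approx(2)])
    qed
    then show "emeasure (distr M1 path_space (path Y1)) (cylinder J K) =
      emeasure (distr M2 path_space (path Y2)) (cylinder J K)"
      unfolding emeasure_distr[OF Y1m S] emeasure_distr[OF Y2m S] pre
      by (simp add: M1.emeasure_eq_measure M2.emeasure_eq_measure)
  qed auto
qed


lemma same_observation_law:
  fixes C :: "real^'d^'q"
  assumes M1: "filtering_model A B C D M1 W1 V1 X1 Y1" and M2: "filtering_model A B C D M2 W2 V2 X2 Y2"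
    and X1: "AE \<omega> in M1. \<forall>t. obs_flow A C t (X1 0 \<omega>) = 0" and X2: "AE \<omega> in M2. \<forall>t. obs_flow A C t (X2 0 \<omega>) = 0"
  shows "observation_law M1 X1 Y1 =
    observation_law M2 X2 Y2"
proof (rule measure_eqI)
  interpret M1: filtering_model A B C D M1 W1 V1 X1 Y1 by fact
  interpret M2: filtering_model A B C D M2 W2 V2 X2 Y2 by fact
  note sub1 = subalgebra_observation_field[OF M1.sets_law] and sub2 = subalgebra_observation_field[OF M2.sets_law]
  show "sets (observation_law M1 X1 Y1) =
      sets (observation_law M2 X2 Y2)"
    by (simp add: sets_restr_to_subalg[OF sub1(1)] sets_restr_to_subalg[OF sub2(1)])
  fix S assume "S \<in> sets (observation_law M1 X1 Y1)"
  then have "S \<in> sets observation_field" by (simp add: sets_restr_to_subalg[OF sub1(1)])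
  moreover have "path (\<lambda>t z. snd (z t)) \<in> space (path_space :: (real \<Rightarrow> (real^'d) \<times> (real^'q)) measure) \<rightarrow> space path_space"
    by (auto simp: space_path_space path_def)
  ultimately obtain E where E: "E \<in> sets path_space" "S = path (\<lambda>t z. snd (z t)) -` E \<inter> space path_space"
    unfolding observation_field_def by (auto simp: sets_vimage_algebra2)
  show "emeasure (observation_law M1 X1 Y1) S =
      emeasure (observation_law M2 X2 Y2) S"
    unfolding E(2) M1.emeasure_observation[OF E(1)] M2.emeasure_observation[OF E(1)]
    by (simp only: observation_law_unique[OF M1 M2 X1 X2])
qed

text \<open>The function \<open>min 1 (norm x)\<close> is admissible and separates 0 from
  \<open>v\<close>.\<close>

lemma bl_dist_return_pos:
  fixes v :: "'a::real_normed_vector"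
  assumes v: "v \<noteq> 0"
  shows "0 < bl_dist (return borel 0) (return borel v)"
proof -
  have bp: "return borel x \<in> borel_probabilities" for x :: 'a
    by (simp add: borel_probabilities_def prob_space_return)
  define f where "f x = min 1 (norm x)" for x :: 'a
  have "1-lipschitz_on UNIV f"
  proof (rule lipschitz_onI)
    fix x y :: 'a
    show "dist (f x) (f y) \<le> 1 * dist x y"
      using norm_triangle_ineq3[of x y] by (auto simp: f_def dist_norm min_def)
  qed simp
  then have f: "f \<in> {f. (\<forall>x. \<bar>f x\<bar> \<le> 1) \<and> 1-lipschitz_on UNIV f}" by (auto simp: f_def)
  have fm: "f \<in> borel_measurable borel" unfolding f_def by measurable
  have "0 < \<bar>(\<integral>x. f x \<partial>return borel 0) - (\<integral>x. f x \<partial>return borel v)\<bar>"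
    using v by (simp add: integral_return fm) (simp add: f_def min_def)
  also have "\<dots> \<le> bl_dist (return borel 0) (return borel v)"
    unfolding bl_dist_def by (rule cSUP_upper[OF f bl_dist_bdd_above[OF bp bp]])
  finally show ?thesis .
qed

theorem proposition3p7:
  fixes A :: "real^'d^'d" and B :: "real^'p^'d" and C :: "real^'d^'q" and D :: "real^'r^'q"
    and M :: "(real^'d) measure \<Rightarrow> 'w measure"
    and W :: "(real^'d) measure \<Rightarrow> real \<Rightarrow> 'w \<Rightarrow> real^'p"
    and V :: "(real^'d) measure \<Rightarrow> real \<Rightarrow> 'w \<Rightarrow> real^'r"
    and X :: "(real^'d) measure \<Rightarrow> real \<Rightarrow> 'w \<Rightarrow> real^'d"
    and Y :: "(real^'d) measure \<Rightarrow> real \<Rightarrow> 'w \<Rightarrow> real^'q"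
  assumes model: "\<And>\<mu>. \<mu> \<in> borel_probabilities \<Longrightarrow>
      linear_filtering_model A B C D (M \<mu>) (W \<mu>) (V \<mu>) (X \<mu>) (Y \<mu>)"
    and initial: "\<And>\<mu>. \<mu> \<in> borel_probabilities \<Longrightarrow> distr (M \<mu>) borel (X \<mu> 0) = \<mu>"
  shows "uniformly_observable (\<lambda>\<mu>. signal_observation_law (M \<mu>) (X \<mu>) (Y \<mu>))
           \<longleftrightarrow> full_rank (observability_matrix A C)"
proof -
  have fm: "filtering_model A B C D (M \<mu>) (W \<mu>) (V \<mu>) (X \<mu>) (Y \<mu>)" if "\<mu> \<in> borel_probabilities" for \<mu>
    using model[OF that] by (rule filtering_model.intro)
  let ?law = "\<lambda>\<mu>. observation_law (M \<mu>) (X \<mu>) (Y \<mu>)"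
  have ret: "return borel x \<in> borel_probabilities" for x :: "real^'d"
    by (simp add: borel_probabilities_def prob_space_return)
  show ?thesis
  proof
    assume obs: "uniformly_observable (\<lambda>\<mu>. signal_observation_law (M \<mu>) (X \<mu>) (Y \<mu>))"
    show "full_rank (observability_matrix A C)"
      unfolding full_rank_observability_matrix
    proof (intro allI impI)
      fix v assume v: "\<forall>k. C *v (matrix_pow A k *v v) = 0"
      \<comment> \<open>Under a point mass the initial condition equals \<open>x\<close> almost
        surely, and an unobservable \<open>x\<close> leaves no trace in the observations. This is
        used for \<open>0\<close> and \<open>v\<close>.\<close>
      have init: "AE \<omega> in M (return borel x). \<forall>t. obs_flow A C t (X (return borel x) 0 \<omega>) = 0"
        if x: "\<forall>k. C *v (matrix_pow A k *v x) = 0" for x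
      proof -
        interpret filtering_model A B C D "M (return borel x)" "W (return borel x)" "V (return borel x)"
          "X (return borel x)" "Y (return borel x)" by (rule fm[OF ret])
        have X0: "X (return borel x) 0 \<in> borel_measurable (M (return borel x))" by (rule measurable_X) simp
        have "AE y in distr (M (return borel x)) borel (X (return borel x) 0). y = x"
          unfolding initial[OF ret] by (simp add: AE_return)
        then have "AE \<omega> in M (return borel x). X (return borel x) 0 \<omega> = x"
          by (rule AE_distrD[OF X0])
        then show ?thesis
        proof eventually_elim
          case (elim \<omega>)
          show ?case unfolding elim using obs_flow_eq_0[of C A x] x by blast
        qed
      qed
      have "?law (return borel 0) = ?law (return borel v)"
        by (rule same_observation_law[OF fm[OF ret] fm[OF ret]]) (rule init, use v in simp)+
      then have "(\<lambda>n::nat. tv_dist (?law (return borel 0)) (?law (return borel v))) \<longlonglongrightarrow> 0"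
        by (simp add: tv_dist_self)
      then have "(\<lambda>n::nat. bl_dist (return borel 0) (return borel v)) \<longlonglongrightarrow> 0"
        using obs[unfolded uniformly_observable_def, THEN spec, THEN spec, of "\<lambda>_. return borel 0" "\<lambda>_. return borel v"] ret
        by blast
      then have "bl_dist (return borel 0) (return borel v) = 0" by (rule LIMSEQ_unique[OF tendsto_const])
      then show "v = 0" using bl_dist_return_pos[of v] by force
    qed
  next
    assume rank: "full_rank (observability_matrix A C)"
    have "x = 0" if "\<And>t. t \<in> {0..} \<Longrightarrow> obs_flow A C t x = 0" for x
      using rank obs_flow_eq_0D[of A C x] that unfolding full_rank_observability_matrix by auto
    from finite_reconstruction[of "obs_flow A C" "{0..}", OF linear_obs_flow this]
    obtain F and P :: "real \<Rightarrow> real^'q^'d" where F: "finite F" "F \<subseteq> {0..}" and P: "\<And>x. (\<Sum>t\<in>F. P t *v obs_flow A C t x) = x"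
      by metis
    \<comment> \<open>The reconstruction as a function of the observation path alone, so that
      bounded functions of it are controlled by total variation on the observation field.\<close>
    define L where "L z = (\<Sum>t\<in>F. P t *v z t)" for z :: "real \<Rightarrow> real^'q"
    define \<alpha> where "\<alpha> \<mu> = distr (M \<mu>) borel (\<lambda>\<omega>. L (path (Y \<mu>) \<omega>))" for \<mu>
    have Lpath: "L (path Z \<omega>) = (\<Sum>t\<in>F. P t *v Z t \<omega>)" for Z and \<omega> :: 'w
      using F(2) unfolding L_def by (intro sum.cong) (auto simp: path_def)
    have Pm: "(\<lambda>y. P t *v y) \<in> borel_measurable borel" for t
      by (intro borel_measurable_continuous_onI continuous_intros)
    have Lm: "L \<in> borel_measurable path_space"
      unfolding L_def[abs_def] using F(2)
      by (intro borel_measurable_sum measurable_compose[OF path_space_component Pm]) auto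
    have "\<forall>m. \<exists>Q. (\<forall>i j. Q i j = Q j i) \<and> (\<forall>u. statistic_char A B C D F P m u = of_real (exp (- quad_form Q u / 2)))"
      by (intro allI, rule statistic_char_gaussian[OF F(1)], blast)
    then obtain Q where sym: "\<And>m i j. Q m i j = Q m j i" and
      Q: "\<And>m u. statistic_char A B C D F P m u = of_real (exp (- quad_form (Q m) u / 2))"
      by metis
    have \<alpha>: "\<alpha> \<mu> \<in> borel_probabilities"
      and lim: "(\<lambda>m. vchar \<mu> u * of_real (exp (- quad_form (Q m) u / 2))) \<longlonglongrightarrow> vchar (\<alpha> \<mu>) u"
      if mu: "\<mu> \<in> borel_probabilities" for \<mu> u
    proof -
      interpret filtering_model A B C D "M \<mu>" "W \<mu>" "V \<mu>" "X \<mu>" "Y \<mu>" by (rule fm[OF mu])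
      have "(\<lambda>\<omega>. L (path (Y \<mu>) \<omega>)) \<in> borel_measurable (M \<mu>)"
        using measurable_path[OF measurable_Y] Lm by (rule measurable_compose)
      then show "\<alpha> \<mu> \<in> borel_probabilities"
        unfolding borel_probabilities_def \<alpha>_def by (simp add: prob_space_distr)
      show "(\<lambda>m. vchar \<mu> u * of_real (exp (- quad_form (Q m) u / 2))) \<longlonglongrightarrow> vchar (\<alpha> \<mu>) u"
        using vchar_statistic_tendsto[OF F P, of u] unfolding Q initial[OF mu] \<alpha>_def Lpath .
    qed
    have one: "vchar (return borel (0::real^'d)) u = 1" for u
      unfolding vchar_def by (subst integral_return) auto
    \<comment> \<open>With initial law a point mass at 0 the factor \<open>vchar \<mu> u\<close> is
      1, so this realization isolates the limit of the noise factors and identifies it as a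
      characteristic function.\<close>
    have lim0: "(\<lambda>m. of_real (exp (- quad_form (Q m) u / 2))) \<longlonglongrightarrow> vchar (\<alpha> (return borel 0)) u" for u
      using lim[OF ret, of 0 u] by (simp add: one)
    obtain Q' where Q': "\<And>u. vchar (\<alpha> (return borel 0)) u = of_real (exp (- quad_form Q' u / 2))"
      using vchar_gaussian_limit[OF \<alpha>[OF ret] sym lim0] by metis
    \<comment> \<open>The forms \<open>Q m\<close> are the same for all initial laws, hence so is
      the limiting noise factor.\<close>
    have char: "gaussian_extension Q' \<mu> (\<alpha> \<mu>)" if mu: "\<mu> \<in> borel_probabilities" for \<mu>
      unfolding gaussian_extension_def
      using LIMSEQ_unique[OF lim[OF mu] tendsto_mult_left[OF lim0]] unfolding Q' by blast
    show "uniformly_observable (\<lambda>\<mu>. signal_observation_law (M \<mu>) (X \<mu>) (Y \<mu>))"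
      unfolding uniformly_observable_def
    proof (intro allI impI, elim conjE)
      fix \<mu> \<nu> :: "nat \<Rightarrow> (real^'d) measure"
      assume tv: "(\<lambda>n. tv_dist (?law (\<mu> n)) (?law (\<nu> n))) \<longlonglongrightarrow> 0"
        and "\<forall>n. \<mu> n \<in> borel_probabilities" "\<forall>n. \<nu> n \<in> borel_probabilities"
      then have m: "\<And>n. \<mu> n \<in> borel_probabilities" and n: "\<And>n. \<nu> n \<in> borel_probabilities" by auto
      \<comment> \<open>Composing \<open>g n\<close> with \<open>L\<close> gives a function of the
        observations bounded by 1, an admissible test function for \<open>tv_dist\<close>.\<close>
      have "asymptotically_equal (\<lambda>n. \<alpha> (\<mu> n)) (\<lambda>n. \<alpha> (\<nu> n))"
        unfolding asymptotically_equal_def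
      proof (intro allI impI)
        fix g :: "nat \<Rightarrow> real^'d \<Rightarrow> real" assume g: "\<forall>n. g n \<in> borel_measurable borel \<and> (\<forall>x. \<bar>g n x\<bar> \<le> 1)"
        have le: "norm ((\<integral>x. g k x \<partial>\<alpha> (\<mu> k)) - (\<integral>x. g k x \<partial>\<alpha> (\<nu> k))) \<le> tv_dist (?law (\<mu> k)) (?law (\<nu> k))" for k
        proof -
          interpret m: filtering_model A B C D "M (\<mu> k)" "W (\<mu> k)" "V (\<mu> k)" "X (\<mu> k)" "Y (\<mu> k)" by (rule fm[OF m])
          interpret n: filtering_model A B C D "M (\<nu> k)" "W (\<nu> k)" "V (\<nu> k)" "X (\<nu> k)" "Y (\<nu> k)" by (rule fm[OF n])
          have gm: "g k \<in> borel_measurable borel" using g by auto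
          have gL: "(\<lambda>z. g k (L z)) \<in> borel_measurable path_space" using Lm gm by (rule measurable_compose)
          note sm = subalgebra_observation_field[OF m.sets_law] and sn = subalgebra_observation_field[OF n.sets_law]
          let ?g = "\<lambda>z. g k (L (path (\<lambda>t z. snd (z t)) z))"
          have "\<bar>(\<integral>z. ?g z \<partial>?law (\<mu> k)) - (\<integral>z. ?g z \<partial>?law (\<nu> k))\<bar> \<le> tv_dist (?law (\<mu> k)) (?law (\<nu> k))"
          proof (rule tv_dist_upper)
            show "prob_space (?law (\<mu> k))" by (rule prob_space_restr_to_subalg[OF sm(1) m.prob_space_law])
            show "prob_space (?law (\<nu> k))" by (rule prob_space_restr_to_subalg[OF sn(1) n.prob_space_law])
            show "sets (?law (\<mu> k)) = sets (?law (\<nu> k))"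
              by (simp add: sets_restr_to_subalg[OF sm(1)] sets_restr_to_subalg[OF sn(1)])
            show "?g \<in> borel_measurable (?law (\<mu> k))"
              unfolding measurable_cong_sets[OF sets_restr_to_subalg[OF sm(1)] refl]
              using sm(2) gL by (rule measurable_compose)
          qed (use g in auto)
          moreover have "(\<integral>z. ?g z \<partial>?law (\<mu> k)) = (\<integral>x. g k x \<partial>\<alpha> (\<mu> k))"
            unfolding m.integral_observation[OF gL] \<alpha>_def
            by (rule integral_distr[OF measurable_compose[OF measurable_path[OF m.measurable_Y] Lm] gm, symmetric])
          moreover have "(\<integral>z. ?g z \<partial>?law (\<nu> k)) = (\<integral>x. g k x \<partial>\<alpha> (\<nu> k))"
            unfolding n.integral_observation[OF gL] \<alpha>_def
            by (rule integral_distr[OF measurable_compose[OF measurable_path[OF n.measurable_Y] Lm] gm, symmetric])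
          ultimately show ?thesis by simp
        qed
        show "(\<lambda>k. (\<integral>x. g k x \<partial>\<alpha> (\<mu> k)) - (\<integral>x. g k x \<partial>\<alpha> (\<nu> k))) \<longlonglongrightarrow> 0"
          by (rule Lim_null_comparison[OF always_eventually[OF allI[OF le]] tv])
      qed
      then show "(\<lambda>n. bl_dist (\<mu> n) (\<nu> n)) \<longlonglongrightarrow> 0"
        by (rule bl_dist_deconvolution[of \<mu> \<nu> "\<lambda>n. \<alpha> (\<mu> n)" "\<lambda>n. \<alpha> (\<nu> n)",
          OF m n \<alpha>[OF m] \<alpha>[OF n] char[OF m] char[OF n]])
    qed
  qed
qed

end
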